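(* Let $\Bbbk$ be a commutative ring, $(\Lambda,\le)$ a finite partially ordered set, and $\mathcal A$ a $\Bbbk$-linear category (or supercategory). For each $\lambda\in\Lambda$ take an object $X_\lambda\in\mathcal A$ and a subalgebra $B_\lambda\subset\operatorname{End}_{\mathcal A}(X_\lambda)$. Let $\mathcal A^\lambda$ be the 2-sided ideal of $\mathcal A$ generated by $X_\lambda$, i.e. $\mathcal A^\lambda(X,Y):=\operatorname{Hom}_{\mathcal A}(X_\lambda,Y)\circ\operatorname{Hom}_{\mathcal A}(X,X_\lambda)\subset\operatorname{Hom}_{\mathcal A}(X,Y)$ (the span of all such composites). Suppose that $$\operatorname{Hom}_{\mathcal A}(X_\mu,X_\lambda)=\sum_{\nu\le\lambda,\,\nu\le\mu}\mathcal A^\nu(X_\mu,X_\lambda)\quad\text{for all }\lambda,\mu\in\Lambda,$$ $$\operatorname{End}_{\mathcal A}(X_\lambda)=B_\lambda+\sum_{\mu<\lambda}\mathcal A^\mu(X_\lambda,X_\lambda)\quad\text{for all }\lambda\in\Lambda.$$ Then for every $\omega\in\Lambda$, $A:=\operatorname{End}_{\mathcal A}(X_\omega)$ is a standardly filtered algebra over $\{B_\lambda\}_{\lambda\in\Lambda}$. Here, with $\mathcal A^{<\lambda}:=\sum_{\mu<\lambda}\mathcal A^\mu$, the Morita contexts of the standard filter are given by $$A/A^{<\lambda}=\operatorname{End}_{\mathcal A/\mathcal A^{<\lambda}}(X_\omega),\quad M_\lambda=\operatorname{Hom}_{\mathcal A/\mathcal A^{<\lambda}}(X_\lambda,X_\omega),$$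 $$B_\lambda/B'_\lambda=\operatorname{End}_{\mathcal A/\mathcal A^{<\lambda}}(X_\lambda),\quad N_\lambda=\operatorname{Hom}_{\mathcal A/\mathcal A^{<\lambda}}(X_\omega,X_\lambda),$$ with structure homomorphisms given by composition of morphisms.
   Context: For a 2-sided ideal $\mathcal I$ of $\mathcal A$ (a family of subspaces $\mathcal I(X,Y)\subset\operatorname{Hom}_{\mathcal A}(X,Y)$ closed under composition with all morphisms), $\mathcal A/\mathcal I$ is the quotient category with the same objects and hom spaces $\operatorname{Hom}_{\mathcal A}(X,Y)/\mathcal I(X,Y)$. A $\Bbbk$-linear supercategory is a category enriched in $\Bbbk$-supermodules; in that case all algebras below are superalgebras. Morita context between algebras $A$, $B$: an $(A,B)$-bimodule $M$ and a $(B,A)$-bimodule $N$ with (degree-preserving) bimodule homomorphisms $\eta\colon M\otimes_BN\to A$, $\rho\colon N\otimes_AM\to B$ such that $\eta(x\otimes y)x'=x\rho(y\otimes x')$ and $\rho(y\otimes x)y'=y\eta(x\otimes y')$. The image of $\eta$ is its trace ideal in $A$. An ideal filter on $A$ indexed by $\Lambda$ is a family of 2-sided ideals $\{A^{\le\lambda}\}$ with $A^{\le\lambda}\subset A^{\le\mu}$ if $\lambda\le\mu$, $A=\sum_\lambda A^{\le\lambda}$, and $A^{\le\lambda}A^{\le\mu}\subset\sum_{\nu\le\lambda,\,\nu\le\mu}A^{\le\nu}$. Put $A^{<\lambda}:=\sum_{\mu<\lambda}A^{\le\mu}$. A standard filter of $A$ over $\{B_\lambda\}$ consists of an ideal filter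 $\{A^{\le\lambda}\}$ on $A$ and, for each $\lambda$, a 2-sided ideal $B'_\lambda\subset B_\lambda$ and a Morita context $(M_\lambda,N_\lambda)$ between $A/A^{<\lambda}$ and $B_\lambda/B'_\lambda$ whose trace ideal in $A/A^{<\lambda}$ is $A^{\le\lambda}/A^{<\lambda}$, such that $A^{\le\mu}M_\lambda=0$ and $N_\lambda A^{\le\mu}=0$ whenever $\lambda\not\le\mu$. An algebra equipped with a standard filter is a standardly filtered algebra. In the claim $A^{\le\lambda}=\sum_{\mu\le\lambda}\mathcal A^\mu(X_\omega,X_\omega)$ and $B'_\lambda$ is the kernel of $B_\lambda\to\operatorname{End}_{\mathcal A/\mathcal A^{<\lambda}}(X_\lambda)$. *)

theory Defs
  imports
    "HOL-Library.Z2"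
    "HOL-Algebra.Module"
    "HOL-Algebra.QuotRing"
    "HOL-Algebra.Ideal_Product"
    "HOL-Algebra.Free_Abelian_Groups"
begin

section \<open>Algebras, submodules and quotients\<close>

text \<open>The library locale \<^locale>\<open>algebra\<close> is commutative; here algebras are associative and unital.\<close>

locale k_algebra = module + ring M +
  assumes smult_mult_left:
      "\<lbrakk>a \<in> carrier R; x \<in> carrier M; y \<in> carrier M\<rbrakk> \<Longrightarrow>
       (a \<odot>\<^bsub>M\<^esub> x) \<otimes>\<^bsub>M\<^esub> y = a \<odot>\<^bsub>M\<^esub> (x \<otimes>\<^bsub>M\<^esub> y)"
    and smult_mult_right:
      "\<lbrakk>a \<in> carrier R; x \<in> carrier M; y \<in> carrier M\<rbrakk> \<Longrightarrow>
       x \<otimes>\<^bsub>M\<^esub> (a \<odot>\<^bsub>M\<^esub> y) = a \<odot>\<^bsub>M\<^esub> (x \<otimes>\<^bsub>M\<^esub> y)"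

definition subalg :: "('k, 'r) ring_scheme \<Rightarrow> ('k, 'a, 'z) module_scheme \<Rightarrow> 'a set \<Rightarrow> bool" where
  "subalg R A S \<longleftrightarrow> submodule S R A \<and> \<one>\<^bsub>A\<^esub> \<in> S \<and> (\<forall>x\<in>S. \<forall>y\<in>S. x \<otimes>\<^bsub>A\<^esub> y \<in> S)"

definition lin_span :: "('k, 'r) ring_scheme \<Rightarrow> ('k, 'a, 'z) module_scheme \<Rightarrow> 'a set \<Rightarrow> 'a set" where
  "lin_span R M S = \<Inter>{N. submodule N R M \<and> S \<subseteq> N}"

text \<open>The sum of the submodules \<open>F i\<close> over \<open>i \<in> P\<close>; the zero submodule if \<open>P\<close> is empty.\<close>

definition submod_sum ::
  "('k, 'r) ring_scheme \<Rightarrow> ('k, 'a, 'z) module_scheme \<Rightarrow> ('l \<Rightarrow> 'a set) \<Rightarrow> 'l set \<Rightarrow> 'a set" where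
  "submod_sum R M F P = lin_span R M (\<Union>i\<in>P. F i)"

text \<open>
  \<^const>\<open>FactRing\<close> together with the scalar action. It serves for quotients of algebras by ideals
  and of modules by submodules; in the second case the fields \<open>mult\<close> and \<open>one\<close> have no meaning.
\<close>

definition quot :: "('k, 'a, 'z) module_scheme \<Rightarrow> 'a set \<Rightarrow> ('k, 'a set) module" where
  "quot M I =
    \<lparr>carrier = a_rcosets\<^bsub>M\<^esub> I, mult = rcoset_mult M I, one = I +>\<^bsub>M\<^esub> \<one>\<^bsub>M\<^esub>,
     ring.zero = I, ring.add = set_add M, smult = (\<lambda>c D. \<Union>x\<in>D. I +>\<^bsub>M\<^esub> (c \<odot>\<^bsub>M\<^esub> x))\<rparr>"

definition alg_iso ::
  "('k, 'r) ring_scheme \<Rightarrow> ('k, 'a, 'y) module_scheme \<Rightarrow> ('k, 'b, 'z) module_scheme \<Rightarrow> ('a \<Rightarrow> 'b) set" where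
  "alg_iso R A B =
    {f \<in> ring_iso A B. \<forall>c\<in>carrier R. \<forall>x\<in>carrier A. f (c \<odot>\<^bsub>A\<^esub> x) = c \<odot>\<^bsub>B\<^esub> f x}"


section \<open>Bimodules and tensor products\<close>

record ('k, 'a, 'b, 'm) bimod = "('k, 'm) module" +
  lact :: "'a \<Rightarrow> 'm \<Rightarrow> 'm"
  ract :: "'m \<Rightarrow> 'b \<Rightarrow> 'm"

definition with_actions ::
  "('k, 'm) module \<Rightarrow> ('a \<Rightarrow> 'm \<Rightarrow> 'm) \<Rightarrow> ('m \<Rightarrow> 'b \<Rightarrow> 'm) \<Rightarrow> ('k, 'a, 'b, 'm) bimod" where
  "with_actions M l r = module.extend M (bimod.fields l r)"

locale bimodule =
  A: k_algebra R A + B: k_algebra R B + M: module R M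
  for R :: "('k, 'r) ring_scheme"
    and A :: "('k, 'a, 'y) module_scheme"
    and B :: "('k, 'b, 'z) module_scheme"
    and M :: "('k, 'a, 'b, 'm) bimod" +
  assumes lact_closed: "\<lbrakk>a \<in> carrier A; x \<in> carrier M\<rbrakk> \<Longrightarrow> lact M a x \<in> carrier M"
    and ract_closed: "\<lbrakk>x \<in> carrier M; b \<in> carrier B\<rbrakk> \<Longrightarrow> ract M x b \<in> carrier M"
    and lact_add_left: "\<lbrakk>a \<in> carrier A; a' \<in> carrier A; x \<in> carrier M\<rbrakk> \<Longrightarrow>
      lact M (a \<oplus>\<^bsub>A\<^esub> a') x = lact M a x \<oplus>\<^bsub>M\<^esub> lact M a' x"
    and lact_add_right: "\<lbrakk>a \<in> carrier A; x \<in> carrier M; x' \<in> carrier M\<rbrakk> \<Longrightarrow>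
      lact M a (x \<oplus>\<^bsub>M\<^esub> x') = lact M a x \<oplus>\<^bsub>M\<^esub> lact M a x'"
    and lact_mult: "\<lbrakk>a \<in> carrier A; a' \<in> carrier A; x \<in> carrier M\<rbrakk> \<Longrightarrow>
      lact M (a \<otimes>\<^bsub>A\<^esub> a') x = lact M a (lact M a' x)"
    and lact_one: "x \<in> carrier M \<Longrightarrow> lact M \<one>\<^bsub>A\<^esub> x = x"
    and lact_smult_left: "\<lbrakk>c \<in> carrier R; a \<in> carrier A; x \<in> carrier M\<rbrakk> \<Longrightarrow>
      lact M (c \<odot>\<^bsub>A\<^esub> a) x = c \<odot>\<^bsub>M\<^esub> lact M a x"
    and lact_smult_right: "\<lbrakk>c \<in> carrier R; a \<in> carrier A; x \<in> carrier M\<rbrakk> \<Longrightarrow>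
      lact M a (c \<odot>\<^bsub>M\<^esub> x) = c \<odot>\<^bsub>M\<^esub> lact M a x"
    and ract_add_left: "\<lbrakk>x \<in> carrier M; x' \<in> carrier M; b \<in> carrier B\<rbrakk> \<Longrightarrow>
      ract M (x \<oplus>\<^bsub>M\<^esub> x') b = ract M x b \<oplus>\<^bsub>M\<^esub> ract M x' b"
    and ract_add_right: "\<lbrakk>x \<in> carrier M; b \<in> carrier B; b' \<in> carrier B\<rbrakk> \<Longrightarrow>
      ract M x (b \<oplus>\<^bsub>B\<^esub> b') = ract M x b \<oplus>\<^bsub>M\<^esub> ract M x b'"
    and ract_mult: "\<lbrakk>x \<in> carrier M; b \<in> carrier B; b' \<in> carrier B\<rbrakk> \<Longrightarrow>
      ract M x (b \<otimes>\<^bsub>B\<^esub> b') = ract M (ract M x b) b'"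
    and ract_one: "x \<in> carrier M \<Longrightarrow> ract M x \<one>\<^bsub>B\<^esub> = x"
    and ract_smult_left: "\<lbrakk>c \<in> carrier R; x \<in> carrier M; b \<in> carrier B\<rbrakk> \<Longrightarrow>
      ract M (c \<odot>\<^bsub>M\<^esub> x) b = c \<odot>\<^bsub>M\<^esub> ract M x b"
    and ract_smult_right: "\<lbrakk>c \<in> carrier R; x \<in> carrier M; b \<in> carrier B\<rbrakk> \<Longrightarrow>
      ract M x (c \<odot>\<^bsub>B\<^esub> b) = c \<odot>\<^bsub>M\<^esub> ract M x b"
    and lact_ract: "\<lbrakk>a \<in> carrier A; x \<in> carrier M; b \<in> carrier B\<rbrakk> \<Longrightarrow>
      ract M (lact M a x) b = lact M a (ract M x b)"

definition regular_bimod :: "('k, 'a) module \<Rightarrow> ('k, 'a, 'a, 'a) bimod" where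
  "regular_bimod A = with_actions A (mult A) (mult A)"

definition bimod_hom ::
  "('k, 'r) ring_scheme \<Rightarrow> ('k, 'a, 'y) module_scheme \<Rightarrow> ('k, 'b, 'z) module_scheme \<Rightarrow>
   ('k, 'a, 'b, 'm) bimod \<Rightarrow> ('k, 'a, 'b, 'n) bimod \<Rightarrow> ('m \<Rightarrow> 'n) set" where
  "bimod_hom R A B M N =
    {f \<in> carrier M \<rightarrow> carrier N.
      (\<forall>x\<in>carrier M. \<forall>y\<in>carrier M. f (x \<oplus>\<^bsub>M\<^esub> y) = f x \<oplus>\<^bsub>N\<^esub> f y) \<and>
      (\<forall>c\<in>carrier R. \<forall>x\<in>carrier M. f (c \<odot>\<^bsub>M\<^esub> x) = c \<odot>\<^bsub>N\<^esub> f x) \<and>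
      (\<forall>a\<in>carrier A. \<forall>x\<in>carrier M. f (lact M a x) = lact N a (f x)) \<and>
      (\<forall>x\<in>carrier M. \<forall>b\<in>carrier B. f (ract M x b) = ract N (f x) b)}"

text \<open>
  The tensor product over the algebra \<open>B\<close> is the quotient of the free abelian group on
  \<open>carrier M \<times> carrier N\<close> by the subgroup generated by the biadditivity and \<open>B\<close>-balancing
  relations. As \<open>B\<close> is a unital algebra, the relation \<open>c x \<otimes> y = x \<otimes> c y\<close> for scalars \<open>c\<close> follows.
\<close>

definition tensor_free ::
  "('k, 'a, 'b, 'm) bimod \<Rightarrow> ('k, 'b, 'c, 'n) bimod \<Rightarrow> (('m \<times> 'n) \<Rightarrow>\<^sub>0 int) monoid" where
  "tensor_free M N = free_Abelian_group (carrier M \<times> carrier N)"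

definition tensor_rel ::
  "('k, 'b, 'z) module_scheme \<Rightarrow> ('k, 'a, 'b, 'm) bimod \<Rightarrow> ('k, 'b, 'c, 'n) bimod \<Rightarrow>
   (('m \<times> 'n) \<Rightarrow>\<^sub>0 int) set" where
  "tensor_rel B M N = generate (tensor_free M N)
    ({frag_of (x \<oplus>\<^bsub>M\<^esub> x', y) - frag_of (x, y) - frag_of (x', y) | x x' y.
        x \<in> carrier M \<and> x' \<in> carrier M \<and> y \<in> carrier N} \<union>
     {frag_of (x, y \<oplus>\<^bsub>N\<^esub> y') - frag_of (x, y) - frag_of (x, y') | x y y'.
        x \<in> carrier M \<and> y \<in> carrier N \<and> y' \<in> carrier N} \<union>
     {frag_of (ract M x b, y) - frag_of (x, lact N b y) | x b y.
        x \<in> carrier M \<and> b \<in> carrier B \<and> y \<in> carrier N})"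

definition pure_tensor ::
  "('k, 'b, 'z) module_scheme \<Rightarrow> ('k, 'a, 'b, 'm) bimod \<Rightarrow> ('k, 'b, 'c, 'n) bimod \<Rightarrow>
   'm \<Rightarrow> 'n \<Rightarrow> (('m \<times> 'n) \<Rightarrow>\<^sub>0 int) set" where
  "pure_tensor B M N x y = tensor_rel B M N #>\<^bsub>tensor_free M N\<^esub> frag_of (x, y)"

text \<open>The map on cosets induced by the additive extension of \<open>(x, y) \<mapsto> h (x, y)\<close>.\<close>

definition tensor_lift ::
  "('k, 'b, 'z) module_scheme \<Rightarrow> ('k, 'a, 'b, 'm) bimod \<Rightarrow> ('k, 'b, 'c, 'n) bimod \<Rightarrow>
   ('m \<times> 'n \<Rightarrow> 'm \<times> 'n) \<Rightarrow> (('m \<times> 'n) \<Rightarrow>\<^sub>0 int) set \<Rightarrow> (('m \<times> 'n) \<Rightarrow>\<^sub>0 int) set" where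
  "tensor_lift B M N h D =
    (\<Union>z\<in>D. tensor_rel B M N #>\<^bsub>tensor_free M N\<^esub> frag_extend (\<lambda>p. frag_of (h p)) z)"

definition tensor ::
  "('k, 'b, 'z) module_scheme \<Rightarrow> ('k, 'a, 'b, 'm) bimod \<Rightarrow> ('k, 'b, 'c, 'n) bimod \<Rightarrow>
   ('k, 'a, 'c, (('m \<times> 'n) \<Rightarrow>\<^sub>0 int) set) bimod" where
  "tensor B M N =
    \<lparr>carrier = rcosets\<^bsub>tensor_free M N\<^esub> (tensor_rel B M N),
     mult = undefined, one = undefined,
     ring.zero = tensor_rel B M N,
     ring.add = set_mult (tensor_free M N),
     smult = (\<lambda>c. tensor_lift B M N (\<lambda>(x, y). (c \<odot>\<^bsub>M\<^esub> x, y))),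
     lact = (\<lambda>a. tensor_lift B M N (\<lambda>(x, y). (lact M a x, y))),
     ract = (\<lambda>D c. tensor_lift B M N (\<lambda>(x, y). (x, ract N y c)) D)\<rparr>"


section \<open>Morita contexts and standard filters\<close>

definition morita_context ::
  "('k, 'r) ring_scheme \<Rightarrow> ('k, 'a) module \<Rightarrow> ('k, 'b) module \<Rightarrow>
   ('k, 'a, 'b, 'm) bimod \<Rightarrow> ('k, 'b, 'a, 'n) bimod \<Rightarrow>
   ((('m \<times> 'n) \<Rightarrow>\<^sub>0 int) set \<Rightarrow> 'a) \<Rightarrow> ((('n \<times> 'm) \<Rightarrow>\<^sub>0 int) set \<Rightarrow> 'b) \<Rightarrow> bool" where
  "morita_context R A B M N \<eta> \<rho> \<longleftrightarrow>
    bimodule R A B M \<and> bimodule R B A N \<and>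
    \<eta> \<in> bimod_hom R A A (tensor B M N) (regular_bimod A) \<and>
    \<rho> \<in> bimod_hom R B B (tensor A N M) (regular_bimod B) \<and>
    (\<forall>x\<in>carrier M. \<forall>y\<in>carrier N. \<forall>x'\<in>carrier M.
      lact M (\<eta> (pure_tensor B M N x y)) x' = ract M x (\<rho> (pure_tensor A N M y x'))) \<and>
    (\<forall>y\<in>carrier N. \<forall>x\<in>carrier M. \<forall>y'\<in>carrier N.
      lact N (\<rho> (pure_tensor A N M y x)) y' = ract N y (\<eta> (pure_tensor B M N x y')))"

definition trace_ideal ::
  "('k, 'b, 'z) module_scheme \<Rightarrow> ('k, 'a, 'b, 'm) bimod \<Rightarrow> ('k, 'b, 'a, 'n) bimod \<Rightarrow>
   ((('m \<times> 'n) \<Rightarrow>\<^sub>0 int) set \<Rightarrow> 'a) \<Rightarrow> 'a set" where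
  "trace_ideal B M N \<eta> = \<eta> ` carrier (tensor B M N)"

definition ideal_filter ::
  "('k, 'r) ring_scheme \<Rightarrow> ('k, 'a, 'z) module_scheme \<Rightarrow> ('l::order \<Rightarrow> 'a set) \<Rightarrow> bool" where
  "ideal_filter R A F \<longleftrightarrow>
    (\<forall>l. ideal (F l) A) \<and>
    (\<forall>l m. l \<le> m \<longrightarrow> F l \<subseteq> F m) \<and>
    carrier A = submod_sum R A F UNIV \<and>
    (\<forall>l m. ideal_prod A (F l) (F m) \<subseteq> submod_sum R A F ({..l} \<inter> {..m}))"

definition filter_below ::
  "('k, 'r) ring_scheme \<Rightarrow> ('k, 'a, 'z) module_scheme \<Rightarrow> ('l::order \<Rightarrow> 'a set) \<Rightarrow> 'l \<Rightarrow> 'a set" where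
  "filter_below R A F l = submod_sum R A F {..<l}"

text \<open>In the last two clauses \<open>A\<close> acts on \<open>M l\<close> and \<open>N l\<close> through its quotient by the lower part.\<close>

definition standard_filter ::
  "('k, 'r) ring_scheme \<Rightarrow> ('k, 'a) module \<Rightarrow> ('l::order \<Rightarrow> ('k, 'b) module) \<Rightarrow>
   ('l \<Rightarrow> 'a set) \<Rightarrow> ('l \<Rightarrow> 'b set) \<Rightarrow>
   ('l \<Rightarrow> ('k, 'a set, 'b set, 'm) bimod) \<Rightarrow> ('l \<Rightarrow> ('k, 'b set, 'a set, 'n) bimod) \<Rightarrow>
   ('l \<Rightarrow> (('m \<times> 'n) \<Rightarrow>\<^sub>0 int) set \<Rightarrow> 'a set) \<Rightarrow>
   ('l \<Rightarrow> (('n \<times> 'm) \<Rightarrow>\<^sub>0 int) set \<Rightarrow> 'b set) \<Rightarrow> bool" where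
  "standard_filter R A B F B' M N \<eta> \<rho> \<longleftrightarrow>
    k_algebra R A \<and> (\<forall>l. k_algebra R (B l)) \<and>
    ideal_filter R A F \<and>
    (\<forall>l. ideal (B' l) (B l)) \<and>
    (\<forall>l. morita_context R (quot A (filter_below R A F l)) (quot (B l) (B' l))
           (M l) (N l) (\<eta> l) (\<rho> l)) \<and>
    (\<forall>l. trace_ideal (quot (B l) (B' l)) (M l) (N l) (\<eta> l) =
           (\<lambda>a. filter_below R A F l +>\<^bsub>A\<^esub> a) ` F l) \<and>
    (\<forall>l m. \<not> l \<le> m \<longrightarrow>
      (\<forall>a\<in>F m. \<forall>x\<in>carrier (M l). lact (M l) (filter_below R A F l +>\<^bsub>A\<^esub> a) x = \<zero>\<^bsub>M l\<^esub>) \<and>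
      (\<forall>a\<in>F m. \<forall>y\<in>carrier (N l). ract (N l) y (filter_below R A F l +>\<^bsub>A\<^esub> a) = \<zero>\<^bsub>N l\<^esub>))"


section \<open>Linear categories\<close>

text \<open>
  \<open>cmp C X Y Z g f\<close> is the composite of \<open>f : X \<rightarrow> Y\<close> and \<open>g : Y \<rightarrow> Z\<close>. The ring fields \<open>mult\<close> and
  \<open>one\<close> of the record \<open>Hom C X Y\<close> have no meaning.
\<close>

record ('o, 'k, 'm) lincat =
  ob :: "'o set"
  Hom :: "'o \<Rightarrow> 'o \<Rightarrow> ('k, 'm) module"
  cmp :: "'o \<Rightarrow> 'o \<Rightarrow> 'o \<Rightarrow> 'm \<Rightarrow> 'm \<Rightarrow> 'm"
  ident :: "'o \<Rightarrow> 'm"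

locale linear_category = cring R
  for R :: "('k, 'r) ring_scheme" and C :: "('o, 'k, 'm) lincat" +
  assumes Hom_module: "\<lbrakk>X \<in> ob C; Y \<in> ob C\<rbrakk> \<Longrightarrow> module R (Hom C X Y)"
    and ident_closed: "X \<in> ob C \<Longrightarrow> ident C X \<in> carrier (Hom C X X)"
    and cmp_closed: "\<lbrakk>X \<in> ob C; Y \<in> ob C; Z \<in> ob C;
      g \<in> carrier (Hom C Y Z); f \<in> carrier (Hom C X Y)\<rbrakk> \<Longrightarrow>
      cmp C X Y Z g f \<in> carrier (Hom C X Z)"
    and cmp_assoc: "\<lbrakk>W \<in> ob C; X \<in> ob C; Y \<in> ob C; Z \<in> ob C;
      h \<in> carrier (Hom C Y Z); g \<in> carrier (Hom C X Y); f \<in> carrier (Hom C W X)\<rbrakk> \<Longrightarrow>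
      cmp C W X Z (cmp C X Y Z h g) f = cmp C W Y Z h (cmp C W X Y g f)"
    and cmp_ident_left: "\<lbrakk>X \<in> ob C; Y \<in> ob C; f \<in> carrier (Hom C X Y)\<rbrakk> \<Longrightarrow>
      cmp C X Y Y (ident C Y) f = f"
    and cmp_ident_right: "\<lbrakk>X \<in> ob C; Y \<in> ob C; f \<in> carrier (Hom C X Y)\<rbrakk> \<Longrightarrow>
      cmp C X X Y f (ident C X) = f"
    and cmp_add_left: "\<lbrakk>X \<in> ob C; Y \<in> ob C; Z \<in> ob C;
      g \<in> carrier (Hom C Y Z); g' \<in> carrier (Hom C Y Z); f \<in> carrier (Hom C X Y)\<rbrakk> \<Longrightarrow>
      cmp C X Y Z (g \<oplus>\<^bsub>Hom C Y Z\<^esub> g') f = cmp C X Y Z g f \<oplus>\<^bsub>Hom C X Z\<^esub> cmp C X Y Z g' f"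
    and cmp_add_right: "\<lbrakk>X \<in> ob C; Y \<in> ob C; Z \<in> ob C;
      g \<in> carrier (Hom C Y Z); f \<in> carrier (Hom C X Y); f' \<in> carrier (Hom C X Y)\<rbrakk> \<Longrightarrow>
      cmp C X Y Z g (f \<oplus>\<^bsub>Hom C X Y\<^esub> f') = cmp C X Y Z g f \<oplus>\<^bsub>Hom C X Z\<^esub> cmp C X Y Z g f'"
    and cmp_smult_left: "\<lbrakk>X \<in> ob C; Y \<in> ob C; Z \<in> ob C; c \<in> carrier R;
      g \<in> carrier (Hom C Y Z); f \<in> carrier (Hom C X Y)\<rbrakk> \<Longrightarrow>
      cmp C X Y Z (c \<odot>\<^bsub>Hom C Y Z\<^esub> g) f = c \<odot>\<^bsub>Hom C X Z\<^esub> cmp C X Y Z g f"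
    and cmp_smult_right: "\<lbrakk>X \<in> ob C; Y \<in> ob C; Z \<in> ob C; c \<in> carrier R;
      g \<in> carrier (Hom C Y Z); f \<in> carrier (Hom C X Y)\<rbrakk> \<Longrightarrow>
      cmp C X Y Z g (c \<odot>\<^bsub>Hom C X Y\<^esub> f) = c \<odot>\<^bsub>Hom C X Z\<^esub> cmp C X Y Z g f"

definition End_alg :: "('o, 'k, 'm) lincat \<Rightarrow> 'o \<Rightarrow> ('k, 'm) module" where
  "End_alg C X = (Hom C X X)\<lparr>mult := cmp C X X X, one := ident C X\<rparr>"

definition quot_cat :: "('o, 'k, 'm) lincat \<Rightarrow> ('o \<Rightarrow> 'o \<Rightarrow> 'm set) \<Rightarrow> ('o, 'k, 'm set) lincat" where
  "quot_cat C I =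
    \<lparr>ob = ob C,
     Hom = (\<lambda>X Y. quot (Hom C X Y) (I X Y)),
     cmp = (\<lambda>X Y Z G F. \<Union>g\<in>G. \<Union>f\<in>F. I X Z +>\<^bsub>Hom C X Z\<^esub> cmp C X Y Z g f),
     ident = (\<lambda>X. I X X +>\<^bsub>Hom C X X\<^esub> ident C X)\<rparr>"

definition gen_ideal ::
  "('k, 'r) ring_scheme \<Rightarrow> ('o, 'k, 'm) lincat \<Rightarrow> 'o \<Rightarrow> 'o \<Rightarrow> 'o \<Rightarrow> 'm set" where
  "gen_ideal R C Z X Y = lin_span R (Hom C X Y)
    {cmp C X Z Y g f | g f. g \<in> carrier (Hom C Z Y) \<and> f \<in> carrier (Hom C X Z)}"

text \<open>The ideal \<open>\<Sum>\<nu>\<in>P. \<A>\<^sup>\<nu>\<close>, where \<open>\<A>\<^sup>\<nu>\<close> is generated by \<open>X \<nu>\<close>.\<close>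

definition sum_ideal ::
  "('k, 'r) ring_scheme \<Rightarrow> ('o, 'k, 'm) lincat \<Rightarrow> ('l \<Rightarrow> 'o) \<Rightarrow> 'l set \<Rightarrow> 'o \<Rightarrow> 'o \<Rightarrow> 'm set" where
  "sum_ideal R C X P Y Z = submod_sum R (Hom C Y Z) (\<lambda>n. gen_ideal R C (X n) Y Z) P"

definition quot_below ::
  "('k, 'r) ring_scheme \<Rightarrow> ('o, 'k, 'm) lincat \<Rightarrow> ('l::order \<Rightarrow> 'o) \<Rightarrow> 'l \<Rightarrow> ('o, 'k, 'm set) lincat" where
  "quot_below R C X l = quot_cat C (sum_ideal R C X {..<l})"


section \<open>The standard filter on an endomorphism algebra\<close>

definition sub_End :: "('o, 'k, 'm) lincat \<Rightarrow> ('l \<Rightarrow> 'o) \<Rightarrow> ('l \<Rightarrow> 'm set) \<Rightarrow> 'l \<Rightarrow> ('k, 'm) module" where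
  "sub_End C X B l = (End_alg C (X l))\<lparr>carrier := B l\<rparr>"

definition End_filter ::
  "('k, 'r) ring_scheme \<Rightarrow> ('o, 'k, 'm) lincat \<Rightarrow> ('l::order \<Rightarrow> 'o) \<Rightarrow> 'l \<Rightarrow> 'l \<Rightarrow> 'm set" where
  "End_filter R C X w l = sum_ideal R C X {..l} (X w) (X w)"

definition proj_below ::
  "('k, 'r) ring_scheme \<Rightarrow> ('o, 'k, 'm) lincat \<Rightarrow> ('l::order \<Rightarrow> 'o) \<Rightarrow> 'l \<Rightarrow> 'm \<Rightarrow> 'm set" where
  "proj_below R C X l b = sum_ideal R C X {..<l} (X l) (X l) +>\<^bsub>Hom C (X l) (X l)\<^esub> b"

definition B_ker ::
  "('k, 'r) ring_scheme \<Rightarrow> ('o, 'k, 'm) lincat \<Rightarrow> ('l::order \<Rightarrow> 'o) \<Rightarrow> ('l \<Rightarrow> 'm set) \<Rightarrow> 'l \<Rightarrow> 'm set" where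
  "B_ker R C X B l =
    a_kernel (sub_End C X B l) (End_alg (quot_below R C X l) (X l)) (proj_below R C X l)"

text \<open>
  The map from the quotient of \<open>B l\<close> by \<^const>\<open>B_ker\<close> to the endomorphism algebra of \<open>X l\<close> in the
  quotient category that is induced by \<^const>\<open>proj_below\<close>. The algebra \<open>B l / B_ker\<close> acts on the
  bimodules below through it.
\<close>

definition canon ::
  "('k, 'r) ring_scheme \<Rightarrow> ('o, 'k, 'm) lincat \<Rightarrow> ('l::order \<Rightarrow> 'o) \<Rightarrow> 'l \<Rightarrow> 'm set \<Rightarrow> 'm set" where
  "canon R C X l D = (\<Union>b\<in>D. proj_below R C X l b)"

definition M_mod ::
  "('k, 'r) ring_scheme \<Rightarrow> ('o, 'k, 'm) lincat \<Rightarrow> ('l::order \<Rightarrow> 'o) \<Rightarrow> 'l \<Rightarrow> 'l \<Rightarrow>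
   ('k, 'm set, 'm set, 'm set) bimod" where
  "M_mod R C X w l = (let Q = quot_below R C X l in
    with_actions (Hom Q (X l) (X w))
      (\<lambda>a x. cmp Q (X l) (X w) (X w) a x)
      (\<lambda>x b. cmp Q (X l) (X l) (X w) x (canon R C X l b)))"

definition N_mod ::
  "('k, 'r) ring_scheme \<Rightarrow> ('o, 'k, 'm) lincat \<Rightarrow> ('l::order \<Rightarrow> 'o) \<Rightarrow> 'l \<Rightarrow> 'l \<Rightarrow>
   ('k, 'm set, 'm set, 'm set) bimod" where
  "N_mod R C X w l = (let Q = quot_below R C X l in
    with_actions (Hom Q (X w) (X l))
      (\<lambda>b y. cmp Q (X w) (X l) (X l) (canon R C X l b) y)
      (\<lambda>y a. cmp Q (X w) (X w) (X l) y a))"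


section \<open>Gradings by parity\<close>

text \<open>
  A super structure is an ordinary structure together with a decomposition \<open>g\<close> of the underlying
  module into an even part \<open>g 0\<close> and an odd part \<open>g 1\<close>; parities live in the type \<^typ>\<open>bit\<close> of integers
  modulo 2. The ground ring is even. Ideals and subalgebras of superalgebras are graded.
  No Koszul signs occur, because all structure maps are even.
\<close>

definition supermodule :: "('k, 'r) ring_scheme \<Rightarrow> ('k, 'a, 'z) module_scheme \<Rightarrow> (bit \<Rightarrow> 'a set) \<Rightarrow> bool" where
  "supermodule R M g \<longleftrightarrow> module R M \<and> (\<forall>d. submodule (g d) R M) \<and>
    carrier M = g 0 <+>\<^bsub>M\<^esub> g 1 \<and> g 0 \<inter> g 1 = {\<zero>\<^bsub>M\<^esub>}"

definition graded_sub :: "('k, 'a, 'z) module_scheme \<Rightarrow> (bit \<Rightarrow> 'a set) \<Rightarrow> 'a set \<Rightarrow> bool" where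
  "graded_sub M g S \<longleftrightarrow> S = (S \<inter> g 0) <+>\<^bsub>M\<^esub> (S \<inter> g 1)"

definition superalgebra :: "('k, 'r) ring_scheme \<Rightarrow> ('k, 'a, 'z) module_scheme \<Rightarrow> (bit \<Rightarrow> 'a set) \<Rightarrow> bool" where
  "superalgebra R A g \<longleftrightarrow> k_algebra R A \<and> supermodule R A g \<and> \<one>\<^bsub>A\<^esub> \<in> g 0 \<and>
    (\<forall>d e. \<forall>x\<in>g d. \<forall>y\<in>g e. x \<otimes>\<^bsub>A\<^esub> y \<in> g (d + e))"

definition quot_grading ::
  "('k, 'a, 'z) module_scheme \<Rightarrow> 'a set \<Rightarrow> (bit \<Rightarrow> 'a set) \<Rightarrow> bit \<Rightarrow> 'a set set" where
  "quot_grading M I g d = (\<lambda>x. I +>\<^bsub>M\<^esub> x) ` g d"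

definition superbimodule ::
  "('k, 'r) ring_scheme \<Rightarrow> ('k, 'a, 'y) module_scheme \<Rightarrow> (bit \<Rightarrow> 'a set) \<Rightarrow>
   ('k, 'b, 'z) module_scheme \<Rightarrow> (bit \<Rightarrow> 'b set) \<Rightarrow>
   ('k, 'a, 'b, 'm) bimod \<Rightarrow> (bit \<Rightarrow> 'm set) \<Rightarrow> bool" where
  "superbimodule R A gA B gB M gM \<longleftrightarrow> bimodule R A B M \<and> supermodule R M gM \<and>
    (\<forall>d e. \<forall>a\<in>gA d. \<forall>x\<in>gM e. lact M a x \<in> gM (d + e)) \<and>
    (\<forall>d e. \<forall>x\<in>gM d. \<forall>b\<in>gB e. ract M x b \<in> gM (d + e))"

definition tensor_grading ::
  "('k, 'r) ring_scheme \<Rightarrow> ('k, 'b, 'z) module_scheme \<Rightarrow>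
   ('k, 'a, 'b, 'm) bimod \<Rightarrow> (bit \<Rightarrow> 'm set) \<Rightarrow> ('k, 'b, 'c, 'n) bimod \<Rightarrow> (bit \<Rightarrow> 'n set) \<Rightarrow>
   bit \<Rightarrow> (('m \<times> 'n) \<Rightarrow>\<^sub>0 int) set set" where
  "tensor_grading R B M gM N gN d = lin_span R (tensor B M N)
    {pure_tensor B M N x y | x y i j. x \<in> gM i \<and> y \<in> gN j \<and> i + j = d}"

definition super_morita_context ::
  "('k, 'r) ring_scheme \<Rightarrow> ('k, 'a) module \<Rightarrow> (bit \<Rightarrow> 'a set) \<Rightarrow> ('k, 'b) module \<Rightarrow> (bit \<Rightarrow> 'b set) \<Rightarrow>
   ('k, 'a, 'b, 'm) bimod \<Rightarrow> (bit \<Rightarrow> 'm set) \<Rightarrow> ('k, 'b, 'a, 'n) bimod \<Rightarrow> (bit \<Rightarrow> 'n set) \<Rightarrow>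
   ((('m \<times> 'n) \<Rightarrow>\<^sub>0 int) set \<Rightarrow> 'a) \<Rightarrow> ((('n \<times> 'm) \<Rightarrow>\<^sub>0 int) set \<Rightarrow> 'b) \<Rightarrow> bool" where
  "super_morita_context R A gA B gB M gM N gN \<eta> \<rho> \<longleftrightarrow>
    morita_context R A B M N \<eta> \<rho> \<and>
    superalgebra R A gA \<and> superalgebra R B gB \<and>
    superbimodule R A gA B gB M gM \<and> superbimodule R B gB A gA N gN \<and>
    (\<forall>d. \<eta> ` tensor_grading R B M gM N gN d \<subseteq> gA d) \<and>
    (\<forall>d. \<rho> ` tensor_grading R A N gN M gM d \<subseteq> gB d)"

definition super_standard_filter ::
  "('k, 'r) ring_scheme \<Rightarrow> ('k, 'a) module \<Rightarrow> (bit \<Rightarrow> 'a set) \<Rightarrow>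
   ('l::order \<Rightarrow> ('k, 'b) module) \<Rightarrow> ('l \<Rightarrow> bit \<Rightarrow> 'b set) \<Rightarrow>
   ('l \<Rightarrow> 'a set) \<Rightarrow> ('l \<Rightarrow> 'b set) \<Rightarrow>
   ('l \<Rightarrow> ('k, 'a set, 'b set, 'm) bimod) \<Rightarrow> ('l \<Rightarrow> bit \<Rightarrow> 'm set) \<Rightarrow>
   ('l \<Rightarrow> ('k, 'b set, 'a set, 'n) bimod) \<Rightarrow> ('l \<Rightarrow> bit \<Rightarrow> 'n set) \<Rightarrow>
   ('l \<Rightarrow> (('m \<times> 'n) \<Rightarrow>\<^sub>0 int) set \<Rightarrow> 'a set) \<Rightarrow>
   ('l \<Rightarrow> (('n \<times> 'm) \<Rightarrow>\<^sub>0 int) set \<Rightarrow> 'b set) \<Rightarrow> bool" where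
  "super_standard_filter R A gA B gB F B' M gM N gN \<eta> \<rho> \<longleftrightarrow>
    standard_filter R A B F B' M N \<eta> \<rho> \<and>
    superalgebra R A gA \<and> (\<forall>l. superalgebra R (B l) (gB l)) \<and>
    (\<forall>l. graded_sub A gA (F l)) \<and> (\<forall>l. graded_sub (B l) (gB l) (B' l)) \<and>
    (\<forall>l. super_morita_context R
      (quot A (filter_below R A F l)) (quot_grading A (filter_below R A F l) gA)
      (quot (B l) (B' l)) (quot_grading (B l) (B' l) (gB l))
      (M l) (gM l) (N l) (gN l) (\<eta> l) (\<rho> l))"

text \<open>A category enriched in supermodules over \<open>R\<close> and their even maps.\<close>

definition supercategory ::
  "('k, 'r) ring_scheme \<Rightarrow> ('o, 'k, 'm) lincat \<Rightarrow> ('o \<Rightarrow> 'o \<Rightarrow> bit \<Rightarrow> 'm set) \<Rightarrow> bool" where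
  "supercategory R C gr \<longleftrightarrow> linear_category R C \<and>
    (\<forall>X\<in>ob C. \<forall>Y\<in>ob C. supermodule R (Hom C X Y) (gr X Y)) \<and>
    (\<forall>X\<in>ob C. ident C X \<in> gr X X 0) \<and>
    (\<forall>X\<in>ob C. \<forall>Y\<in>ob C. \<forall>Z\<in>ob C. \<forall>d e. \<forall>g\<in>gr Y Z d. \<forall>f\<in>gr X Y e.
      cmp C X Y Z g f \<in> gr X Z (d + e))"

definition below_grading ::
  "('k, 'r) ring_scheme \<Rightarrow> ('o, 'k, 'm) lincat \<Rightarrow> ('l::order \<Rightarrow> 'o) \<Rightarrow> 'l \<Rightarrow>
   ('o \<Rightarrow> 'o \<Rightarrow> bit \<Rightarrow> 'm set) \<Rightarrow> 'o \<Rightarrow> 'o \<Rightarrow> bit \<Rightarrow> 'm set set" where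
  "below_grading R C X l gr Y Z = quot_grading (Hom C Y Z) (sum_ideal R C X {..<l} Y Z) (gr Y Z)"

end

theory Submission
  imports Defs
begin

text \<open>
  For any linear category and objects \<open>X\<close>, \<open>Y\<close>, composition makes \<open>Hom(X, Y)\<close> and \<open>Hom(Y, X)\<close> a Morita
  context between \<open>End(Y)\<close> and \<open>End(X)\<close>: composition is balanced, so it factors through the tensor
  products, and the Morita identities are associativity. Its trace ideal in \<open>End(Y)\<close> consists of the
  endomorphisms that are sums of maps factoring through \<open>X\<close>. Apply this in the quotient category \<open>\<A>/\<A>\<^sup><\<^sup>\<lambda>\<close>
  to \<open>X\<^sub>\<lambda>\<close> and \<open>X\<^sub>\<omega>\<close>. The hypothesis on \<open>End(X\<^sub>\<lambda>)\<close> says precisely that \<open>B\<^sub>\<lambda>\<close> surjects onto the endomorphism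
  algebra of \<open>X\<^sub>\<lambda>\<close> there. The hypothesis on \<open>Hom(X\<^sub>\<mu>, X\<^sub>\<lambda>)\<close> gives the remaining axioms of the filter: a
  composite \<open>X\<^sub>\<omega> \<rightarrow> X\<^sub>\<mu> \<rightarrow> X\<^sub>\<omega> \<rightarrow> X\<^sub>\<lambda> \<rightarrow> X\<^sub>\<omega>\<close> has a middle part \<open>X\<^sub>\<mu> \<rightarrow> X\<^sub>\<lambda>\<close>, which factors through objects \<open>X\<^sub>\<nu>\<close> with
  \<open>\<nu> \<le> \<lambda>\<close> and \<open>\<nu> \<le> \<mu>\<close>. In the super case all ideals involved are spanned by homogeneous composites, so every
  quotient inherits its grading.
\<close>

section \<open>Submodules, spans and quotient modules\<close>

text \<open>The tensor product is a set of cosets in a free abelian group whose actions are unions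
  over representatives, and it is never shown to be a module. Facts about it are therefore checked
  on integer combinations of pairs and then moved to cosets, and linearity of \<eta> and \<rho> is
  passed on in the form that preimages of submodules are submodules. A second obstacle is that the
  quotient of \<open>B l\<close> by \<open>B_ker\<close> is not literally the endomorphism algebra
  of \<open>X l\<close> in the quotient category: the bimodules see it through \<open>canon\<close>,
  so \<eta> is composition itself, while \<rho> is composition pulled back along the inverse of
  \<open>canon\<close>. The factorization of morphisms \<open>X m \<rightarrow> X l\<close> does
  double duty. Besides the product axiom it gives the annihilation conditions, because an index
  below both \<open>l\<close> and \<open>m\<close> cannot be \<open>l\<close> unless
  \<open>l \<le> m\<close>. Finally, one choice of \<eta> and \<rho> must serve every grading, so
  they are fixed by conditions that mention no parity. Parity preservation is then read off from
  pure tensors; for \<rho> it rests on \<open>B l\<close> being graded, which supplies homogeneous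
  representatives in \<open>B l\<close> of homogeneous classes.\<close>

definition lin_maps ::
  "('k, 'r) ring_scheme \<Rightarrow> ('k, 'a, 'y) module_scheme \<Rightarrow> ('k, 'b, 'z) module_scheme \<Rightarrow> ('a \<Rightarrow> 'b) set" where
  "lin_maps R M N =
    {f \<in> carrier M \<rightarrow> carrier N.
      (\<forall>x\<in>carrier M. \<forall>y\<in>carrier M. f (x \<oplus>\<^bsub>M\<^esub> y) = f x \<oplus>\<^bsub>N\<^esub> f y) \<and>
      (\<forall>c\<in>carrier R. \<forall>x\<in>carrier M. f (c \<odot>\<^bsub>M\<^esub> x) = c \<odot>\<^bsub>N\<^esub> f x)}"

lemma lin_mapsI:
  assumes "\<And>x. x \<in> carrier M \<Longrightarrow> f x \<in> carrier N"
    and "\<And>x y. \<lbrakk>x \<in> carrier M; y \<in> carrier M\<rbrakk> \<Longrightarrow> f (x \<oplus>\<^bsub>M\<^esub> y) = f x \<oplus>\<^bsub>N\<^esub> f y"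
    and "\<And>c x. \<lbrakk>c \<in> carrier R; x \<in> carrier M\<rbrakk> \<Longrightarrow> f (c \<odot>\<^bsub>M\<^esub> x) = c \<odot>\<^bsub>N\<^esub> f x"
  shows "f \<in> lin_maps R M N"
  using assms by (auto simp: lin_maps_def)

lemma lin_mapsD:
  assumes "f \<in> lin_maps R M N"
  shows "x \<in> carrier M \<Longrightarrow> f x \<in> carrier N"
    and "\<lbrakk>x \<in> carrier M; y \<in> carrier M\<rbrakk> \<Longrightarrow> f (x \<oplus>\<^bsub>M\<^esub> y) = f x \<oplus>\<^bsub>N\<^esub> f y"
    and "\<lbrakk>c \<in> carrier R; x \<in> carrier M\<rbrakk> \<Longrightarrow> f (c \<odot>\<^bsub>M\<^esub> x) = c \<odot>\<^bsub>N\<^esub> f x"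
  using assms by (auto simp: lin_maps_def)

lemma lin_maps_zero:
  assumes "module R M" "module R N" "f \<in> lin_maps R M N"
  shows "f \<zero>\<^bsub>M\<^esub> = \<zero>\<^bsub>N\<^esub>"
proof -
  interpret M: module R M by fact
  interpret N: module R N by fact
  have "f \<zero>\<^bsub>M\<^esub> = f (\<zero>\<^bsub>R\<^esub> \<odot>\<^bsub>M\<^esub> \<zero>\<^bsub>M\<^esub>)" by simp
  also have "\<dots> = \<zero>\<^bsub>N\<^esub>"
    using lin_mapsD[OF assms(3)] by (simp del: M.smult_l_null M.smult_r_null)
  finally show ?thesis .
qed

lemma lin_maps_a_inv:
  assumes "module R M" "module R N" "f \<in> lin_maps R M N" "x \<in> carrier M"
  shows "f (\<ominus>\<^bsub>M\<^esub> x) = \<ominus>\<^bsub>N\<^esub> f x"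
proof -
  interpret M: module R M by fact
  interpret N: module R N by fact
  note f = lin_mapsD[OF assms(3)]
  have "f (\<ominus>\<^bsub>M\<^esub> x) \<oplus>\<^bsub>N\<^esub> f x = \<zero>\<^bsub>N\<^esub>"
    using f(2)[of "\<ominus>\<^bsub>M\<^esub> x" x] assms(4) lin_maps_zero[OF assms(1-3)] by (simp add: M.l_neg)
  then show ?thesis
    using assms(4) f(1) by (metis M.a_inv_closed N.minus_equality)
qed

lemma submoduleD:
  assumes "submodule H R M"
  shows "x \<in> H \<Longrightarrow> x \<in> carrier M" "\<zero>\<^bsub>M\<^esub> \<in> H"
    "\<lbrakk>x \<in> H; y \<in> H\<rbrakk> \<Longrightarrow> x \<oplus>\<^bsub>M\<^esub> y \<in> H"
    "x \<in> H \<Longrightarrow> \<ominus>\<^bsub>M\<^esub> x \<in> H"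
    "\<lbrakk>c \<in> carrier R; x \<in> H\<rbrakk> \<Longrightarrow> c \<odot>\<^bsub>M\<^esub> x \<in> H"
proof -
  interpret submodule H R M by fact
  show "x \<in> H \<Longrightarrow> x \<in> carrier M" "\<zero>\<^bsub>M\<^esub> \<in> H"
    "\<lbrakk>x \<in> H; y \<in> H\<rbrakk> \<Longrightarrow> x \<oplus>\<^bsub>M\<^esub> y \<in> H" "x \<in> H \<Longrightarrow> \<ominus>\<^bsub>M\<^esub> x \<in> H"
    "\<lbrakk>c \<in> carrier R; x \<in> H\<rbrakk> \<Longrightarrow> c \<odot>\<^bsub>M\<^esub> x \<in> H"
    using subset one_closed m_closed[of x y] m_inv_closed[of x] by (auto simp: a_inv_def)
qed

text \<open>\<open>End_alg\<close> and \<open>with_actions\<close> change only the multiplicative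
  fields or add actions, while a submodule sees carrier, addition, zero and scalars. This and the
  two congruences below move facts between such records and the underlying Hom module.\<close>

lemma submodule_cong:
  assumes "carrier M' = carrier M" "ring.add M' = ring.add M" "\<zero>\<^bsub>M'\<^esub> = \<zero>\<^bsub>M\<^esub>" "smult M' = smult M"
  shows "submodule H R M' \<longleftrightarrow> submodule H R M"
  using assms by (simp add: submodule_def submodule_axioms_def subgroup_def m_inv_def)

lemma lin_span_cong:
  assumes "carrier M' = carrier M" "ring.add M' = ring.add M" "\<zero>\<^bsub>M'\<^esub> = \<zero>\<^bsub>M\<^esub>" "smult M' = smult M"
  shows "lin_span R M' S = lin_span R M S"
  unfolding lin_span_def by (simp add: submodule_cong[OF assms])

lemma module_cong:
  assumes "carrier M' = carrier M" "ring.add M' = ring.add M" "\<zero>\<^bsub>M'\<^esub> = \<zero>\<^bsub>M\<^esub>" "smult M' = smult M"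
  shows "module R M' \<longleftrightarrow> module R M"
  using assms
  by (simp add: module_def module_axioms_def abelian_group_def abelian_monoid_def
      abelian_group_axioms_def comm_group_def group_def group_axioms_def comm_monoid_def
      comm_monoid_axioms_def monoid_def Units_def)

lemma submodule_preimage:
  assumes "module R M" "module R N" "f \<in> lin_maps R M N" "submodule H R N"
  shows "submodule {x \<in> carrier M. f x \<in> H} R M"
proof -
  interpret M: module R M by fact
  note f = lin_mapsD[OF assms(3)] and H = submoduleD[OF assms(4)]
  show ?thesis
    using H f lin_maps_zero[OF assms(1-3)] lin_maps_a_inv[OF assms(1-3)]
    by (intro M.submoduleI) auto
qed

lemma submodule_image:
  assumes "module R M" "module R N" "f \<in> lin_maps R M N" "submodule H R M"
  shows "submodule (f ` H) R N"
proof -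
  interpret N: module R N by fact
  note f = lin_mapsD[OF assms(3)] and H = submoduleD[OF assms(4)]
  show ?thesis
  proof (rule N.submoduleI)
    show "\<zero>\<^bsub>N\<^esub> \<in> f ` H" using H(2) lin_maps_zero[OF assms(1-3)] by (metis imageI)
    show "\<ominus>\<^bsub>N\<^esub> a \<in> f ` H" if a: "a \<in> f ` H" for a
    proof -
      obtain h where h: "h \<in> H" "a = f h" using a by blast
      then have "\<ominus>\<^bsub>N\<^esub> a = f (\<ominus>\<^bsub>M\<^esub> h)" using lin_maps_a_inv[OF assms(1-3)] H(1) by simp
      then show ?thesis using h H(4) by blast
    qed
    show "a \<oplus>\<^bsub>N\<^esub> b \<in> f ` H" if ab: "a \<in> f ` H" "b \<in> f ` H" for a b
    proof -
      obtain h k where h: "h \<in> H" "a = f h" "k \<in> H" "b = f k" using ab by blast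
      then have "a \<oplus>\<^bsub>N\<^esub> b = f (h \<oplus>\<^bsub>M\<^esub> k)" using f(2) H(1) by simp
      then show ?thesis using h H(3) by blast
    qed
    show "c \<odot>\<^bsub>N\<^esub> a \<in> f ` H" if ca: "c \<in> carrier R" "a \<in> f ` H" for c a
    proof -
      obtain h where h: "h \<in> H" "a = f h" using ca by blast
      then have "c \<odot>\<^bsub>N\<^esub> a = f (c \<odot>\<^bsub>M\<^esub> h)" using f(3) H(1) ca by simp
      then show ?thesis using h H(5) ca by blast
    qed
  qed (use f(1) H(1) in auto)
qed

lemma submodule_Int:
  assumes "module R M" "submodule H R M" "submodule K R M"
  shows "submodule (H \<inter> K) R M"
proof -
  interpret M: module R M by fact
  show ?thesis
    using submoduleD[OF assms(2)] submoduleD[OF assms(3)] by (intro M.submoduleI) auto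
qed

lemma set_addI: "\<lbrakk>h \<in> H; k \<in> K\<rbrakk> \<Longrightarrow> h \<oplus>\<^bsub>M\<^esub> k \<in> H <+>\<^bsub>M\<^esub> K"
  by (auto simp: set_add_def')

lemma set_addE:
  assumes "x \<in> H <+>\<^bsub>M\<^esub> K"
  obtains h k where "h \<in> H" "k \<in> K" "x = h \<oplus>\<^bsub>M\<^esub> k"
  using assms by (auto simp: set_add_def')

lemma submodule_set_add:
  assumes "module R M" "submodule H R M" "submodule K R M"
  shows "submodule (H <+>\<^bsub>M\<^esub> K) R M"
proof -
  interpret M: module R M by fact
  note H = submoduleD[OF assms(2)] and K = submoduleD[OF assms(3)]
  show ?thesis
  proof (rule M.submoduleI)
    show "H <+>\<^bsub>M\<^esub> K \<subseteq> carrier M" using H(1) K(1) by (auto simp: set_add_def')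
    show "\<zero>\<^bsub>M\<^esub> \<in> H <+>\<^bsub>M\<^esub> K" using H(2) K(2) by (force simp: set_add_def')
    show "\<ominus>\<^bsub>M\<^esub> a \<in> H <+>\<^bsub>M\<^esub> K" if a: "a \<in> H <+>\<^bsub>M\<^esub> K" for a
    proof -
      obtain h k where h: "h \<in> H" "k \<in> K" "a = h \<oplus>\<^bsub>M\<^esub> k" using a by (auto simp: set_add_def')
      then have "\<ominus>\<^bsub>M\<^esub> a = \<ominus>\<^bsub>M\<^esub> h \<oplus>\<^bsub>M\<^esub> \<ominus>\<^bsub>M\<^esub> k" using H K by (simp add: M.minus_add)
      then show ?thesis using h H(4) K(4) by (auto intro!: set_addI)
    qed
    show "a \<oplus>\<^bsub>M\<^esub> b \<in> H <+>\<^bsub>M\<^esub> K" if ab: "a \<in> H <+>\<^bsub>M\<^esub> K" "b \<in> H <+>\<^bsub>M\<^esub> K" for a b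
    proof -
      obtain h k h' k' where h: "h \<in> H" "k \<in> K" "a = h \<oplus>\<^bsub>M\<^esub> k" "h' \<in> H" "k' \<in> K" "b = h' \<oplus>\<^bsub>M\<^esub> k'"
        using ab by (auto simp: set_add_def')
      then have "a \<oplus>\<^bsub>M\<^esub> b = (h \<oplus>\<^bsub>M\<^esub> h') \<oplus>\<^bsub>M\<^esub> (k \<oplus>\<^bsub>M\<^esub> k')" using H(1) K(1) by (simp add: M.a_ac)
      then show ?thesis using h H(3) K(3) by (auto intro!: set_addI)
    qed
    show "c \<odot>\<^bsub>M\<^esub> a \<in> H <+>\<^bsub>M\<^esub> K" if ca: "c \<in> carrier R" "a \<in> H <+>\<^bsub>M\<^esub> K" for c a
    proof -
      obtain h k where h: "h \<in> H" "k \<in> K" "a = h \<oplus>\<^bsub>M\<^esub> k" using ca by (auto simp: set_add_def')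
      then have "c \<odot>\<^bsub>M\<^esub> a = c \<odot>\<^bsub>M\<^esub> h \<oplus>\<^bsub>M\<^esub> c \<odot>\<^bsub>M\<^esub> k" using H(1) K(1) ca by (simp add: M.smult_r_distr)
      then show ?thesis using h H(5) K(5) ca by (auto intro!: set_addI)
    qed
  qed
qed

lemma lin_span_incl: "S \<subseteq> lin_span R M S"
  by (auto simp: lin_span_def)

lemma lin_span_least: "\<lbrakk>submodule H R M; S \<subseteq> H\<rbrakk> \<Longrightarrow> lin_span R M S \<subseteq> H"
  by (auto simp: lin_span_def)

lemma lin_span_submodule:
  assumes "module R M" "S \<subseteq> carrier M"
  shows "submodule (lin_span R M S) R M"
proof -
  interpret M: module R M by fact
  have "lin_span R M S \<subseteq> carrier M"
    using assms M.carrier_is_submodule by (intro lin_span_least)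
  then show ?thesis
    by (intro M.submoduleI) (auto simp: lin_span_def dest: submoduleD)
qed

lemma lin_span_mono: "S \<subseteq> T \<Longrightarrow> lin_span R M S \<subseteq> lin_span R M T"
  by (auto simp: lin_span_def)

text \<open>The preimage of a submodule under a linear map is a submodule, so minimality of the span
  reduces the claim to generators. Since spans are intersections, this takes the place of an
  induction over linear combinations.\<close>

lemma lin_span_map_in:
  assumes "module R M" "module R N" "f \<in> lin_maps R M N" "submodule H R N"
    and "S \<subseteq> carrier M" "\<And>s. s \<in> S \<Longrightarrow> f s \<in> H" "x \<in> lin_span R M S"
  shows "f x \<in> H"
proof -
  have "lin_span R M S \<subseteq> {x \<in> carrier M. f x \<in> H}"
    using assms(5,6) by (intro lin_span_least submodule_preimage[OF assms(1-4)]) auto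
  then show ?thesis using assms(7) by blast
qed

text \<open>One inclusion is a test on generators; the other holds because the image of the span is
  itself a submodule containing the image of \<open>S\<close>.\<close>

lemma lin_span_image:
  assumes M: "module R M" and N: "module R N" and f: "f \<in> lin_maps R M N" and S: "S \<subseteq> carrier M"
  shows "f ` lin_span R M S = lin_span R N (f ` S)"
proof
  have "f ` S \<subseteq> carrier N" using lin_mapsD(1)[OF f] S by blast
  then show "f ` lin_span R M S \<subseteq> lin_span R N (f ` S)"
    using lin_span_map_in[OF M N f lin_span_submodule[OF N] S] lin_span_incl[of "f ` S" R N] by blast
  show "lin_span R N (f ` S) \<subseteq> f ` lin_span R M S"
    using lin_span_incl[of S R M]
    by (intro lin_span_least submodule_image[OF M N f] lin_span_submodule[OF M S]) blast
qed

lemma submod_sum_incl: "i \<in> P \<Longrightarrow> F i \<subseteq> submod_sum R M F P"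
  unfolding submod_sum_def by (rule order_trans[OF _ lin_span_incl]) blast

lemma submod_sum_least: "\<lbrakk>submodule H R M; \<And>i. i \<in> P \<Longrightarrow> F i \<subseteq> H\<rbrakk> \<Longrightarrow> submod_sum R M F P \<subseteq> H"
  unfolding submod_sum_def by (rule lin_span_least) auto

lemma submod_sum_submodule:
  assumes "module R M" "\<And>i. i \<in> P \<Longrightarrow> F i \<subseteq> carrier M"
  shows "submodule (submod_sum R M F P) R M"
  unfolding submod_sum_def using assms by (intro lin_span_submodule) auto

lemma submod_sum_mono: "P \<subseteq> Q \<Longrightarrow> submod_sum R M F P \<subseteq> submod_sum R M F Q"
  unfolding submod_sum_def by (rule lin_span_mono) auto

section \<open>Cosets of a submodule and the quotient module\<close>

context module
begin

lemma smult_lin_map: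
  assumes "c \<in> carrier R"
  shows "(\<lambda>x. c \<odot>\<^bsub>M\<^esub> x) \<in> lin_maps R M M"
  using assms by (intro lin_mapsI) (auto simp: smult_r_distr R.m_comm simp flip: smult_assoc1)

lemma submodule_abelian_subgroup:
  assumes "submodule N R M"
  shows "abelian_subgroup N M"
  using assms M.abelian_group_axioms
  by (intro abelian_subgroupI3 additive_subgroupI) (auto simp: submodule_def)

lemma coset_eq_iff:
  assumes "submodule N R M" "x \<in> carrier M" "y \<in> carrier M"
  shows "N +>\<^bsub>M\<^esub> x = N +>\<^bsub>M\<^esub> y \<longleftrightarrow> x \<ominus>\<^bsub>M\<^esub> y \<in> N"
proof -
  interpret abelian_subgroup N M using submodule_abelian_subgroup[OF assms(1)] .
  have "N +>\<^bsub>M\<^esub> x = N +>\<^bsub>M\<^esub> y \<longleftrightarrow> x \<in> N +>\<^bsub>M\<^esub> y"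
    using a_repr_independence'[of x y] a_repr_independenceD[of x y] assms(2,3) by metis
  then show ?thesis
    unfolding a_minus_def a_rcos_module[OF assms(3,2)] .
qed

lemma coset_zero_iff:
  assumes "submodule N R M" "x \<in> carrier M"
  shows "N +>\<^bsub>M\<^esub> x = N \<longleftrightarrow> x \<in> N"
proof -
  interpret abelian_subgroup N M using submodule_abelian_subgroup[OF assms(1)] .
  show ?thesis
    using a_coset_join1[of N x] a_coset_join2[of x N] a_subgroup assms(2) by blast
qed

lemma coset_mem_eq:
  assumes "submodule N R M" "x \<in> carrier M" "y \<in> N +>\<^bsub>M\<^esub> x"
  shows "y \<in> carrier M" "N +>\<^bsub>M\<^esub> y = N +>\<^bsub>M\<^esub> x"
proof -
  interpret abelian_subgroup N M using submodule_abelian_subgroup[OF assms(1)] .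
  show "y \<in> carrier M" "N +>\<^bsub>M\<^esub> y = N +>\<^bsub>M\<^esub> x"
    using a_elemrcos_carrier[OF assms(2,3)] a_repr_independence'[OF assms(3,2)] by auto
qed

lemma coset_self:
  assumes "submodule N R M" "x \<in> carrier M"
  shows "x \<in> N +>\<^bsub>M\<^esub> x"
  using abelian_subgroup.a_rcos_self[OF submodule_abelian_subgroup[OF assms(1)] assms(2)] .

text \<open>Scalar multiplication on \<open>quot\<close> is a union over all representatives; once
  the members of the union depend only on the coset, it collapses to a single value.\<close>

lemma UN_coset:
  assumes "submodule N R M" "x \<in> carrier M"
    and "\<And>y. \<lbrakk>y \<in> carrier M; N +>\<^bsub>M\<^esub> y = N +>\<^bsub>M\<^esub> x\<rbrakk> \<Longrightarrow> F y = F x"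
  shows "(\<Union>y\<in>N +>\<^bsub>M\<^esub> x. F y) = F x"
  using assms(3) coset_mem_eq[OF assms(1,2)] coset_self[OF assms(1,2)] by blast

lemma quot_carrier: "carrier (quot M N) = (\<lambda>x. N +>\<^bsub>M\<^esub> x) ` carrier M"
  by (auto simp: quot_def A_RCOSETS_def')

lemma quot_zero: "\<zero>\<^bsub>quot M N\<^esub> = N"
  by (simp add: quot_def)

lemma quot_zero_coset: "submodule N R M \<Longrightarrow> \<zero>\<^bsub>quot M N\<^esub> = N +>\<^bsub>M\<^esub> \<zero>\<^bsub>M\<^esub>"
  using coset_zero_iff[of N "\<zero>\<^bsub>M\<^esub>"] submoduleD(2)[of N R M] by (simp add: quot_zero)

lemma quot_add:
  assumes "submodule N R M" "x \<in> carrier M" "y \<in> carrier M"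
  shows "(N +>\<^bsub>M\<^esub> x) \<oplus>\<^bsub>quot M N\<^esub> (N +>\<^bsub>M\<^esub> y) = N +>\<^bsub>M\<^esub> (x \<oplus>\<^bsub>M\<^esub> y)"
  using abelian_subgroup.a_rcos_sum[OF submodule_abelian_subgroup[OF assms(1)] assms(2,3)]
  by (simp add: quot_def)

text \<open>Independence of the representative comes from \<open>c y - c x = c (y - x)\<close>,
  which stays in the submodule.\<close>

lemma quot_smult:
  assumes N: "submodule N R M" and "c \<in> carrier R" "x \<in> carrier M"
  shows "c \<odot>\<^bsub>quot M N\<^esub> (N +>\<^bsub>M\<^esub> x) = N +>\<^bsub>M\<^esub> (c \<odot>\<^bsub>M\<^esub> x)"
proof -
  have "N +>\<^bsub>M\<^esub> (c \<odot>\<^bsub>M\<^esub> y) = N +>\<^bsub>M\<^esub> (c \<odot>\<^bsub>M\<^esub> x)"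
    if "y \<in> carrier M" "N +>\<^bsub>M\<^esub> y = N +>\<^bsub>M\<^esub> x" for y
  proof -
    have "c \<odot>\<^bsub>M\<^esub> y \<ominus>\<^bsub>M\<^esub> c \<odot>\<^bsub>M\<^esub> x = c \<odot>\<^bsub>M\<^esub> (y \<ominus>\<^bsub>M\<^esub> x)"
      using that assms by (simp add: a_minus_def smult_r_distr smult_r_minus)
    moreover have "y \<ominus>\<^bsub>M\<^esub> x \<in> N" using that coset_eq_iff[OF N] assms by simp
    ultimately show ?thesis using submoduleD(5)[OF N] assms that coset_eq_iff[OF N] by simp
  qed
  then have "(\<Union>y\<in>N +>\<^bsub>M\<^esub> x. N +>\<^bsub>M\<^esub> (c \<odot>\<^bsub>M\<^esub> y)) = N +>\<^bsub>M\<^esub> (c \<odot>\<^bsub>M\<^esub> x)"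
    by (rule UN_coset[OF assms(1,3)])
  then show ?thesis by (simp add: quot_def)
qed

lemma quot_module:
  assumes N: "submodule N R M"
  shows "module R (quot M N)"
proof (rule moduleI)
  show "cring R" ..
  note q = quot_carrier[of N] quot_add[OF N] quot_smult[OF N] quot_zero_coset[OF N]
  show "abelian_group (quot M N)"
  proof (rule abelian_groupI)
    fix x assume "x \<in> carrier (quot M N)"
    then obtain a where a: "a \<in> carrier M" "x = N +>\<^bsub>M\<^esub> a" by (auto simp: quot_carrier)
    show "\<zero>\<^bsub>quot M N\<^esub> \<oplus>\<^bsub>quot M N\<^esub> x = x" using a by (simp add: q)
    show "\<exists>y\<in>carrier (quot M N). y \<oplus>\<^bsub>quot M N\<^esub> x = \<zero>\<^bsub>quot M N\<^esub>"
      using a by (intro bexI[of _ "N +>\<^bsub>M\<^esub> (\<ominus>\<^bsub>M\<^esub> a)"]) (auto simp: q M.l_neg)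
    fix y assume "y \<in> carrier (quot M N)"
    then obtain b where b: "b \<in> carrier M" "y = N +>\<^bsub>M\<^esub> b" by (auto simp: quot_carrier)
    show "x \<oplus>\<^bsub>quot M N\<^esub> y \<in> carrier (quot M N)" using a b by (simp add: q)
    show "x \<oplus>\<^bsub>quot M N\<^esub> y = y \<oplus>\<^bsub>quot M N\<^esub> x" using a b by (simp add: q M.a_comm)
    fix z assume "z \<in> carrier (quot M N)"
    then obtain c where c: "c \<in> carrier M" "z = N +>\<^bsub>M\<^esub> c" by (auto simp: quot_carrier)
    show "x \<oplus>\<^bsub>quot M N\<^esub> y \<oplus>\<^bsub>quot M N\<^esub> z = x \<oplus>\<^bsub>quot M N\<^esub> (y \<oplus>\<^bsub>quot M N\<^esub> z)"
      using a b c by (simp add: q M.a_assoc)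
  next
    show "\<zero>\<^bsub>quot M N\<^esub> \<in> carrier (quot M N)" using quot_zero_coset[OF N] by (auto simp: quot_carrier)
  qed
  show "\<one>\<^bsub>R\<^esub> \<odot>\<^bsub>quot M N\<^esub> x = x" if "x \<in> carrier (quot M N)" for x
    using that by (auto simp: q)
next
  note q = quot_carrier[of N] quot_add[OF N] quot_smult[OF N]
  fix c x assume c: "c \<in> carrier R" and "x \<in> carrier (quot M N)"
  then obtain a where a: "a \<in> carrier M" "x = N +>\<^bsub>M\<^esub> a" by (auto simp: quot_carrier)
  show "c \<odot>\<^bsub>quot M N\<^esub> x \<in> carrier (quot M N)" using a c by (simp add: q)
  show "(c \<oplus>\<^bsub>R\<^esub> d) \<odot>\<^bsub>quot M N\<^esub> x = c \<odot>\<^bsub>quot M N\<^esub> x \<oplus>\<^bsub>quot M N\<^esub> d \<odot>\<^bsub>quot M N\<^esub> x"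
    "(c \<otimes>\<^bsub>R\<^esub> d) \<odot>\<^bsub>quot M N\<^esub> x = c \<odot>\<^bsub>quot M N\<^esub> (d \<odot>\<^bsub>quot M N\<^esub> x)"
    if "d \<in> carrier R" for d
    unfolding a(2) using a(1) c that
    by (simp_all only: q smult_closed R.a_closed R.m_closed smult_l_distr smult_assoc1)
  fix y assume "y \<in> carrier (quot M N)"
  then obtain b where b: "b \<in> carrier M" "y = N +>\<^bsub>M\<^esub> b" by (auto simp: quot_carrier)
  show "c \<odot>\<^bsub>quot M N\<^esub> (x \<oplus>\<^bsub>quot M N\<^esub> y) = c \<odot>\<^bsub>quot M N\<^esub> x \<oplus>\<^bsub>quot M N\<^esub> c \<odot>\<^bsub>quot M N\<^esub> y"
    unfolding a(2) b(2) using a(1) b(1) c by (simp only: q smult_closed M.a_closed smult_r_distr)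
qed

lemma coset_lin_map:
  assumes N: "submodule N R M"
  shows "(\<lambda>x. N +>\<^bsub>M\<^esub> x) \<in> lin_maps R M (quot M N)"
proof (rule lin_mapsI)
  show "N +>\<^bsub>M\<^esub> x \<in> carrier (quot M N)" if "x \<in> carrier M" for x
    using that by (auto simp: quot_carrier)
  show "N +>\<^bsub>M\<^esub> (x \<oplus>\<^bsub>M\<^esub> y) = (N +>\<^bsub>M\<^esub> x) \<oplus>\<^bsub>quot M N\<^esub> (N +>\<^bsub>M\<^esub> y)" if "x \<in> carrier M" "y \<in> carrier M" for x y
    by (rule quot_add[OF N that, symmetric])
  show "N +>\<^bsub>M\<^esub> (c \<odot>\<^bsub>M\<^esub> x) = c \<odot>\<^bsub>quot M N\<^esub> (N +>\<^bsub>M\<^esub> x)" if "c \<in> carrier R" "x \<in> carrier M" for c x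
    by (rule quot_smult[OF N that, symmetric])
qed

end

section \<open>Maps out of a tensor product\<close>

lemma tensor_free_simps [simp]:
  "z \<in> carrier (tensor_free M N) \<longleftrightarrow> Poly_Mapping.keys z \<subseteq> carrier M \<times> carrier N"
  "z \<otimes>\<^bsub>tensor_free M N\<^esub> z' = z + z'" "\<one>\<^bsub>tensor_free M N\<^esub> = 0"
  "Poly_Mapping.keys z \<subseteq> carrier M \<times> carrier N \<Longrightarrow> inv\<^bsub>tensor_free M N\<^esub> z = - z"
  by (auto simp: tensor_free_def)

lemma tensor_free_comm_group: "comm_group (tensor_free M N)"
  unfolding tensor_free_def by (rule abelian_free_Abelian_group)

text \<open>Both the generators of \<open>tensor_rel\<close> and the induction rule for free abelian
  groups are phrased with differences, so homomorphisms have to be evaluated on differences.\<close>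

lemma hom_tensor_free_diff:
  assumes "h \<in> hom (tensor_free M N) G" "group G"
    and "Poly_Mapping.keys a \<subseteq> carrier M \<times> carrier N" "Poly_Mapping.keys b \<subseteq> carrier M \<times> carrier N"
  shows "h (a - b) = h a \<otimes>\<^bsub>G\<^esub> inv\<^bsub>G\<^esub> h b"
proof -
  interpret group_hom "tensor_free M N" G h
    using assms comm_group.axioms(2)[OF tensor_free_comm_group]
    by (simp add: group_hom_def group_hom_axioms_def)
  have "h (a + - b) = h a \<otimes>\<^bsub>G\<^esub> h (- b)" using hom_mult[of a "- b"] assms by simp
  then show ?thesis using hom_inv[of b] assms by simp
qed

lemma frag_extend_hom:
  assumes "\<And>p. p \<in> carrier M \<times> carrier N \<Longrightarrow> h p \<in> carrier M \<times> carrier N"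
  shows "frag_extend (\<lambda>p. frag_of (h p)) \<in> hom (tensor_free M N) (tensor_free M N)"
proof (rule homI)
  show "frag_extend (\<lambda>p. frag_of (h p)) z \<in> carrier (tensor_free M N)"
    if "z \<in> carrier (tensor_free M N)" for z
  proof -
    have "Poly_Mapping.keys (frag_extend (\<lambda>p. frag_of (h p)) z)
        \<subseteq> (\<Union>p\<in>Poly_Mapping.keys z. Poly_Mapping.keys (frag_of (h p)))"
      by (rule keys_frag_extend)
    also have "\<dots> \<subseteq> carrier M \<times> carrier N" using that assms by (simp add: UN_subset_iff) blast
    finally show ?thesis by simp
  qed
qed (simp add: frag_extend_add)

lemma frag_of_relation_in:
  assumes "p \<in> carrier M \<times> carrier N" "q \<in> carrier M \<times> carrier N"
  shows "Poly_Mapping.keys (frag_of p - frag_of q) \<subseteq> carrier M \<times> carrier N"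
    and "r \<in> carrier M \<times> carrier N \<Longrightarrow>
      Poly_Mapping.keys (frag_of p - frag_of q - frag_of r) \<subseteq> carrier M \<times> carrier N"
proof -
  show *: "Poly_Mapping.keys (frag_of p - frag_of q) \<subseteq> carrier M \<times> carrier N"
    using keys_diff[of "frag_of p" "frag_of q"] assms by auto
  show "Poly_Mapping.keys (frag_of p - frag_of q - frag_of r) \<subseteq> carrier M \<times> carrier N"
    if "r \<in> carrier M \<times> carrier N"
    using keys_diff[of "frag_of p - frag_of q" "frag_of r"] that * by auto
qed

lemma subgroup_hom_preimage:
  assumes "group_hom G H h" "subgroup K H"
  shows "subgroup {x \<in> carrier G. h x \<in> K} G"
proof -
  interpret group_hom G H h by fact
  interpret K: subgroup K H by fact
  show ?thesis by unfold_locales auto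
qed

section \<open>The universal property of the tensor product for balanced maps\<close>

locale tensor_pair = M: bimodule R A B M + N: bimodule R B C N
  for R :: "('k, 'r) ring_scheme"
    and A :: "('k, 'a, 'x) module_scheme" and B :: "('k, 'b, 'y) module_scheme"
    and C :: "('k, 'c, 'z) module_scheme"
    and M :: "('k, 'a, 'b, 'm) bimod" and N :: "('k, 'b, 'c, 'n) bimod"
begin

abbreviation "T \<equiv> tensor B M N"
abbreviation "F \<equiv> tensor_free M N"
abbreviation "K \<equiv> tensor_rel B M N"

text \<open>The three equations mirror the three families of generators of
  \<open>tensor_rel\<close>. Compatibility with scalars and with the outer actions enters separately
  in \<open>bimod_hom_extend\<close>.\<close>

definition balanced :: "('m \<times> 'n \<Rightarrow> 'g) \<Rightarrow> ('g, 'h) ring_scheme \<Rightarrow> bool" where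
  "balanced \<beta> D \<longleftrightarrow> \<beta> \<in> carrier M \<times> carrier N \<rightarrow> carrier D \<and>
    (\<forall>x\<in>carrier M. \<forall>x'\<in>carrier M. \<forall>y\<in>carrier N. \<beta> (x \<oplus>\<^bsub>M\<^esub> x', y) = \<beta> (x, y) \<oplus>\<^bsub>D\<^esub> \<beta> (x', y)) \<and>
    (\<forall>x\<in>carrier M. \<forall>y\<in>carrier N. \<forall>y'\<in>carrier N. \<beta> (x, y \<oplus>\<^bsub>N\<^esub> y') = \<beta> (x, y) \<oplus>\<^bsub>D\<^esub> \<beta> (x, y')) \<and>
    (\<forall>x\<in>carrier M. \<forall>b\<in>carrier B. \<forall>y\<in>carrier N. \<beta> (ract M x b, y) = \<beta> (x, lact N b y))"

lemma free_group: "group F"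
  using comm_group.axioms(2)[OF tensor_free_comm_group] .

lemma rel_generators_in_free:
  "{frag_of (x \<oplus>\<^bsub>M\<^esub> x', y) - frag_of (x, y) - frag_of (x', y) | x x' y.
        x \<in> carrier M \<and> x' \<in> carrier M \<and> y \<in> carrier N} \<union>
     {frag_of (x, y \<oplus>\<^bsub>N\<^esub> y') - frag_of (x, y) - frag_of (x, y') | x y y'.
        x \<in> carrier M \<and> y \<in> carrier N \<and> y' \<in> carrier N} \<union>
     {frag_of (ract M x b, y) - frag_of (x, lact N b y) | x b y.
        x \<in> carrier M \<and> b \<in> carrier B \<and> y \<in> carrier N} \<subseteq> carrier F"
  by (safe; simp add: frag_of_relation_in M.ract_closed N.lact_closed)

lemma rel_subgroup: "subgroup K F"
  unfolding tensor_rel_def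
  by (rule group.generate_is_subgroup[OF free_group rel_generators_in_free])

lemma rel_normal: "K \<lhd> F"
  using comm_group.normal_iff_subgroup[OF tensor_free_comm_group] rel_subgroup by blast

lemma rel_least:
  assumes "subgroup H F"
    and "\<And>x x' y. \<lbrakk>x \<in> carrier M; x' \<in> carrier M; y \<in> carrier N\<rbrakk> \<Longrightarrow>
      frag_of (x \<oplus>\<^bsub>M\<^esub> x', y) - frag_of (x, y) - frag_of (x', y) \<in> H"
    and "\<And>x y y'. \<lbrakk>x \<in> carrier M; y \<in> carrier N; y' \<in> carrier N\<rbrakk> \<Longrightarrow>
      frag_of (x, y \<oplus>\<^bsub>N\<^esub> y') - frag_of (x, y) - frag_of (x, y') \<in> H"
    and "\<And>x b y. \<lbrakk>x \<in> carrier M; b \<in> carrier B; y \<in> carrier N\<rbrakk> \<Longrightarrow>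
      frag_of (ract M x b, y) - frag_of (x, lact N b y) \<in> H"
  shows "K \<subseteq> H"
  unfolding tensor_rel_def
  by (rule group.generate_subgroup_incl[OF free_group _ assms(1)]) (safe; rule assms(2-4); assumption)

lemma rel_generators:
  shows "\<lbrakk>x \<in> carrier M; x' \<in> carrier M; y \<in> carrier N\<rbrakk> \<Longrightarrow>
      frag_of (x \<oplus>\<^bsub>M\<^esub> x', y) - frag_of (x, y) - frag_of (x', y) \<in> K"
    and "\<lbrakk>x \<in> carrier M; y \<in> carrier N; y' \<in> carrier N\<rbrakk> \<Longrightarrow>
      frag_of (x, y \<oplus>\<^bsub>N\<^esub> y') - frag_of (x, y) - frag_of (x, y') \<in> K"
    and "\<lbrakk>x \<in> carrier M; b \<in> carrier B; y \<in> carrier N\<rbrakk> \<Longrightarrow>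
      frag_of (ract M x b, y) - frag_of (x, lact N b y) \<in> K"
  unfolding tensor_rel_def by (rule generate.incl; blast)+

text \<open>Additively the tensor product is the factor group of the free abelian group by the
  relations, which makes factor group theory available for a record declared as a bimodule.\<close>

lemma tensor_add_monoid:
  "carrier T = carrier (F Mod K)" "ring.add T = mult (F Mod K)" "\<zero>\<^bsub>T\<^esub> = \<one>\<^bsub>F Mod K\<^esub>"
  by (auto simp: tensor_def FactGroup_def)

lemma tensor_carrier: "carrier T = (\<lambda>z. K #>\<^bsub>F\<^esub> z) ` carrier F"
  by (auto simp: tensor_def RCOSETS_def)

lemma pure_tensor_closed:
  "\<lbrakk>x \<in> carrier M; y \<in> carrier N\<rbrakk> \<Longrightarrow> pure_tensor B M N x y \<in> carrier T"
  by (auto simp: pure_tensor_def tensor_carrier intro!: imageI)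

lemma balancedD:
  assumes "balanced \<beta> D"
  shows "\<lbrakk>x \<in> carrier M; y \<in> carrier N\<rbrakk> \<Longrightarrow> \<beta> (x, y) \<in> carrier D"
    and "\<lbrakk>x \<in> carrier M; x' \<in> carrier M; y \<in> carrier N\<rbrakk> \<Longrightarrow>
      \<beta> (x \<oplus>\<^bsub>M\<^esub> x', y) = \<beta> (x, y) \<oplus>\<^bsub>D\<^esub> \<beta> (x', y)"
    and "\<lbrakk>x \<in> carrier M; y \<in> carrier N; y' \<in> carrier N\<rbrakk> \<Longrightarrow>
      \<beta> (x, y \<oplus>\<^bsub>N\<^esub> y') = \<beta> (x, y) \<oplus>\<^bsub>D\<^esub> \<beta> (x, y')"
    and "\<lbrakk>x \<in> carrier M; b \<in> carrier B; y \<in> carrier N\<rbrakk> \<Longrightarrow>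
      \<beta> (ract M x b, y) = \<beta> (x, lact N b y)"
  using assms by (auto simp: balanced_def)

text \<open>Freeness extends \<beta> to all integer combinations. Being balanced says that this
  extension kills every generating relation, so it descends to the cosets.\<close>

lemma balanced_extend:
  assumes D: "abelian_group D" and \<beta>: "balanced \<beta> D"
  obtains \<eta> where "\<eta> \<in> hom (F Mod K) (add_monoid D)"
    and "\<And>x y. \<lbrakk>x \<in> carrier M; y \<in> carrier N\<rbrakk> \<Longrightarrow> \<eta> (pure_tensor B M N x y) = \<beta> (x, y)"
proof -
  interpret D: abelian_group D by fact
  note b = balancedD[OF \<beta>]
  have "\<beta> ` (carrier M \<times> carrier N) \<subseteq> carrier (add_monoid D)" using b(1) by auto
  then obtain h where "h \<in> hom (free_Abelian_group (carrier M \<times> carrier N)) (add_monoid D)"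
    and h: "\<And>p. p \<in> carrier M \<times> carrier N \<Longrightarrow> h (frag_of p) = \<beta> p"
    using comm_group.free_Abelian_group_universal[OF D.a_comm_group] by blast
  then have hh: "h \<in> hom F (add_monoid D)" by (simp add: tensor_free_def)
  interpret h: group_hom F "add_monoid D" h
    using hh free_group D.a_group by (simp add: group_hom_def group_hom_axioms_def)
  have d2: "h (frag_of p - frag_of q) = \<beta> p \<ominus>\<^bsub>D\<^esub> \<beta> q"
    if "p \<in> carrier M \<times> carrier N" "q \<in> carrier M \<times> carrier N" for p q
    using hom_tensor_free_diff[OF hh D.a_group, of "frag_of p" "frag_of q"] h that
    by (simp add: a_minus_def a_inv_def)
  have d3: "h (frag_of p - frag_of q - frag_of r) = \<beta> p \<ominus>\<^bsub>D\<^esub> \<beta> q \<ominus>\<^bsub>D\<^esub> \<beta> r"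
    if "p \<in> carrier M \<times> carrier N" "q \<in> carrier M \<times> carrier N" "r \<in> carrier M \<times> carrier N" for p q r
    using hom_tensor_free_diff[OF hh D.a_group, of "frag_of p - frag_of q" "frag_of r"]
      h that d2 frag_of_relation_in(1)[OF that(1,2)]
    by (simp add: a_minus_def a_inv_def)
  \<comment> \<open>This expression is the value of the extension on a biadditivity relation;
    \<open>c2\<close> plays the same part for a balancing relation.\<close>
  have c: "(u \<oplus>\<^bsub>D\<^esub> v) \<ominus>\<^bsub>D\<^esub> u \<ominus>\<^bsub>D\<^esub> v = \<zero>\<^bsub>D\<^esub>" if "u \<in> carrier D" "v \<in> carrier D" for u v
  proof -
    have "(u \<oplus>\<^bsub>D\<^esub> v) \<ominus>\<^bsub>D\<^esub> u \<ominus>\<^bsub>D\<^esub> v = (u \<oplus>\<^bsub>D\<^esub> v) \<oplus>\<^bsub>D\<^esub> \<ominus>\<^bsub>D\<^esub> (u \<oplus>\<^bsub>D\<^esub> v)"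
      using that by (simp add: a_minus_def D.a_assoc D.minus_add)
    then show ?thesis using that by (simp add: D.r_neg)
  qed
  have c2: "u \<ominus>\<^bsub>D\<^esub> u = \<zero>\<^bsub>D\<^esub>" if "u \<in> carrier D" for u
    using that by (simp add: a_minus_def D.r_neg)
  have "K \<subseteq> kernel F (add_monoid D) h"
    using b
    by (intro rel_least h.subgroup_kernel)
      (auto simp: kernel_def d2 d3 c c2 frag_of_relation_in M.ract_closed N.lact_closed del: subsetI)
  then obtain \<eta> where "\<eta> \<in> hom (F Mod K) (add_monoid D)" "\<And>z. z \<in> carrier F \<Longrightarrow> \<eta> (K #>\<^bsub>F\<^esub> z) = h z"
    by (rule h.FactGroup_universal_kernel[OF rel_normal]) blast
  then show thesis using that h by (simp add: pure_tensor_def)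
qed

text \<open>Representatives of one coset differ by an element of \<open>K\<close>, whose image stays
  in \<open>K\<close>; so all members of the union defining \<open>tensor_lift\<close> are the same
  coset.\<close>

lemma tensor_lift_coset:
  assumes "h \<in> carrier M \<times> carrier N \<rightarrow> carrier M \<times> carrier N"
    and "\<And>z. z \<in> K \<Longrightarrow> frag_extend (\<lambda>p. frag_of (h p)) z \<in> K" "z \<in> carrier F"
  shows "tensor_lift B M N h (K #>\<^bsub>F\<^esub> z) = K #>\<^bsub>F\<^esub> frag_extend (\<lambda>p. frag_of (h p)) z"
proof -
  let ?e = "frag_extend (\<lambda>p. frag_of (h p))"
  interpret K: normal K F by (rule rel_normal)
  have hom: "?e \<in> hom F F" by (rule frag_extend_hom) (use assms(1) in blast)
  have "K #>\<^bsub>F\<^esub> ?e w = K #>\<^bsub>F\<^esub> ?e z" if w: "w \<in> K #>\<^bsub>F\<^esub> z" for w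
  proof -
    obtain k where k: "k \<in> K" "w = k + z" using w by (auto simp: r_coset_def)
    then have "?e w = ?e k \<otimes>\<^bsub>F\<^esub> ?e z" by (simp add: frag_extend_add)
    then have "?e w \<in> K #>\<^bsub>F\<^esub> ?e z" using assms(2)[OF k(1)] by (auto simp: r_coset_def)
    moreover have "?e z \<in> carrier F" using hom assms(3) hom_in_carrier by metis
    ultimately show ?thesis
      using group.repr_independence[OF free_group _ _ rel_subgroup] by metis
  qed
  moreover have "z \<in> K #>\<^bsub>F\<^esub> z" using group.rcos_self[OF free_group assms(3) rel_subgroup] .
  ultimately show ?thesis unfolding tensor_lift_def by blast
qed

text \<open>Additive maps that commute with the action of \<open>B\<close> carry each generating
  relation to a relation of the same kind. Taking \<open>f\<close> or \<open>g\<close> to be the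
  identity covers the scalar, left and right operations on the tensor product.\<close>

lemma tensor_lift_pointwise:
  assumes f: "\<And>x. x \<in> carrier M \<Longrightarrow> f x \<in> carrier M"
      "\<And>x x'. \<lbrakk>x \<in> carrier M; x' \<in> carrier M\<rbrakk> \<Longrightarrow> f (x \<oplus>\<^bsub>M\<^esub> x') = f x \<oplus>\<^bsub>M\<^esub> f x'"
      "\<And>x b. \<lbrakk>x \<in> carrier M; b \<in> carrier B\<rbrakk> \<Longrightarrow> f (ract M x b) = ract M (f x) b"
    and g: "\<And>y. y \<in> carrier N \<Longrightarrow> g y \<in> carrier N"
      "\<And>y y'. \<lbrakk>y \<in> carrier N; y' \<in> carrier N\<rbrakk> \<Longrightarrow> g (y \<oplus>\<^bsub>N\<^esub> y') = g y \<oplus>\<^bsub>N\<^esub> g y'"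
      "\<And>y b. \<lbrakk>y \<in> carrier N; b \<in> carrier B\<rbrakk> \<Longrightarrow> g (lact N b y) = lact N b (g y)"
    and z: "z \<in> carrier F"
  shows "tensor_lift B M N (\<lambda>(x, y). (f x, g y)) (K #>\<^bsub>F\<^esub> z) =
    K #>\<^bsub>F\<^esub> frag_extend (\<lambda>p. frag_of (case p of (x, y) \<Rightarrow> (f x, g y))) z"
proof (rule tensor_lift_coset[OF _ _ z])
  let ?h = "\<lambda>(x, y). (f x, g y)"
  let ?e = "frag_extend (\<lambda>p. frag_of (?h p))"
  show h: "?h \<in> carrier M \<times> carrier N \<rightarrow> carrier M \<times> carrier N" using f(1) g(1) by auto
  have hom: "?e \<in> hom F F" by (rule frag_extend_hom) (use h in blast)
  interpret e: group_hom F F ?e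
    using hom free_group by (simp add: group_hom_def group_hom_axioms_def)
  have "K \<subseteq> {z \<in> carrier F. ?e z \<in> K}"
  proof (rule rel_least)
    show "subgroup {z \<in> carrier F. ?e z \<in> K} F"
      using subgroup_hom_preimage[OF e.group_hom_axioms rel_subgroup] .
  qed (use f g rel_generators in
      \<open>auto simp: frag_extend_diff frag_of_relation_in M.ract_closed N.lact_closed del: subsetI\<close>)
  then show "?e k \<in> K" if "k \<in> K" for k using that by blast
qed

text \<open>Operations on cosets are computed on representatives, where compatibility with \<beta>
  follows by induction over the free abelian group. The preimage clause is what later yields
  preservation of parity, and the image clause yields the trace ideal.\<close>

theorem bimod_hom_extend:
  assumes D: "bimodule R A C D" and \<beta>: "balanced \<beta> D"
    and smult: "\<And>c x y. \<lbrakk>c \<in> carrier R; x \<in> carrier M; y \<in> carrier N\<rbrakk> \<Longrightarrow>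
      \<beta> (c \<odot>\<^bsub>M\<^esub> x, y) = c \<odot>\<^bsub>D\<^esub> \<beta> (x, y)"
    and lact: "\<And>a x y. \<lbrakk>a \<in> carrier A; x \<in> carrier M; y \<in> carrier N\<rbrakk> \<Longrightarrow>
      \<beta> (lact M a x, y) = lact D a (\<beta> (x, y))"
    and ract: "\<And>c x y. \<lbrakk>c \<in> carrier C; x \<in> carrier M; y \<in> carrier N\<rbrakk> \<Longrightarrow>
      \<beta> (x, ract N y c) = ract D (\<beta> (x, y)) c"
  obtains \<eta> where "\<eta> \<in> bimod_hom R A C T D"
    and "\<And>x y. \<lbrakk>x \<in> carrier M; y \<in> carrier N\<rbrakk> \<Longrightarrow> \<eta> (pure_tensor B M N x y) = \<beta> (x, y)"
    and "\<And>H. submodule H R D \<Longrightarrow> submodule {t \<in> carrier T. \<eta> t \<in> H} R T"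
    and "\<eta> ` carrier T = lin_span R D (\<beta> ` (carrier M \<times> carrier N))"
proof -
  interpret D: bimodule R A C D by fact
  have Dgrp: "abelian_group D" by unfold_locales
  obtain \<eta> where hom: "\<eta> \<in> hom (F Mod K) (add_monoid D)"
    and pure: "\<And>x y. \<lbrakk>x \<in> carrier M; y \<in> carrier N\<rbrakk> \<Longrightarrow> \<eta> (pure_tensor B M N x y) = \<beta> (x, y)"
    by (rule balanced_extend[OF Dgrp \<beta>]) blast
  interpret K: normal K F by (rule rel_normal)
  interpret \<eta>: group_hom "F Mod K" "add_monoid D" \<eta>
    using hom K.factorgroup_is_group D.M.a_group by (simp add: group_hom_def group_hom_axioms_def)
  note b = balancedD[OF \<beta>]
  have in_D: "\<eta> t \<in> carrier D" if "t \<in> carrier T" for t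
    using \<eta>.hom_closed that by (simp add: tensor_add_monoid)
  have add: "\<eta> (t \<oplus>\<^bsub>T\<^esub> t') = \<eta> t \<oplus>\<^bsub>D\<^esub> \<eta> t'" if "t \<in> carrier T" "t' \<in> carrier T" for t t'
    using \<eta>.hom_mult that by (simp add: tensor_add_monoid)
  have coset_hom: "(\<lambda>z. \<eta> (K #>\<^bsub>F\<^esub> z)) \<in> hom F (add_monoid D)"
  proof (rule homI)
    show "\<eta> (K #>\<^bsub>F\<^esub> z) \<in> carrier (add_monoid D)" if "z \<in> carrier F" for z
      using in_D that by (auto simp: tensor_carrier)
    show "\<eta> (K #>\<^bsub>F\<^esub> (z \<otimes>\<^bsub>F\<^esub> z')) = \<eta> (K #>\<^bsub>F\<^esub> z) \<otimes>\<^bsub>add_monoid D\<^esub> \<eta> (K #>\<^bsub>F\<^esub> z')"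
      if "z \<in> carrier F" "z' \<in> carrier F" for z z'
    proof -
      have "K #>\<^bsub>F\<^esub> (z \<otimes>\<^bsub>F\<^esub> z') = (K #>\<^bsub>F\<^esub> z) \<otimes>\<^bsub>F Mod K\<^esub> (K #>\<^bsub>F\<^esub> z')"
        using K.rcos_sum[OF that] by (simp add: FactGroup_def)
      then show ?thesis using add that by (simp add: tensor_carrier tensor_add_monoid)
    qed
  qed
  have diff: "\<eta> (K #>\<^bsub>F\<^esub> (z - z')) = \<eta> (K #>\<^bsub>F\<^esub> z) \<ominus>\<^bsub>D\<^esub> \<eta> (K #>\<^bsub>F\<^esub> z')"
    if "Poly_Mapping.keys z \<subseteq> carrier M \<times> carrier N" "Poly_Mapping.keys z' \<subseteq> carrier M \<times> carrier N" for z z'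
    using hom_tensor_free_diff[OF coset_hom D.M.a_group that] by (simp add: a_minus_def a_inv_def)
  have zero: "\<eta> (K #>\<^bsub>F\<^esub> 0) = \<zero>\<^bsub>D\<^esub>"
    using diff[of 0 0] in_D[of "K #>\<^bsub>F\<^esub> 0"] by (simp add: tensor_carrier a_minus_def D.M.r_neg)
  \<comment> \<open>Induction over the free abelian group with zero, differences and single pairs as
    cases; a submodule containing the values of \<beta> survives all three.\<close>
  have span: "\<eta> (K #>\<^bsub>F\<^esub> z) \<in> H"
    if H: "submodule H R D" "\<beta> ` (carrier M \<times> carrier N) \<subseteq> H" and z: "z \<in> carrier F" for H z
  proof -
    have "Poly_Mapping.keys z \<subseteq> carrier M \<times> carrier N" using z by simp
    then show ?thesis
    proof (induction z rule: free_Abelian_group_induct[where S = "carrier M \<times> carrier N", consumes 1])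
      case (3 p)
      then show ?case using pure H(2) by (auto simp: pure_tensor_def)
    qed (use zero diff submoduleD[OF H(1)] in \<open>simp_all add: a_minus_def\<close>)
  qed
  \<comment> \<open>One argument for all three actions: if an operation moves pairs by
    \<open>h\<close> and corresponds under \<beta> to a linear map \<phi> of \<open>D\<close>, then
    \<eta> intertwines the two. Scalars, \<open>A\<close> and \<open>C\<close> give the
    instances.\<close>
  have op: "\<eta> (K #>\<^bsub>F\<^esub> frag_extend (\<lambda>p. frag_of (h p)) z) = \<phi> (\<eta> (K #>\<^bsub>F\<^esub> z)) \<and>
      K #>\<^bsub>F\<^esub> frag_extend (\<lambda>p. frag_of (h p)) z \<in> carrier T"
    if z: "z \<in> carrier F" and h: "h \<in> carrier M \<times> carrier N \<rightarrow> carrier M \<times> carrier N"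
      and \<phi>: "\<phi> \<in> lin_maps R D D" "\<And>p. p \<in> carrier M \<times> carrier N \<Longrightarrow> \<beta> (h p) = \<phi> (\<beta> p)" for z h \<phi>
  proof
    have eh: "frag_extend (\<lambda>p. frag_of (h p)) \<in> hom F F" by (rule frag_extend_hom) (use h in blast)
    then have ek: "Poly_Mapping.keys (frag_extend (\<lambda>p. frag_of (h p)) w) \<subseteq> carrier M \<times> carrier N"
      if "Poly_Mapping.keys w \<subseteq> carrier M \<times> carrier N" for w
      using hom_in_carrier[OF eh, of w] that by simp
    then show "K #>\<^bsub>F\<^esub> frag_extend (\<lambda>p. frag_of (h p)) z \<in> carrier T" using z by (simp add: tensor_carrier)
    have \<phi>_diff: "\<phi> (u \<ominus>\<^bsub>D\<^esub> v) = \<phi> u \<ominus>\<^bsub>D\<^esub> \<phi> v" if "u \<in> carrier D" "v \<in> carrier D" for u v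
      using lin_maps_a_inv[OF D.M.module_axioms D.M.module_axioms \<phi>(1)] lin_mapsD[OF \<phi>(1)] that
      by (simp add: a_minus_def)
    have "Poly_Mapping.keys z \<subseteq> carrier M \<times> carrier N" using z by simp
    then show "\<eta> (K #>\<^bsub>F\<^esub> frag_extend (\<lambda>p. frag_of (h p)) z) = \<phi> (\<eta> (K #>\<^bsub>F\<^esub> z))"
    proof (induction z rule: free_Abelian_group_induct[where S = "carrier M \<times> carrier N", consumes 1])
      case 1
      then show ?case using zero lin_maps_zero[OF D.M.module_axioms D.M.module_axioms \<phi>(1)] by simp
    next
      case (2 x y)
      have "K #>\<^bsub>F\<^esub> x \<in> carrier T" "K #>\<^bsub>F\<^esub> y \<in> carrier T" using 2 by (auto simp: tensor_carrier)
      then show ?case using 2 ek by (simp add: frag_extend_diff diff \<phi>_diff in_D)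
    next
      case (3 p)
      obtain x y where p: "p = (x, y)" "x \<in> carrier M" "y \<in> carrier N" using 3 by blast
      obtain x' y' where p': "h p = (x', y')" "x' \<in> carrier M" "y' \<in> carrier N" using 3 h by blast
      have "\<eta> (K #>\<^bsub>F\<^esub> frag_of (h p)) = \<beta> (h p)" "\<eta> (K #>\<^bsub>F\<^esub> frag_of p) = \<beta> p"
        using pure p p' by (auto simp: pure_tensor_def)
      then show ?case using \<phi>(2)[OF 3] by simp
    qed
  qed
  have smult_op: "\<eta> (c \<odot>\<^bsub>T\<^esub> t) = c \<odot>\<^bsub>D\<^esub> \<eta> t" "c \<odot>\<^bsub>T\<^esub> t \<in> carrier T"
    if c: "c \<in> carrier R" and t: "t \<in> carrier T" for c t
  proof -
    obtain z where z: "z \<in> carrier F" "t = K #>\<^bsub>F\<^esub> z" using t by (auto simp: tensor_carrier)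
    have "c \<odot>\<^bsub>T\<^esub> t = K #>\<^bsub>F\<^esub> frag_extend (\<lambda>p. frag_of (case p of (x, y) \<Rightarrow> (c \<odot>\<^bsub>M\<^esub> x, y))) z"
      using tensor_lift_pointwise[OF _ _ _ _ _ _ z(1), of "\<lambda>x. c \<odot>\<^bsub>M\<^esub> x" "\<lambda>y. y"] c z(2)
      by (simp add: tensor_def M.M.smult_r_distr M.ract_smult_left)
    moreover have "(\<lambda>u. c \<odot>\<^bsub>D\<^esub> u) \<in> lin_maps R D D"
      by (rule D.M.smult_lin_map[OF c])
    moreover have "(\<lambda>(x, y). (c \<odot>\<^bsub>M\<^esub> x, y)) \<in> carrier M \<times> carrier N \<rightarrow> carrier M \<times> carrier N"
      using c by auto
    ultimately show "\<eta> (c \<odot>\<^bsub>T\<^esub> t) = c \<odot>\<^bsub>D\<^esub> \<eta> t" "c \<odot>\<^bsub>T\<^esub> t \<in> carrier T"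
      using op[OF z(1), of "\<lambda>(x, y). (c \<odot>\<^bsub>M\<^esub> x, y)" "\<lambda>u. c \<odot>\<^bsub>D\<^esub> u"] c z(2) smult by auto
  qed
  have lact_op: "\<eta> (lact T a t) = lact D a (\<eta> t)"
    if a: "a \<in> carrier A" and t: "t \<in> carrier T" for a t
  proof -
    obtain z where z: "z \<in> carrier F" "t = K #>\<^bsub>F\<^esub> z" using t by (auto simp: tensor_carrier)
    have "lact T a t = K #>\<^bsub>F\<^esub> frag_extend (\<lambda>p. frag_of (case p of (x, y) \<Rightarrow> (lact M a x, y))) z"
      using tensor_lift_pointwise[OF _ _ _ _ _ _ z(1), of "lact M a" "\<lambda>y. y"] a z(2)
      by (simp add: tensor_def M.lact_closed M.lact_add_right M.lact_ract)
    moreover have "lact D a \<in> lin_maps R D D"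
      using a by (intro lin_mapsI) (auto simp: D.lact_closed D.lact_add_right D.lact_smult_right)
    moreover have "(\<lambda>(x, y). (lact M a x, y)) \<in> carrier M \<times> carrier N \<rightarrow> carrier M \<times> carrier N"
      using a M.lact_closed by auto
    ultimately show ?thesis
      using op[OF z(1), of "\<lambda>(x, y). (lact M a x, y)" "lact D a"] a z(2) lact M.lact_closed by auto
  qed
  have ract_op: "\<eta> (ract T t c) = ract D (\<eta> t) c"
    if c: "c \<in> carrier C" and t: "t \<in> carrier T" for c t
  proof -
    obtain z where z: "z \<in> carrier F" "t = K #>\<^bsub>F\<^esub> z" using t by (auto simp: tensor_carrier)
    have "ract T t c = K #>\<^bsub>F\<^esub> frag_extend (\<lambda>p. frag_of (case p of (x, y) \<Rightarrow> (x, ract N y c))) z"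
      using tensor_lift_pointwise[OF _ _ _ _ _ _ z(1), of "\<lambda>x. x" "\<lambda>y. ract N y c"] c z(2)
      by (simp add: tensor_def N.ract_closed N.ract_add_left N.lact_ract)
    moreover have "(\<lambda>u. ract D u c) \<in> lin_maps R D D"
      using c by (intro lin_mapsI) (auto simp: D.ract_closed D.ract_add_left D.ract_smult_left)
    moreover have "(\<lambda>(x, y). (x, ract N y c)) \<in> carrier M \<times> carrier N \<rightarrow> carrier M \<times> carrier N"
      using c N.ract_closed by auto
    ultimately show ?thesis
      using op[OF z(1), of "\<lambda>(x, y). (x, ract N y c)" "\<lambda>u. ract D u c"] c z(2) ract N.ract_closed by auto
  qed
  \<comment> \<open>\<open>submodule\<close> asks for an additive subgroup closed under scalars, and
    the additive group of \<open>T\<close> is the factor group, so subgroups found there can be used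
    directly.\<close>
  have sub_T: "submodule H' R T" if "subgroup H' (F Mod K)" "\<And>c t. \<lbrakk>c \<in> carrier R; t \<in> H'\<rbrakk> \<Longrightarrow> c \<odot>\<^bsub>T\<^esub> t \<in> H'" for H'
    using that
    by (simp add: submodule_def submodule_axioms_def subgroup_def m_inv_def tensor_add_monoid)
  show thesis
  proof
    show "\<eta> \<in> bimod_hom R A C T D"
      using in_D add smult_op(1) lact_op ract_op by (auto simp: bimod_hom_def)
    show "\<eta> (pure_tensor B M N x y) = \<beta> (x, y)" if "x \<in> carrier M" "y \<in> carrier N" for x y
      using pure that .
    show "submodule {t \<in> carrier T. \<eta> t \<in> H} R T" if H: "submodule H R D" for H
    proof (rule sub_T)
      have "subgroup H (add_monoid D)" using H by (simp add: submodule_def)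
      from subgroup_hom_preimage[OF \<eta>.group_hom_axioms this] show "subgroup {t \<in> carrier T. \<eta> t \<in> H} (F Mod K)"
        by (simp add: tensor_add_monoid)
    qed (use smult_op submoduleD(5)[OF H] in auto)
    show "\<eta> ` carrier T = lin_span R D (\<beta> ` (carrier M \<times> carrier N))"
    proof
      have "\<beta> ` (carrier M \<times> carrier N) \<subseteq> carrier D" using b(1) by auto
      then show "\<eta> ` carrier T \<subseteq> lin_span R D (\<beta> ` (carrier M \<times> carrier N))"
        using span[OF lin_span_submodule[OF D.M.module_axioms] lin_span_incl]
        by (auto simp: tensor_carrier simp del: tensor_free_simps(1))
      \<comment> \<open>The image of a group homomorphism is a subgroup, and it is closed under
        scalars because a scalar multiple of a value is the value at the scalar multiple of the
        tensor.\<close>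
      have "submodule (\<eta> ` carrier T) R D"
      proof (rule submodule.intro)
        show "subgroup (\<eta> ` carrier T) (add_monoid D)"
          using \<eta>.img_is_subgroup by (simp add: tensor_add_monoid)
        show "submodule_axioms (\<eta> ` carrier T) R D"
          by unfold_locales (use smult_op in \<open>auto simp flip: smult_op(1)\<close>)
      qed
      then show "lin_span R D (\<beta> ` (carrier M \<times> carrier N)) \<subseteq> \<eta> ` carrier T"
        using pure pure_tensor_closed by (intro lin_span_least) (auto simp flip: pure)
    qed
  qed
qed

end

section \<open>Algebras and their quotients\<close>

definition alg_hom ::
  "('k, 'r) ring_scheme \<Rightarrow> ('k, 'a, 'y) module_scheme \<Rightarrow> ('k, 'b, 'z) module_scheme \<Rightarrow> ('a \<Rightarrow> 'b) set" where
  "alg_hom R A B =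
    {f \<in> ring_hom A B. \<forall>c\<in>carrier R. \<forall>x\<in>carrier A. f (c \<odot>\<^bsub>A\<^esub> x) = c \<odot>\<^bsub>B\<^esub> f x}"

lemma alg_homD:
  assumes "f \<in> alg_hom R A B"
  shows "x \<in> carrier A \<Longrightarrow> f x \<in> carrier B"
    and "\<lbrakk>x \<in> carrier A; y \<in> carrier A\<rbrakk> \<Longrightarrow> f (x \<oplus>\<^bsub>A\<^esub> y) = f x \<oplus>\<^bsub>B\<^esub> f y"
    and "\<lbrakk>x \<in> carrier A; y \<in> carrier A\<rbrakk> \<Longrightarrow> f (x \<otimes>\<^bsub>A\<^esub> y) = f x \<otimes>\<^bsub>B\<^esub> f y"
    and "f \<one>\<^bsub>A\<^esub> = \<one>\<^bsub>B\<^esub>"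
    and "\<lbrakk>c \<in> carrier R; x \<in> carrier A\<rbrakk> \<Longrightarrow> f (c \<odot>\<^bsub>A\<^esub> x) = c \<odot>\<^bsub>B\<^esub> f x"
  using assms by (auto simp: alg_hom_def ring_hom_def)

lemma alg_hom_id: "(\<lambda>x. x) \<in> alg_hom R A A"
  by (auto simp: alg_hom_def ring_hom_def)

text \<open>The inverse is needed to give \<rho> its values: composites live in an endomorphism
  algebra, whereas \<rho> maps to an algebra that is only isomorphic to it.\<close>

lemma alg_iso_inverse:
  assumes A: "k_algebra R A" and f: "f \<in> alg_iso R A B"
  obtains g where "f \<in> alg_hom R A B" "g \<in> alg_hom R B A"
    and "\<And>x. x \<in> carrier A \<Longrightarrow> g (f x) = x" "\<And>y. y \<in> carrier B \<Longrightarrow> f (g y) = y"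
proof -
  interpret A: k_algebra R A by fact
  have bij: "bij_betw f (carrier A) (carrier B)" and fh: "f \<in> alg_hom R A B"
    using f by (auto simp: alg_iso_def ring_iso_def alg_hom_def)
  note h = alg_homD[OF fh]
  define g where "g = inv_into (carrier A) f"
  have gf: "g (f x) = x" if "x \<in> carrier A" for x
    using bij that by (simp add: g_def bij_betw_def)
  have fg: "f (g y) = y" and gc: "g y \<in> carrier A" if "y \<in> carrier B" for y
    using bij that by (auto simp: g_def bij_betw_def inv_into_into f_inv_into_f)
  have "g (x \<oplus>\<^bsub>B\<^esub> y) = g x \<oplus>\<^bsub>A\<^esub> g y" "g (x \<otimes>\<^bsub>B\<^esub> y) = g x \<otimes>\<^bsub>A\<^esub> g y"
    if "x \<in> carrier B" "y \<in> carrier B" for x y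
    using gf[of "g x \<oplus>\<^bsub>A\<^esub> g y"] gf[of "g x \<otimes>\<^bsub>A\<^esub> g y"] h gc that fg by auto
  moreover have "g (c \<odot>\<^bsub>B\<^esub> x) = c \<odot>\<^bsub>A\<^esub> g x" if "c \<in> carrier R" "x \<in> carrier B" for c x
    using gf[of "c \<odot>\<^bsub>A\<^esub> g x"] h(5) gc that fg by auto
  moreover have "g \<one>\<^bsub>B\<^esub> = \<one>\<^bsub>A\<^esub>" using gf[of "\<one>\<^bsub>A\<^esub>"] h(4) by simp
  ultimately have "g \<in> alg_hom R B A" using gc by (auto simp: alg_hom_def ring_hom_def)
  then show thesis using that fh gf fg by blast
qed

context k_algebra
begin

text \<open>Ring ideals say nothing about scalars; in a unital algebra \<open>c x\<close> equals
  \<open>(c 1) x\<close>, so closure under multiplication includes closure under scalars.\<close>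

lemma ideal_submodule:
  assumes "ideal I M"
  shows "submodule I R M"
proof -
  interpret I: ideal I M by fact
  show ?thesis
  proof (rule submodule.intro)
    show "submodule_axioms I R M"
    proof
      fix c x assume c: "c \<in> carrier R" and x: "x \<in> I"
      have "c \<odot>\<^bsub>M\<^esub> x = (c \<odot>\<^bsub>M\<^esub> \<one>\<^bsub>M\<^esub>) \<otimes>\<^bsub>M\<^esub> x"
        using c I.Icarr[OF x] by (simp add: smult_mult_left)
      also have "\<dots> \<in> I" using c I.I_l_closed[OF x] by simp
      finally show "c \<odot>\<^bsub>M\<^esub> x \<in> I" .
    qed
  qed (rule I.a_subgroup)
qed

lemma quot_mult:
  assumes "ideal I M" "x \<in> carrier M" "y \<in> carrier M"
  shows "(I +>\<^bsub>M\<^esub> x) \<otimes>\<^bsub>quot M I\<^esub> (I +>\<^bsub>M\<^esub> y) = I +>\<^bsub>M\<^esub> (x \<otimes>\<^bsub>M\<^esub> y)"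
  using ideal.rcoset_mult_add[OF assms] by (simp add: quot_def)

lemma quot_k_algebra:
  assumes I: "ideal I M"
  shows "k_algebra R (quot M I)"
proof -
  note IS = ideal_submodule[OF I]
  interpret Q: module R "quot M I" by (rule quot_module[OF IS])
  have one: "\<one>\<^bsub>quot M I\<^esub> = I +>\<^bsub>M\<^esub> \<one>\<^bsub>M\<^esub>" by (simp add: quot_def)
  note q = quot_carrier[of I] quot_add[OF IS] quot_smult[OF IS] quot_mult[OF I] one
  have ex: "\<exists>a\<in>carrier M. x = I +>\<^bsub>M\<^esub> a" if "x \<in> carrier (quot M I)" for x
    using that by (auto simp: quot_carrier)
  have "ring (quot M I)"
  proof (rule ringI)
    show "Group.monoid (quot M I)"
    proof (rule monoidI)
      fix x y z assume "x \<in> carrier (quot M I)" "y \<in> carrier (quot M I)" "z \<in> carrier (quot M I)"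
      then obtain a b c where "a \<in> carrier M" "b \<in> carrier M" "c \<in> carrier M"
        "x = I +>\<^bsub>M\<^esub> a" "y = I +>\<^bsub>M\<^esub> b" "z = I +>\<^bsub>M\<^esub> c" using ex by metis
      then show "x \<otimes>\<^bsub>quot M I\<^esub> y \<otimes>\<^bsub>quot M I\<^esub> z = x \<otimes>\<^bsub>quot M I\<^esub> (y \<otimes>\<^bsub>quot M I\<^esub> z)"
        by (simp add: q m_assoc)
    qed (auto simp: q)
    fix x y z assume "x \<in> carrier (quot M I)" "y \<in> carrier (quot M I)" "z \<in> carrier (quot M I)"
    then obtain a b c where "a \<in> carrier M" "b \<in> carrier M" "c \<in> carrier M"
      "x = I +>\<^bsub>M\<^esub> a" "y = I +>\<^bsub>M\<^esub> b" "z = I +>\<^bsub>M\<^esub> c" using ex by metis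
    then show "(x \<oplus>\<^bsub>quot M I\<^esub> y) \<otimes>\<^bsub>quot M I\<^esub> z = x \<otimes>\<^bsub>quot M I\<^esub> z \<oplus>\<^bsub>quot M I\<^esub> y \<otimes>\<^bsub>quot M I\<^esub> z"
      "z \<otimes>\<^bsub>quot M I\<^esub> (x \<oplus>\<^bsub>quot M I\<^esub> y) = z \<otimes>\<^bsub>quot M I\<^esub> x \<oplus>\<^bsub>quot M I\<^esub> z \<otimes>\<^bsub>quot M I\<^esub> y"
      by (simp_all add: q l_distr r_distr)
  qed (rule Q.abelian_group_axioms)
  moreover have "(c \<odot>\<^bsub>quot M I\<^esub> x) \<otimes>\<^bsub>quot M I\<^esub> y = c \<odot>\<^bsub>quot M I\<^esub> (x \<otimes>\<^bsub>quot M I\<^esub> y)"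
    "x \<otimes>\<^bsub>quot M I\<^esub> (c \<odot>\<^bsub>quot M I\<^esub> y) = c \<odot>\<^bsub>quot M I\<^esub> (x \<otimes>\<^bsub>quot M I\<^esub> y)"
    if "c \<in> carrier R" and xy: "x \<in> carrier (quot M I)" "y \<in> carrier (quot M I)" for c x y
  proof -
    obtain a b where "a \<in> carrier M" "b \<in> carrier M" "x = I +>\<^bsub>M\<^esub> a" "y = I +>\<^bsub>M\<^esub> b"
      using ex xy by metis
    then show "(c \<odot>\<^bsub>quot M I\<^esub> x) \<otimes>\<^bsub>quot M I\<^esub> y = c \<odot>\<^bsub>quot M I\<^esub> (x \<otimes>\<^bsub>quot M I\<^esub> y)"
      "x \<otimes>\<^bsub>quot M I\<^esub> (c \<odot>\<^bsub>quot M I\<^esub> y) = c \<odot>\<^bsub>quot M I\<^esub> (x \<otimes>\<^bsub>quot M I\<^esub> y)"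
      using that(1) by (simp_all add: q smult_mult_left smult_mult_right)
  qed
  ultimately show ?thesis
    using Q.module_axioms by (simp add: k_algebra_def k_algebra_axioms_def)
qed

lemma subalg_k_algebra:
  assumes "subalg R M S"
  shows "k_algebra R (M\<lparr>carrier := S\<rparr>)"
proof -
  have S: "submodule S R M" "\<one>\<^bsub>M\<^esub> \<in> S" "\<And>x y. \<lbrakk>x \<in> S; y \<in> S\<rbrakk> \<Longrightarrow> x \<otimes>\<^bsub>M\<^esub> y \<in> S"
    using assms by (auto simp: subalg_def)
  note c = submoduleD(1)[OF S(1)]
  interpret S: module R "M\<lparr>carrier := S\<rparr>"
    using submodule.submodule_is_module[OF S(1)] module_axioms .
  have "ring (M\<lparr>carrier := S\<rparr>)"
    using S c by (intro ringI S.abelian_group_axioms monoidI) (auto simp: m_assoc l_distr r_distr)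
  then show ?thesis
    using S.module_axioms c
    by (simp add: k_algebra_def k_algebra_axioms_def smult_mult_left smult_mult_right)
qed

end

lemma with_actions_simps [simp]:
  "carrier (with_actions M l r) = carrier M" "mult (with_actions M l r) = mult M"
  "one (with_actions M l r) = one M" "\<zero>\<^bsub>with_actions M l r\<^esub> = \<zero>\<^bsub>M\<^esub>"
  "ring.add (with_actions M l r) = ring.add M" "smult (with_actions M l r) = smult M"
  "lact (with_actions M l r) = l" "ract (with_actions M l r) = r"
  by (simp_all add: with_actions_def module.defs bimod.defs)

lemma regular_bimodule:
  assumes "k_algebra R A"
  shows "bimodule R A A (regular_bimod A)"
proof -
  interpret k_algebra R A by fact
  have "module R (regular_bimod A)"
    using module_axioms by (subst module_cong[of _ A]) (simp_all add: regular_bimod_def)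
  then show ?thesis
    using k_algebra_axioms
    by (simp add: bimodule_def bimodule_axioms_def regular_bimod_def l_distr r_distr m_assoc
        smult_mult_left smult_mult_right)
qed

section \<open>Linear categories\<close>

text \<open>Composition in \<open>quot_cat\<close> is a union over both cosets; this collapses it
  once the value is independent of the representatives.\<close>

lemma UN_UN_const:
  assumes "a \<in> A" "b \<in> B" "\<And>x y. \<lbrakk>x \<in> A; y \<in> B\<rbrakk> \<Longrightarrow> F x y = G"
  shows "(\<Union>x\<in>A. \<Union>y\<in>B. F x y) = G"
  using assms by auto

definition cat_ideal ::
  "('k, 'r) ring_scheme \<Rightarrow> ('o, 'k, 'm) lincat \<Rightarrow> ('o \<Rightarrow> 'o \<Rightarrow> 'm set) \<Rightarrow> bool" where
  "cat_ideal R C I \<longleftrightarrow>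
    (\<forall>X\<in>ob C. \<forall>Y\<in>ob C. submodule (I X Y) R (Hom C X Y)) \<and>
    (\<forall>X\<in>ob C. \<forall>Y\<in>ob C. \<forall>Z\<in>ob C. \<forall>g\<in>carrier (Hom C Y Z). \<forall>f\<in>I X Y. cmp C X Y Z g f \<in> I X Z) \<and>
    (\<forall>X\<in>ob C. \<forall>Y\<in>ob C. \<forall>Z\<in>ob C. \<forall>g\<in>I Y Z. \<forall>f\<in>carrier (Hom C X Y). cmp C X Y Z g f \<in> I X Z)"

lemma cat_idealD:
  assumes "cat_ideal R C I" "X \<in> ob C" "Y \<in> ob C"
  shows "submodule (I X Y) R (Hom C X Y)"
    and "\<lbrakk>Z \<in> ob C; g \<in> carrier (Hom C Y Z); f \<in> I X Y\<rbrakk> \<Longrightarrow> cmp C X Y Z g f \<in> I X Z"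
    and "\<lbrakk>Z \<in> ob C; g \<in> I Y Z; f \<in> carrier (Hom C X Y)\<rbrakk> \<Longrightarrow> cmp C X Y Z g f \<in> I X Z"
  using assms by (auto simp: cat_ideal_def)

context linear_category
begin

lemma cmp_lin_map_left:
  "\<lbrakk>X \<in> ob C; Y \<in> ob C; Z \<in> ob C; g \<in> carrier (Hom C Y Z)\<rbrakk> \<Longrightarrow>
    (\<lambda>f. cmp C X Y Z g f) \<in> lin_maps R (Hom C X Y) (Hom C X Z)"
  by (rule lin_mapsI) (auto simp: cmp_closed cmp_add_right cmp_smult_right)

lemma cmp_lin_map_right:
  "\<lbrakk>X \<in> ob C; Y \<in> ob C; Z \<in> ob C; f \<in> carrier (Hom C X Y)\<rbrakk> \<Longrightarrow>
    (\<lambda>g. cmp C X Y Z g f) \<in> lin_maps R (Hom C Y Z) (Hom C X Z)"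
  by (rule lin_mapsI) (auto simp: cmp_closed cmp_add_left cmp_smult_left)

section \<open>Endomorphism algebras, Hom bimodules and the Morita context of two objects\<close>

lemma End_alg_simps [simp]:
  "carrier (End_alg C X) = carrier (Hom C X X)" "mult (End_alg C X) = cmp C X X X"
  "one (End_alg C X) = ident C X" "\<zero>\<^bsub>End_alg C X\<^esub> = \<zero>\<^bsub>Hom C X X\<^esub>"
  "ring.add (End_alg C X) = ring.add (Hom C X X)" "smult (End_alg C X) = smult (Hom C X X)"
  by (simp_all add: End_alg_def)

lemma End_alg_k_algebra:
  assumes X: "X \<in> ob C"
  shows "k_algebra R (End_alg C X)"
proof -
  interpret E: module R "End_alg C X"
    using Hom_module[OF X X] by (subst module_cong[of _ "Hom C X X"]) simp_all
  have "ring (End_alg C X)"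
    using X by (intro ringI E.abelian_group_axioms monoidI)
      (auto simp: cmp_closed ident_closed cmp_assoc cmp_ident_left cmp_ident_right cmp_add_left cmp_add_right)
  then show ?thesis
    using E.module_axioms X
    by (simp add: k_algebra_def k_algebra_axioms_def cmp_smult_left cmp_smult_right)
qed

text \<open>The algebras act through homomorphisms \<psi> and \<phi> into the endomorphism algebras,
  so one lemma serves both bimodules of the context: on one side the homomorphism is the identity,
  on the other the isomorphism later taken to be \<open>canon\<close>.\<close>

lemma Hom_bimodule:
  assumes X: "X \<in> ob C" and Y: "Y \<in> ob C"
    and A: "k_algebra R A" "\<psi> \<in> alg_hom R A (End_alg C Y)"
    and B: "k_algebra R B" "\<phi> \<in> alg_hom R B (End_alg C X)"
  shows "bimodule R A B (with_actions (Hom C X Y)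
    (\<lambda>a x. cmp C X Y Y (\<psi> a) x) (\<lambda>x b. cmp C X X Y x (\<phi> b)))" (is "bimodule R A B ?M")
proof -
  have "module R ?M"
    using Hom_module[OF X Y] by (subst module_cong[of _ "Hom C X Y"]) simp_all
  moreover have "bimodule_axioms R A B ?M"
    using X Y alg_homD[OF A(2)] alg_homD[OF B(2)]
    by unfold_locales (simp_all add: cmp_closed cmp_assoc cmp_ident_left cmp_ident_right
        cmp_add_left cmp_add_right cmp_smult_left cmp_smult_right)
  ultimately show ?thesis using A(1) B(1) by (simp add: bimodule_def)
qed

text \<open>\<open>B\<close> is only isomorphic to the endomorphism algebra of \<open>X\<close>, so
  \<eta> is induced by composition and \<rho> by composition followed by the inverse of \<phi>. The
  clauses after the first record the values, the image and the preimages that the standard filter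
  and the parity argument read off.\<close>

theorem morita_context_Hom:
  fixes B :: "('k, 'd) module" and X Y :: 'o and \<phi> :: "'d \<Rightarrow> 'm"
  assumes X: "X \<in> ob C" and Y: "Y \<in> ob C"
    and B: "k_algebra R B" and \<phi>: "\<phi> \<in> alg_iso R B (End_alg C X)"
  defines "M \<equiv> with_actions (Hom C X Y) (\<lambda>a x. cmp C X Y Y a x) (\<lambda>x b. cmp C X X Y x (\<phi> b))"
    and "N \<equiv> with_actions (Hom C Y X) (\<lambda>b y. cmp C Y X X (\<phi> b) y) (\<lambda>y a. cmp C Y Y X y a)"
  obtains \<eta> \<rho> where "morita_context R (End_alg C Y) B M N \<eta> \<rho>"
    and "\<And>x y. \<lbrakk>x \<in> carrier (Hom C X Y); y \<in> carrier (Hom C Y X)\<rbrakk> \<Longrightarrow>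
      \<eta> (pure_tensor B M N x y) = cmp C Y X Y x y"
    and "\<And>x y. \<lbrakk>x \<in> carrier (Hom C X Y); y \<in> carrier (Hom C Y X)\<rbrakk> \<Longrightarrow>
      \<rho> (pure_tensor (End_alg C Y) N M y x) \<in> carrier B \<and>
      \<phi> (\<rho> (pure_tensor (End_alg C Y) N M y x)) = cmp C X Y X y x"
    and "trace_ideal B M N \<eta> = gen_ideal R C X Y Y"
    and "\<And>H. submodule H R (Hom C Y Y) \<Longrightarrow>
      submodule {t \<in> carrier (tensor B M N). \<eta> t \<in> H} R (tensor B M N)"
    and "\<And>H. submodule H R B \<Longrightarrow>
      submodule {t \<in> carrier (tensor (End_alg C Y) N M). \<rho> t \<in> H} R (tensor (End_alg C Y) N M)"
proof -
  let ?A = "End_alg C Y"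
  have A: "k_algebra R ?A" by (rule End_alg_k_algebra[OF Y])
  obtain \<psi> where \<phi>h: "\<phi> \<in> alg_hom R B (End_alg C X)" and \<psi>h: "\<psi> \<in> alg_hom R (End_alg C X) B"
    and \<psi>\<phi>: "\<And>b. b \<in> carrier B \<Longrightarrow> \<psi> (\<phi> b) = b"
    and \<phi>\<psi>': "\<And>u. u \<in> carrier (End_alg C X) \<Longrightarrow> \<phi> (\<psi> u) = u"
    by (rule alg_iso_inverse[OF B \<phi>]) (rule that)
  note \<phi>' = alg_homD[OF \<phi>h, simplified] and \<psi>' = alg_homD[OF \<psi>h, simplified]
    and \<phi>\<psi> = \<phi>\<psi>'[simplified]
  interpret B: k_algebra R B by fact
  have M: "bimodule R ?A B M"
    unfolding M_def using Hom_bimodule[OF X Y A alg_hom_id B \<phi>h] .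
  have N: "bimodule R B ?A N"
    unfolding N_def using Hom_bimodule[OF Y X B \<phi>h A alg_hom_id] .
  interpret MN: tensor_pair R ?A B ?A M N using M N by (rule tensor_pair.intro)
  interpret NM: tensor_pair R B ?A B N M using N M by (rule tensor_pair.intro)
  note c = cmp_closed cmp_assoc cmp_add_left cmp_add_right cmp_smult_left cmp_smult_right X Y
  have carr: "carrier M = carrier (Hom C X Y)" "carrier N = carrier (Hom C Y X)"
    by (simp_all add: M_def N_def)
  obtain \<eta> where \<eta>: "\<eta> \<in> bimod_hom R ?A ?A (tensor B M N) (regular_bimod ?A)"
    and \<eta>_pure: "\<And>x y. \<lbrakk>x \<in> carrier M; y \<in> carrier N\<rbrakk> \<Longrightarrow>
      \<eta> (pure_tensor B M N x y) = (case (x, y) of (x, y) \<Rightarrow> cmp C Y X Y x y)"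
    and \<eta>_pre: "\<And>H. submodule H R (regular_bimod ?A) \<Longrightarrow>
      submodule {t \<in> carrier (tensor B M N). \<eta> t \<in> H} R (tensor B M N)"
    and \<eta>_img: "\<eta> ` carrier (tensor B M N) =
      lin_span R (regular_bimod ?A) ((\<lambda>(x, y). cmp C Y X Y x y) ` (carrier M \<times> carrier N))"
  proof (rule MN.bimod_hom_extend[of "regular_bimod ?A" "\<lambda>(x, y). cmp C Y X Y x y"])
    show "bimodule R ?A ?A (regular_bimod ?A)" by (rule regular_bimodule[OF A])
    show "MN.balanced (\<lambda>(x, y). cmp C Y X Y x y) (regular_bimod ?A)"
      unfolding MN.balanced_def by (auto simp: regular_bimod_def M_def N_def c \<phi>')
  qed (auto simp: regular_bimod_def M_def N_def c)
  obtain \<rho> where \<rho>: "\<rho> \<in> bimod_hom R B B (tensor ?A N M) (regular_bimod B)"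
    and \<rho>_pure: "\<And>y x. \<lbrakk>y \<in> carrier N; x \<in> carrier M\<rbrakk> \<Longrightarrow>
      \<rho> (pure_tensor ?A N M y x) = (case (y, x) of (y, x) \<Rightarrow> \<psi> (cmp C X Y X y x))"
    and \<rho>_pre: "\<And>H. submodule H R (regular_bimod B) \<Longrightarrow>
      submodule {t \<in> carrier (tensor ?A N M). \<rho> t \<in> H} R (tensor ?A N M)"
  proof (rule NM.bimod_hom_extend[of "regular_bimod B" "\<lambda>(y, x). \<psi> (cmp C X Y X y x)"])
    show "bimodule R B B (regular_bimod B)" by (rule regular_bimodule[OF B])
    show "NM.balanced (\<lambda>(y, x). \<psi> (cmp C X Y X y x)) (regular_bimod B)"
      unfolding NM.balanced_def by (auto simp: regular_bimod_def M_def N_def c \<psi>')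
    show "(case (lact N a x, y) of (y, x) \<Rightarrow> \<psi> (cmp C X Y X y x)) =
        lact (regular_bimod B) a (case (x, y) of (y, x) \<Rightarrow> \<psi> (cmp C X Y X y x))"
      if "a \<in> carrier B" "x \<in> carrier N" "y \<in> carrier M" for a x y
      using that by (simp add: regular_bimod_def M_def N_def c \<phi>' \<psi>' \<psi>\<phi>)
    \<comment> \<open>Associativity is used from right to left: the composite must be regrouped so
      that \<phi> \<open>a\<close> is its last factor before the multiplicative \<psi> can split it
      off.\<close>
    show "(case (x, ract M y a) of (y, x) \<Rightarrow> \<psi> (cmp C X Y X y x)) =
        ract (regular_bimod B) (case (x, y) of (y, x) \<Rightarrow> \<psi> (cmp C X Y X y x)) a"
      if "a \<in> carrier B" "x \<in> carrier N" "y \<in> carrier M" for a x y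
      using that cmp_assoc[of X X Y X x y "\<phi> a", symmetric]
      by (simp add: regular_bimod_def M_def N_def cmp_closed X Y \<phi>' \<psi>' \<psi>\<phi>)
  qed (auto simp: regular_bimod_def M_def N_def c \<psi>')
  have reg_A: "submodule H R (regular_bimod ?A) \<longleftrightarrow> submodule H R (Hom C Y Y)" for H
    by (rule submodule_cong) (simp_all add: regular_bimod_def)
  have reg_B: "submodule H R (regular_bimod B) \<longleftrightarrow> submodule H R B" for H
    by (rule submodule_cong) (simp_all add: regular_bimod_def)
  show thesis
  proof (rule that)
    show "morita_context R ?A B M N \<eta> \<rho>"
      unfolding morita_context_def
    proof (intro conjI ballI)
      fix x y x' assume xy: "x \<in> carrier M" "y \<in> carrier N" "x' \<in> carrier M"
      then show "lact M (\<eta> (pure_tensor B M N x y)) x' = ract M x (\<rho> (pure_tensor ?A N M y x'))"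
        unfolding \<eta>_pure[OF xy(1,2)] \<rho>_pure[OF xy(2,3)] by (simp add: M_def N_def c \<phi>\<psi>)
    next
      fix y x y' assume xy: "y \<in> carrier N" "x \<in> carrier M" "y' \<in> carrier N"
      then show "lact N (\<rho> (pure_tensor ?A N M y x)) y' = ract N y (\<eta> (pure_tensor B M N x y'))"
        unfolding \<eta>_pure[OF xy(2,3)] \<rho>_pure[OF xy(1,2)] by (simp add: M_def N_def c \<phi>\<psi>)
    qed (fact M N \<eta> \<rho>)+
    show "trace_ideal B M N \<eta> = gen_ideal R C X Y Y"
      unfolding trace_ideal_def \<eta>_img gen_ideal_def carr
      by (subst lin_span_cong[of _ "Hom C Y Y"])
        (auto simp: regular_bimod_def intro!: arg_cong[where f = "lin_span R (Hom C Y Y)"])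
    show "submodule {t \<in> carrier (tensor B M N). \<eta> t \<in> H} R (tensor B M N)"
      if "submodule H R (Hom C Y Y)" for H
      using \<eta>_pre that by (simp add: reg_A)
    show "submodule {t \<in> carrier (tensor ?A N M). \<rho> t \<in> H} R (tensor ?A N M)"
      if "submodule H R B" for H
      using \<rho>_pre that by (simp add: reg_B)
  qed (use \<eta>_pure \<rho>_pure in \<open>auto simp: carr c \<phi>\<psi> intro: \<psi>'(1)\<close>)
qed

section \<open>The quotient category by a two-sided ideal\<close>

lemma quot_cat_simps [simp]:
  "ob (quot_cat C I) = ob C" "Hom (quot_cat C I) X Y = quot (Hom C X Y) (I X Y)"
  "ident (quot_cat C I) X = I X X +>\<^bsub>Hom C X X\<^esub> ident C X"
  by (simp_all add: quot_cat_def)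

text \<open>Representatives are exchanged one at a time: replacing \<open>f'\<close> by
  \<open>f\<close> changes the composite by \<open>g'\<close> after an element of the ideal, and
  replacing \<open>g'\<close> by \<open>g\<close> changes it by an element of the ideal after
  \<open>f\<close>.\<close>

lemma quot_cat_cmp:
  assumes I: "cat_ideal R C I" and ob: "X \<in> ob C" "Y \<in> ob C" "Z \<in> ob C"
    and g: "g \<in> carrier (Hom C Y Z)" and f: "f \<in> carrier (Hom C X Y)"
  shows "cmp (quot_cat C I) X Y Z (I Y Z +>\<^bsub>Hom C Y Z\<^esub> g) (I X Y +>\<^bsub>Hom C X Y\<^esub> f) =
    I X Z +>\<^bsub>Hom C X Z\<^esub> cmp C X Y Z g f"
proof -
  interpret XY: module R "Hom C X Y" using ob by (simp add: Hom_module)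
  interpret YZ: module R "Hom C Y Z" using ob by (simp add: Hom_module)
  interpret XZ: module R "Hom C X Z" using ob by (simp add: Hom_module)
  note S = cat_idealD(1)[OF I]
  have "I X Z +>\<^bsub>Hom C X Z\<^esub> cmp C X Y Z g' f' = I X Z +>\<^bsub>Hom C X Z\<^esub> cmp C X Y Z g f"
    if g': "g' \<in> I Y Z +>\<^bsub>Hom C Y Z\<^esub> g" and f': "f' \<in> I X Y +>\<^bsub>Hom C X Y\<^esub> f" for g' f'
  proof -
    have g'c: "g' \<in> carrier (Hom C Y Z)" and gd: "g' \<ominus>\<^bsub>Hom C Y Z\<^esub> g \<in> I Y Z"
      using YZ.coset_mem_eq[OF S[OF ob(2,3)] g g'] YZ.coset_eq_iff[OF S[OF ob(2,3)] _ g] by auto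
    have f'c: "f' \<in> carrier (Hom C X Y)" and fd: "f' \<ominus>\<^bsub>Hom C X Y\<^esub> f \<in> I X Y"
      using XY.coset_mem_eq[OF S[OF ob(1,2)] f f'] XY.coset_eq_iff[OF S[OF ob(1,2)] _ f] by auto
    have "cmp C X Y Z g' (f' \<ominus>\<^bsub>Hom C X Y\<^esub> f) = cmp C X Y Z g' f' \<ominus>\<^bsub>Hom C X Z\<^esub> cmp C X Y Z g' f"
      using lin_maps_a_inv[OF XY.module_axioms XZ.module_axioms cmp_lin_map_left[OF ob g'c] f] ob f f'c g'c
      by (simp add: a_minus_def cmp_add_right)
    then have "I X Z +>\<^bsub>Hom C X Z\<^esub> cmp C X Y Z g' f' = I X Z +>\<^bsub>Hom C X Z\<^esub> cmp C X Y Z g' f"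
      using XZ.coset_eq_iff[OF S[OF ob(1,3)]] cat_idealD(2)[OF I ob(1,2,3) g'c fd] ob f f'c g'c
      by (simp add: cmp_closed)
    moreover have "cmp C X Y Z (g' \<ominus>\<^bsub>Hom C Y Z\<^esub> g) f = cmp C X Y Z g' f \<ominus>\<^bsub>Hom C X Z\<^esub> cmp C X Y Z g f"
      using lin_maps_a_inv[OF YZ.module_axioms XZ.module_axioms cmp_lin_map_right[OF ob f] g] ob f g g'c
      by (simp add: a_minus_def cmp_add_left)
    then have "I X Z +>\<^bsub>Hom C X Z\<^esub> cmp C X Y Z g' f = I X Z +>\<^bsub>Hom C X Z\<^esub> cmp C X Y Z g f"
      using XZ.coset_eq_iff[OF S[OF ob(1,3)]] cat_idealD(3)[OF I ob(1,2,3) gd f] ob f g g'c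
      by (simp add: cmp_closed)
    ultimately show ?thesis by simp
  qed
  then show ?thesis
    unfolding quot_cat_def lincat.simps
    by (rule UN_UN_const[OF YZ.coset_self[OF S[OF ob(2,3)] g] XY.coset_self[OF S[OF ob(1,2)] f]])
qed

lemma quot_cat_linear_category:
  assumes I: "cat_ideal R C I"
  shows "linear_category R (quot_cat C I)"
proof -
  let ?Q = "quot_cat C I"
  have ex: "\<exists>f'\<in>carrier (Hom C X Y). f = I X Y +>\<^bsub>Hom C X Y\<^esub> f'"
    if "f \<in> carrier (Hom ?Q X Y)" "X \<in> ob C" "Y \<in> ob C" for f X Y
    using that module.quot_carrier[OF Hom_module] by auto
  have coset: "I X Y +>\<^bsub>Hom C X Y\<^esub> f \<in> carrier (quot (Hom C X Y) (I X Y))"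
    if "f \<in> carrier (Hom C X Y)" "X \<in> ob C" "Y \<in> ob C" for f X Y
    using that module.quot_carrier[OF Hom_module] by auto
  note q = quot_cat_cmp[OF I] module.quot_add[OF Hom_module cat_idealD(1)[OF I]]
    module.quot_smult[OF Hom_module cat_idealD(1)[OF I]] coset
    cmp_closed ident_closed
  have mod_ops: "\<lbrakk>X \<in> ob C; Y \<in> ob C; f \<in> carrier (Hom C X Y); g \<in> carrier (Hom C X Y)\<rbrakk> \<Longrightarrow>
      f \<oplus>\<^bsub>Hom C X Y\<^esub> g \<in> carrier (Hom C X Y)"
    "\<lbrakk>X \<in> ob C; Y \<in> ob C; c \<in> carrier R; f \<in> carrier (Hom C X Y)\<rbrakk> \<Longrightarrow>
      c \<odot>\<^bsub>Hom C X Y\<^esub> f \<in> carrier (Hom C X Y)" for X Y f g c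
    using module.smult_closed[OF Hom_module] abelian_monoid.a_closed[OF abelian_group.axioms(1)[OF module.axioms(2)[OF Hom_module]]]
    by metis+
  show ?thesis
  proof (rule linear_category.intro[OF cring_axioms], rule linear_category_axioms.intro)
    show "ident ?Q X \<in> carrier (Hom ?Q X X)" if "X \<in> ob ?Q" for X using that q by simp
  next
    fix X Y assume XY: "X \<in> ob ?Q" "Y \<in> ob ?Q"
    then show "module R (Hom ?Q X Y)"
      using module.quot_module[OF Hom_module cat_idealD(1)[OF I]] by simp
    fix f assume f: "f \<in> carrier (Hom ?Q X Y)"
    obtain f' where f': "f' \<in> carrier (Hom C X Y)" "f = I X Y +>\<^bsub>Hom C X Y\<^esub> f'" using ex[OF f] XY by auto
    show "cmp ?Q X Y Y (ident ?Q Y) f = f" using XY f' by (simp add: q cmp_ident_left)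
    show "cmp ?Q X X Y f (ident ?Q X) = f" using XY f' by (simp add: q cmp_ident_right)
    fix Z g assume Z: "Z \<in> ob ?Q" and g: "g \<in> carrier (Hom ?Q Y Z)"
    obtain g' where g': "g' \<in> carrier (Hom C Y Z)" "g = I Y Z +>\<^bsub>Hom C Y Z\<^esub> g'" using ex[OF g] XY Z by auto
    show "cmp ?Q X Y Z g f \<in> carrier (Hom ?Q X Z)" using XY Z f' g' by (simp add: q)
    show "cmp ?Q X Y Z (c \<odot>\<^bsub>Hom ?Q Y Z\<^esub> g) f = c \<odot>\<^bsub>Hom ?Q X Z\<^esub> cmp ?Q X Y Z g f"
      "cmp ?Q X Y Z g (c \<odot>\<^bsub>Hom ?Q X Y\<^esub> f) = c \<odot>\<^bsub>Hom ?Q X Z\<^esub> cmp ?Q X Y Z g f"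
      if "c \<in> carrier R" for c
      using XY Z f' g' that by (simp_all add: q mod_ops cmp_smult_left cmp_smult_right)
    show "cmp ?Q X Y Z (g \<oplus>\<^bsub>Hom ?Q Y Z\<^esub> k) f = cmp ?Q X Y Z g f \<oplus>\<^bsub>Hom ?Q X Z\<^esub> cmp ?Q X Y Z k f"
      if k: "k \<in> carrier (Hom ?Q Y Z)" for k
    proof -
      obtain k' where "k' \<in> carrier (Hom C Y Z)" "k = I Y Z +>\<^bsub>Hom C Y Z\<^esub> k'" using ex[OF k] XY Z by auto
      then show ?thesis using XY Z f' g' by (simp add: q mod_ops cmp_add_left)
    qed
    show "cmp ?Q X Y Z g (f \<oplus>\<^bsub>Hom ?Q X Y\<^esub> k) = cmp ?Q X Y Z g f \<oplus>\<^bsub>Hom ?Q X Z\<^esub> cmp ?Q X Y Z g k"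
      if k: "k \<in> carrier (Hom ?Q X Y)" for k
    proof -
      obtain k' where "k' \<in> carrier (Hom C X Y)" "k = I X Y +>\<^bsub>Hom C X Y\<^esub> k'" using ex[OF k] XY Z by auto
      then show ?thesis using XY Z f' g' by (simp add: q mod_ops cmp_add_right)
    qed
    fix W h assume W: "W \<in> ob ?Q" and h: "h \<in> carrier (Hom ?Q W X)"
    obtain h' where h': "h' \<in> carrier (Hom C W X)" "h = I W X +>\<^bsub>Hom C W X\<^esub> h'" using ex[OF h] XY W by auto
    show "cmp ?Q W X Z (cmp ?Q X Y Z g f) h = cmp ?Q W Y Z g (cmp ?Q W X Y f h)"
      using XY Z W f' g' h' by (simp add: q cmp_assoc)
  qed
qed

end

section \<open>Ideals generated by objects\<close>

context linear_category
begin

lemma composites_in_Hom: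
  "\<lbrakk>X \<in> ob C; Y \<in> ob C; Z \<in> ob C\<rbrakk> \<Longrightarrow>
    {cmp C X Z Y g f | g f. g \<in> carrier (Hom C Z Y) \<and> f \<in> carrier (Hom C X Z)} \<subseteq> carrier (Hom C X Y)"
  by (auto simp: cmp_closed)

lemma gen_ideal_submodule:
  "\<lbrakk>X \<in> ob C; Y \<in> ob C; Z \<in> ob C\<rbrakk> \<Longrightarrow> submodule (gen_ideal R C Z X Y) R (Hom C X Y)"
  unfolding gen_ideal_def by (intro lin_span_submodule Hom_module composites_in_Hom)

lemma composite_in_gen_ideal:
  "\<lbrakk>g \<in> carrier (Hom C Z Y); f \<in> carrier (Hom C X Z)\<rbrakk> \<Longrightarrow> cmp C X Z Y g f \<in> gen_ideal R C Z X Y"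
  unfolding gen_ideal_def by (rule subsetD[OF lin_span_incl]) blast

lemma sum_ideal_submodule:
  assumes "\<And>n. n \<in> P \<Longrightarrow> X n \<in> ob C" "Y \<in> ob C" "Z \<in> ob C"
  shows "submodule (sum_ideal R C X P Y Z) R (Hom C Y Z)"
  unfolding sum_ideal_def
  using assms submoduleD(1)[OF gen_ideal_submodule[OF assms(2,3) assms(1)]]
  by (intro submod_sum_submodule Hom_module subsetI)

lemma composite_in_sum_ideal:
  assumes "n \<in> P" "g \<in> carrier (Hom C (X n) Z)" "f \<in> carrier (Hom C Y (X n))"
  shows "cmp C Y (X n) Z g f \<in> sum_ideal R C X P Y Z"
  using submod_sum_incl[OF assms(1)] composite_in_gen_ideal[OF assms(2,3)]
  unfolding sum_ideal_def by (rule subsetD)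

lemma sum_ideal_mono: "P \<subseteq> P' \<Longrightarrow> sum_ideal R C X P Y Z \<subseteq> sum_ideal R C X P' Y Z"
  unfolding sum_ideal_def by (rule submod_sum_mono)

lemma sum_ideal_least:
  assumes "submodule H R (Hom C Y Z)"
    and "\<And>n g f. \<lbrakk>n \<in> P; g \<in> carrier (Hom C (X n) Z); f \<in> carrier (Hom C Y (X n))\<rbrakk> \<Longrightarrow>
      cmp C Y (X n) Z g f \<in> H"
  shows "sum_ideal R C X P Y Z \<subseteq> H"
  unfolding sum_ideal_def gen_ideal_def
  using assms(2) by (intro submod_sum_least lin_span_least assms(1)) blast

text \<open>An induction principle: membership in \<open>H\<close> after a linear map need only be
  tested on composites through some \<open>X n\<close>, since the generated ideals and their sum are
  spans. The ideal property, the product axiom and the trace ideal all go through it.\<close>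

lemma sum_ideal_map_in:
  assumes "Y \<in> ob C" "Z \<in> ob C" "module R N" "\<phi> \<in> lin_maps R (Hom C Y Z) N" "submodule H R N"
    and X: "\<And>n. n \<in> P \<Longrightarrow> X n \<in> ob C"
    and "\<And>n g f. \<lbrakk>n \<in> P; g \<in> carrier (Hom C (X n) Z); f \<in> carrier (Hom C Y (X n))\<rbrakk> \<Longrightarrow>
      \<phi> (cmp C Y (X n) Z g f) \<in> H"
    and "x \<in> sum_ideal R C X P Y Z"
  shows "\<phi> x \<in> H"
proof -
  have "sum_ideal R C X P Y Z \<subseteq> {x \<in> carrier (Hom C Y Z). \<phi> x \<in> H}"
    using assms(1,2,7) X
    by (intro sum_ideal_least submodule_preimage[OF Hom_module assms(3-5)]) (auto simp: cmp_closed)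
  then show ?thesis using assms(8) by blast
qed

text \<open>By associativity, composing with a further morphism on either side changes only one leg
  of a composite through \<open>X n\<close>; linearity extends this to the spans.\<close>

lemma sum_ideal_cat_ideal:
  assumes X: "\<And>n. n \<in> P \<Longrightarrow> X n \<in> ob C"
  shows "cat_ideal R C (sum_ideal R C X P)"
  unfolding cat_ideal_def
proof (intro conjI ballI)
  show "submodule (sum_ideal R C X P Y Z) R (Hom C Y Z)" if "Y \<in> ob C" "Z \<in> ob C" for Y Z
    using sum_ideal_submodule X that by blast
  fix U V W assume ob: "U \<in> ob C" "V \<in> ob C" "W \<in> ob C"
  note S = sum_ideal_submodule[OF X ob(1,3)]
  show "cmp C U V W g f \<in> sum_ideal R C X P U W"
    if g: "g \<in> carrier (Hom C V W)" and f: "f \<in> sum_ideal R C X P U V" for g f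
  proof (rule sum_ideal_map_in[OF ob(1,2) Hom_module[OF ob(1,3)] cmp_lin_map_left[OF ob g] S X _ f])
    fix n h k assume n: "n \<in> P" and hk: "h \<in> carrier (Hom C (X n) V)" "k \<in> carrier (Hom C U (X n))"
    have "cmp C U V W g (cmp C U (X n) V h k) = cmp C U (X n) W (cmp C (X n) V W g h) k"
      using cmp_assoc[OF ob(1) X[OF n] ob(2,3) g hk] by simp
    then show "cmp C U V W g (cmp C U (X n) V h k) \<in> sum_ideal R C X P U W"
      using composite_in_sum_ideal[of n P] n cmp_closed[OF X[OF n] ob(2,3) g hk(1)] hk(2) by simp
  qed
  show "cmp C U V W g f \<in> sum_ideal R C X P U W"
    if g: "g \<in> sum_ideal R C X P V W" and f: "f \<in> carrier (Hom C U V)" for g f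
  proof (rule sum_ideal_map_in[OF ob(2,3) Hom_module[OF ob(1,3)] cmp_lin_map_right[OF ob f] S X _ g])
    fix n h k assume n: "n \<in> P" and hk: "h \<in> carrier (Hom C (X n) W)" "k \<in> carrier (Hom C V (X n))"
    have "cmp C U V W (cmp C V (X n) W h k) f = cmp C U (X n) W h (cmp C U V (X n) k f)"
      using cmp_assoc[OF ob(1,2) X[OF n] ob(3) hk f] by simp
    then show "cmp C U V W (cmp C V (X n) W h k) f \<in> sum_ideal R C X P U W"
      using composite_in_sum_ideal[of n P] n cmp_closed[OF ob(1,2) X[OF n] hk(2) f] hk(1) by simp
  qed
qed

section \<open>Endomorphism algebras and generated ideals in the quotient category\<close>

lemma End_alg_coset: "I +>\<^bsub>End_alg C X\<^esub> a = I +>\<^bsub>Hom C X X\<^esub> a"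
  by (simp add: a_r_coset_def')

lemma quot_End_alg: "quot (End_alg C X) (I X X) = End_alg (quot_cat C I) X"
  by (simp add: quot_def quot_cat_def End_alg_def A_RCOSETS_def' a_r_coset_def' rcoset_mult_def
      set_add_def' fun_eq_iff)

lemma cat_ideal_ideal:
  assumes I: "cat_ideal R C I" and X: "X \<in> ob C"
  shows "ideal (I X X) (End_alg C X)"
proof (rule idealI)
  show "ring (End_alg C X)" using End_alg_k_algebra[OF X] by (simp add: k_algebra_def)
  have "submodule (I X X) R (End_alg C X)"
    using cat_idealD(1)[OF I X X] by (subst submodule_cong[of _ "Hom C X X"]) simp_all
  then show "subgroup (I X X) (add_monoid (End_alg C X))" by (simp only: submodule_def)
qed (use cat_idealD(2,3)[OF I X X X] in auto)

text \<open>Every morphism of the quotient is a coset and composites of cosets are cosets of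
  composites, so generators go onto generators; the projection is linear, so spans go onto
  spans.\<close>

lemma gen_ideal_quot_cat:
  assumes I: "cat_ideal R C I" and ob: "X \<in> ob C" "Y \<in> ob C" "Z \<in> ob C"
  shows "gen_ideal R (quot_cat C I) Z X Y = (\<lambda>f. I X Y +>\<^bsub>Hom C X Y\<^esub> f) ` gen_ideal R C Z X Y"
proof -
  let ?q = "\<lambda>f. I X Y +>\<^bsub>Hom C X Y\<^esub> f"
  let ?S = "{cmp C X Z Y g f | g f. g \<in> carrier (Hom C Z Y) \<and> f \<in> carrier (Hom C X Z)}"
  let ?S' = "{cmp (quot_cat C I) X Z Y g f | g f.
    g \<in> carrier (quot (Hom C Z Y) (I Z Y)) \<and> f \<in> carrier (quot (Hom C X Z) (I X Z))}"
  note S = cat_idealD(1)[OF I]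
  have "?S' = ?q ` ?S"
  proof
    show "?S' \<subseteq> ?q ` ?S"
      using ob by (force simp: module.quot_carrier[OF Hom_module] quot_cat_cmp[OF I])
    show "?q ` ?S \<subseteq> ?S'"
    proof
      fix u assume "u \<in> ?q ` ?S"
      then obtain g f where "g \<in> carrier (Hom C Z Y)" "f \<in> carrier (Hom C X Z)" "u = ?q (cmp C X Z Y g f)"
        by blast
      then show "u \<in> ?S'"
        using ob quot_cat_cmp[OF I ob(1,3,2), of g f, symmetric]
        by (auto simp: module.quot_carrier[OF Hom_module])
    qed
  qed
  moreover have "?q ` lin_span R (Hom C X Y) ?S = lin_span R (quot (Hom C X Y) (I X Y)) (?q ` ?S)"
    using ob by (intro lin_span_image Hom_module module.quot_module[OF Hom_module S]
        module.coset_lin_map[OF Hom_module S] composites_in_Hom)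
  ultimately show ?thesis unfolding gen_ideal_def by simp
qed

end

section \<open>The standard filter\<close>

locale filtered_category = linear_category R C
  for R :: "('k, 'r) ring_scheme" and C :: "('o, 'k, 'm) lincat" +
  fixes X :: "'l::order \<Rightarrow> 'o" and B :: "'l \<Rightarrow> 'm set"
  assumes X_ob: "\<And>l. X l \<in> ob C"
    and B_subalg: "\<And>l. subalg R (End_alg C (X l)) (B l)"
    and Hom_eq: "\<And>l m. carrier (Hom C (X m) (X l)) = sum_ideal R C X ({..l} \<inter> {..m}) (X m) (X l)"
    and End_eq: "\<And>l. carrier (End_alg C (X l)) =
               B l <+>\<^bsub>End_alg C (X l)\<^esub> sum_ideal R C X {..<l} (X l) (X l)"
begin

abbreviation "Q l \<equiv> quot_below R C X l"
abbreviation "I l \<equiv> sum_ideal R C X {..<l}"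

lemma cat_ideal_sum: "cat_ideal R C (sum_ideal R C X P)"
  by (rule sum_ideal_cat_ideal) (rule X_ob)

lemma sum_submodule: "submodule (sum_ideal R C X P (X l) (X m)) R (Hom C (X l) (X m))"
  using cat_idealD(1)[OF cat_ideal_sum X_ob X_ob] .

lemma Hom_X_module: "module R (Hom C (X l) (X m))"
  by (rule Hom_module[OF X_ob X_ob])

lemma Q_linear_category: "linear_category R (Q l)"
  unfolding quot_below_def by (rule quot_cat_linear_category[OF cat_ideal_sum])

lemma sum_submodule_End: "submodule (sum_ideal R C X P (X l) (X l)) R (End_alg C (X l))"
  using sum_submodule by (subst submodule_cong[of _ "Hom C (X l) (X l)"]) simp_all

text \<open>For a down-closed \<open>P\<close>, a filter term with index in \<open>P\<close>
  involves only objects with index in \<open>P\<close>, and a composite through \<open>X n\<close>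
  already lies in the term of index \<open>n\<close>. It is applied to the indices strictly below
  \<open>l\<close>, to all indices, and to those below both \<open>l\<close> and
  \<open>m\<close>.\<close>

lemma submod_sum_End_filter:
  assumes "\<And>p q. \<lbrakk>p \<in> P; q \<le> p\<rbrakk> \<Longrightarrow> q \<in> P"
  shows "submod_sum R (End_alg C (X w)) (End_filter R C X w) P = sum_ideal R C X P (X w) (X w)"
proof
  show "submod_sum R (End_alg C (X w)) (End_filter R C X w) P \<subseteq> sum_ideal R C X P (X w) (X w)"
    unfolding End_filter_def using assms
    by (intro submod_sum_least sum_submodule_End sum_ideal_mono) auto
  have F: "End_filter R C X w l \<subseteq> carrier (End_alg C (X w))" for l
    unfolding End_filter_def using submoduleD(1)[OF sum_submodule_End] by blast
  have A: "module R (End_alg C (X w))"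
    using End_alg_k_algebra[OF X_ob] by (simp add: k_algebra_def)
  have "submodule (submod_sum R (End_alg C (X w)) (End_filter R C X w) P) R (Hom C (X w) (X w))"
    using submod_sum_submodule[OF A F]
    by (subst (asm) submodule_cong[of _ "Hom C (X w) (X w)"]) simp_all
  then show "sum_ideal R C X P (X w) (X w) \<subseteq> submod_sum R (End_alg C (X w)) (End_filter R C X w) P"
  proof (rule sum_ideal_least)
    fix n g f assume n: "n \<in> P" and "g \<in> carrier (Hom C (X n) (X w))" "f \<in> carrier (Hom C (X w) (X n))"
    then have "cmp C (X w) (X n) (X w) g f \<in> End_filter R C X w n"
      unfolding End_filter_def by (intro composite_in_sum_ideal) auto
    then show "cmp C (X w) (X n) (X w) g f \<in> submod_sum R (End_alg C (X w)) (End_filter R C X w) P"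
      by (rule subsetD[OF submod_sum_incl[OF n]])
  qed
qed

lemma filter_below_eq:
  "filter_below R (End_alg C (X w)) (End_filter R C X w) l = I l (X w) (X w)"
  unfolding filter_below_def by (rule submod_sum_End_filter) auto

lemma quot_filter_below:
  "quot (End_alg C (X w)) (filter_below R (End_alg C (X w)) (End_filter R C X w) l) = End_alg (Q l) (X w)"
  unfolding filter_below_eq quot_below_def by (rule quot_End_alg)

text \<open>The three objects are kept apart so that taking \<open>X l\<close> as source or target
  also gives the annihilation conditions, where one factor is a morphism between \<open>X l\<close>
  and \<open>X w\<close>.\<close>

lemma End_filter_prod:
  assumes a: "a \<in> sum_ideal R C X {..l} (X n) (X w)" and b: "b \<in> sum_ideal R C X {..m} (X v) (X n)"
  shows "cmp C (X v) (X n) (X w) a b \<in> sum_ideal R C X ({..l} \<inter> {..m}) (X v) (X w)" (is "_ \<in> ?S")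
proof -
  have bc: "b \<in> carrier (Hom C (X v) (X n))" using submoduleD(1)[OF sum_submodule b] .
  show ?thesis
  proof (rule sum_ideal_map_in[OF X_ob X_ob Hom_X_module cmp_lin_map_right[OF X_ob X_ob X_ob bc] sum_submodule X_ob _ a])
    fix p g h assume p: "p \<in> {..l}" and g: "g \<in> carrier (Hom C (X p) (X w))" and h: "h \<in> carrier (Hom C (X n) (X p))"
    have "cmp C (X v) (X n) (X w) (cmp C (X n) (X p) (X w) g h) b \<in> ?S"
    proof (rule sum_ideal_map_in[OF X_ob X_ob Hom_X_module
          cmp_lin_map_left[OF X_ob X_ob X_ob cmp_closed[OF X_ob X_ob X_ob g h]] sum_submodule X_ob _ b])
      fix q g' h' assume q: "q \<in> {..m}" and g': "g' \<in> carrier (Hom C (X q) (X n))"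
        and h': "h' \<in> carrier (Hom C (X v) (X q))"
      \<comment> \<open>The middle part \<open>X q \<rightarrow> X n \<rightarrow> X p\<close> is a
        morphism \<open>X q \<rightarrow> X p\<close>, so \<open>Hom_eq\<close> rewrites it through
        indices below \<open>p\<close> and \<open>q\<close>; since \<open>p \<le> l\<close> and
        \<open>q \<le> m\<close>, these are below \<open>l\<close> and \<open>m\<close>.\<close>
      have "cmp C (X q) (X n) (X p) h g' \<in> sum_ideal R C X ({..p} \<inter> {..q}) (X q) (X p)"
        using cmp_closed[OF X_ob X_ob X_ob h g'] Hom_eq by simp
      also have "\<dots> \<subseteq> sum_ideal R C X ({..l} \<inter> {..m}) (X q) (X p)"
        using p q by (intro sum_ideal_mono) auto
      finally have "cmp C (X v) (X q) (X p) (cmp C (X q) (X n) (X p) h g') h'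
          \<in> sum_ideal R C X ({..l} \<inter> {..m}) (X v) (X p)"
        using cat_idealD(3)[OF cat_ideal_sum X_ob X_ob X_ob _ h'] by blast
      then have "cmp C (X v) (X p) (X w) g (cmp C (X v) (X q) (X p) (cmp C (X q) (X n) (X p) h g') h') \<in> ?S"
        using cat_idealD(2)[OF cat_ideal_sum X_ob X_ob X_ob g] by blast
      then show "cmp C (X v) (X n) (X w) (cmp C (X n) (X p) (X w) g h) (cmp C (X v) (X q) (X n) g' h') \<in> ?S"
        using g h g' h' by (simp add: cmp_assoc cmp_closed X_ob)
    qed
    then show "cmp C (X v) (X n) (X w) (cmp C (X n) (X p) (X w) g h) b \<in> ?S" .
  qed
qed

lemma End_filter_ideal_filter: "ideal_filter R (End_alg C (X w)) (End_filter R C X w)"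
  unfolding ideal_filter_def
proof (intro conjI allI impI)
  show "ideal (End_filter R C X w l) (End_alg C (X w))" for l
    unfolding End_filter_def by (rule cat_ideal_ideal[OF cat_ideal_sum X_ob])
  show "End_filter R C X w l \<subseteq> End_filter R C X w m" if "l \<le> m" for l m
    unfolding End_filter_def using that by (intro sum_ideal_mono) auto
  \<comment> \<open>With both indices equal to \<open>w\<close>, \<open>Hom_eq\<close> already
    exhausts the endomorphisms of \<open>X w\<close> by objects of index at most
    \<open>w\<close>.\<close>
  have "carrier (Hom C (X w) (X w)) \<subseteq> sum_ideal R C X UNIV (X w) (X w)"
    unfolding Hom_eq by (rule sum_ideal_mono) auto
  then show "carrier (End_alg C (X w)) = submod_sum R (End_alg C (X w)) (End_filter R C X w) UNIV"
    using submoduleD(1)[OF sum_submodule] by (subst submod_sum_End_filter) auto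
  show "ideal_prod (End_alg C (X w)) (End_filter R C X w l) (End_filter R C X w m)
      \<subseteq> submod_sum R (End_alg C (X w)) (End_filter R C X w) ({..l} \<inter> {..m})" for l m
  proof
    fix s assume s: "s \<in> ideal_prod (End_alg C (X w)) (End_filter R C X w l) (End_filter R C X w m)"
    have "s \<in> sum_ideal R C X ({..l} \<inter> {..m}) (X w) (X w)"
      using s
    proof induction
      case (prod i j)
      then show ?case using End_filter_prod[of i l w w j m w] by (simp add: End_filter_def)
    next
      case (sum s1 s2)
      then show ?case using submoduleD(3)[OF sum_submodule] by simp
    qed
    then show "s \<in> submod_sum R (End_alg C (X w)) (End_filter R C X w) ({..l} \<inter> {..m})"
      by (subst submod_sum_End_filter) auto
  qed
qed

text \<open>A common lower bound equal to \<open>l\<close> would force \<open>l \<le> m\<close>.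
  This turns the condition on \<open>l\<close> and \<open>m\<close> into membership in the ideal
  that is killed in \<open>Q l\<close>.\<close>

lemma Int_atMost_less:
  fixes l m :: 'l
  shows "\<not> l \<le> m \<Longrightarrow> {..l} \<inter> {..m} \<subseteq> {..<l}"
  by (auto simp: less_le)

lemma End_filter_annihilates:
  assumes "\<not> l \<le> m"
  shows "\<lbrakk>a \<in> End_filter R C X w m; x \<in> carrier (Hom C (X l) (X w))\<rbrakk> \<Longrightarrow>
      cmp C (X l) (X w) (X w) a x \<in> I l (X l) (X w)"
    and "\<lbrakk>a \<in> End_filter R C X w m; y \<in> carrier (Hom C (X w) (X l))\<rbrakk> \<Longrightarrow>
      cmp C (X w) (X w) (X l) y a \<in> I l (X w) (X l)"
proof -
  \<comment> \<open>By \<open>Hom_eq\<close>, a morphism with source or target \<open>X l\<close> is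
    a sum of composites through objects of index at most \<open>l\<close>, so it can serve as one
    factor in \<open>End_filter_prod\<close>.\<close>
  have l: "carrier (Hom C (X l) (X w)) \<subseteq> sum_ideal R C X {..l} (X l) (X w)"
    "carrier (Hom C (X w) (X l)) \<subseteq> sum_ideal R C X {..l} (X w) (X l)"
    unfolding Hom_eq by (intro sum_ideal_mono; auto)+
  show "cmp C (X l) (X w) (X w) a x \<in> I l (X l) (X w)"
    if "a \<in> End_filter R C X w m" "x \<in> carrier (Hom C (X l) (X w))"
    using End_filter_prod[of a m w w x l l] that subsetD[OF l(1)]
      subsetD[OF sum_ideal_mono[OF Int_atMost_less[OF assms]]]
    by (simp add: End_filter_def Int_commute)
  show "cmp C (X w) (X w) (X l) y a \<in> I l (X w) (X l)"
    if "a \<in> End_filter R C X w m" "y \<in> carrier (Hom C (X w) (X l))"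
    using End_filter_prod[of y l w l a m w] that subsetD[OF l(2)]
      subsetD[OF sum_ideal_mono[OF Int_atMost_less[OF assms]]]
    by (simp add: End_filter_def)
qed

section \<open>The algebras \<open>B l\<close> and their image in the quotient category\<close>

lemma sub_End_simps [simp]:
  "carrier (sub_End C X B l) = B l" "mult (sub_End C X B l) = cmp C (X l) (X l) (X l)"
  "one (sub_End C X B l) = ident C (X l)" "\<zero>\<^bsub>sub_End C X B l\<^esub> = \<zero>\<^bsub>Hom C (X l) (X l)\<^esub>"
  "ring.add (sub_End C X B l) = ring.add (Hom C (X l) (X l))"
  "smult (sub_End C X B l) = smult (Hom C (X l) (X l))"
  by (simp_all add: sub_End_def)

lemma M_mod_simps [simp]:
  "carrier (M_mod R C X w l) = carrier (Hom (Q l) (X l) (X w))"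
  "\<zero>\<^bsub>M_mod R C X w l\<^esub> = \<zero>\<^bsub>Hom (Q l) (X l) (X w)\<^esub>"
  "ring.add (M_mod R C X w l) = ring.add (Hom (Q l) (X l) (X w))"
  "smult (M_mod R C X w l) = smult (Hom (Q l) (X l) (X w))"
  "lact (M_mod R C X w l) a x = cmp (Q l) (X l) (X w) (X w) a x"
  "ract (M_mod R C X w l) x b = cmp (Q l) (X l) (X l) (X w) x (canon R C X l b)"
  by (simp_all add: M_mod_def Let_def)

lemma N_mod_simps [simp]:
  "carrier (N_mod R C X w l) = carrier (Hom (Q l) (X w) (X l))"
  "\<zero>\<^bsub>N_mod R C X w l\<^esub> = \<zero>\<^bsub>Hom (Q l) (X w) (X l)\<^esub>"
  "ring.add (N_mod R C X w l) = ring.add (Hom (Q l) (X w) (X l))"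
  "smult (N_mod R C X w l) = smult (Hom (Q l) (X w) (X l))"
  "lact (N_mod R C X w l) b y = cmp (Q l) (X w) (X l) (X l) (canon R C X l b) y"
  "ract (N_mod R C X w l) y a = cmp (Q l) (X w) (X w) (X l) y a"
  by (simp_all add: N_mod_def Let_def)

lemma sub_End_k_algebra: "k_algebra R (sub_End C X B l)"
  unfolding sub_End_def
  by (rule k_algebra.subalg_k_algebra[OF End_alg_k_algebra[OF X_ob] B_subalg])

lemma B_submodule: "submodule (B l) R (Hom C (X l) (X l))"
  using B_subalg[of l] submodule_cong[of "End_alg C (X l)" "Hom C (X l) (X l)" "B l" R]
  by (simp add: subalg_def)

lemma B_carrier: "b \<in> B l \<Longrightarrow> b \<in> carrier (Hom C (X l) (X l))"
  by (rule submoduleD(1)[OF B_submodule])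

text \<open>The zero of the quotient is the ideal itself, and the coset of \<open>b\<close> equals
  it exactly when \<open>b\<close> lies in the ideal. As an intersection, \<open>B_ker\<close>
  inherits its closure properties and its grading from the two factors.\<close>

lemma B_ker_eq: "B_ker R C X B l = B l \<inter> I l (X l) (X l)"
proof -
  have "I l (X l) (X l) +>\<^bsub>Hom C (X l) (X l)\<^esub> b = I l (X l) (X l) \<longleftrightarrow> b \<in> I l (X l) (X l)"
    if "b \<in> B l" for b
    using module.coset_zero_iff[OF Hom_X_module sum_submodule B_carrier[OF that]] .
  moreover have "\<zero>\<^bsub>End_alg (Q l) (X l)\<^esub> = I l (X l) (X l)"
    by (simp add: quot_below_def module.quot_zero[OF Hom_X_module]
        linear_category.End_alg_simps[OF Q_linear_category, unfolded quot_below_def])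
  ultimately show ?thesis
    unfolding B_ker_def a_kernel_def' proj_below_def by (simp add: Int_def cong: conj_cong)
qed

lemma B_ker_ideal: "ideal (B_ker R C X B l) (sub_End C X B l)"
proof (rule idealI)
  interpret B: k_algebra R "sub_End C X B l" by (rule sub_End_k_algebra)
  show "ring (sub_End C X B l)" by (rule B.ring_axioms)
  note J = submoduleD[OF submodule_Int[OF Hom_X_module B_submodule[of l]
        sum_submodule[where P = "{..<l}"]]]
  have "submodule (B_ker R C X B l) R (sub_End C X B l)"
    unfolding B_ker_eq
  proof (rule B.submoduleI)
    fix a assume a: "a \<in> B l \<inter> I l (X l) (X l)"
    have "\<ominus>\<^bsub>Hom C (X l) (X l)\<^esub> a \<in> B l \<inter> I l (X l) (X l)" using J(4)[OF a] .
    \<comment> \<open>Additive inverses in \<open>sub_End\<close> are defined relative to the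
      carrier \<open>B l\<close>; uniqueness of inverses identifies them with those of the Hom
      module.\<close>
    moreover have "\<ominus>\<^bsub>Hom C (X l) (X l)\<^esub> a = \<ominus>\<^bsub>sub_End C X B l\<^esub> a"
      using B.minus_equality[of "\<ominus>\<^bsub>Hom C (X l) (X l)\<^esub> a" a] a J(4)[OF a] J(1)[OF a]
        abelian_group.l_neg[OF module.axioms(2)[OF Hom_X_module]] by simp
    ultimately show "\<ominus>\<^bsub>sub_End C X B l\<^esub> a \<in> B l \<inter> I l (X l) (X l)" by simp
  qed (use J in auto)
  then show "subgroup (B_ker R C X B l) (add_monoid (sub_End C X B l))" by (simp only: submodule_def)
qed (use cat_idealD(2,3)[OF cat_ideal_sum X_ob X_ob X_ob] B_carrier B_subalg in
    \<open>auto simp: B_ker_eq subalg_def\<close>)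

lemma quot_B_k_algebra: "k_algebra R (quot (sub_End C X B l) (B_ker R C X B l))"
  by (rule k_algebra.quot_k_algebra[OF sub_End_k_algebra B_ker_ideal])

lemma B_ker_submodule: "submodule (B_ker R C X B l) R (sub_End C X B l)"
  by (rule k_algebra.ideal_submodule[OF sub_End_k_algebra B_ker_ideal])

text \<open>\<open>canon\<close> is a union over a coset whose members differ by elements of the
  kernel; these lie in the ideal, so all members have the same projection.\<close>

lemma canon_coset:
  assumes b: "b \<in> B l"
  shows "canon R C X l (B_ker R C X B l +>\<^bsub>sub_End C X B l\<^esub> b) = proj_below R C X l b"
proof -
  interpret E: module R "Hom C (X l) (X l)" by (rule Hom_X_module)
  have "proj_below R C X l (k \<oplus>\<^bsub>Hom C (X l) (X l)\<^esub> b) = proj_below R C X l b"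
    if k: "k \<in> B_ker R C X B l" for k
  proof -
    have k': "k \<in> carrier (Hom C (X l) (X l))" "k \<in> I l (X l) (X l)" "b \<in> carrier (Hom C (X l) (X l))"
      using k b B_carrier by (auto simp: B_ker_eq)
    then have "(k \<oplus>\<^bsub>Hom C (X l) (X l)\<^esub> b) \<ominus>\<^bsub>Hom C (X l) (X l)\<^esub> b = k"
      by (simp add: a_minus_def E.M.a_assoc E.M.r_neg)
    then show ?thesis
      unfolding proj_below_def using k' E.coset_eq_iff[OF sum_submodule] by simp
  qed
  moreover have "B_ker R C X B l \<noteq> {}" using submoduleD(2)[OF B_ker_submodule] by blast
  ultimately show ?thesis by (simp add: canon_def a_r_coset_def')
qed

text \<open>Injectivity holds because the kernel of the projection has been divided out,
  surjectivity because of \<open>End_eq\<close>. This is the isomorphism with which the Morita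
  context of two objects is instantiated.\<close>

lemma canon_alg_iso:
  "canon R C X l \<in> alg_iso R (quot (sub_End C X B l) (B_ker R C X B l)) (End_alg (Q l) (X l))"
proof -
  let ?S = "sub_End C X B l" and ?J = "B_ker R C X B l" and ?E = "Hom C (X l) (X l)"
  let ?I = "I l (X l) (X l)"
  interpret E: module R ?E by (rule Hom_X_module)
  interpret S: k_algebra R ?S by (rule sub_End_k_algebra)
  interpret Q: linear_category R "Q l" by (rule Q_linear_category)
  have carr: "carrier (quot ?S ?J) = (\<lambda>b. ?J +>\<^bsub>?S\<^esub> b) ` B l"
    using S.quot_carrier[of ?J] by simp
  have QE: "Hom (Q l) (X l) (X l) = quot ?E ?I" by (simp add: quot_below_def)
  have proj: "proj_below R C X l b = ?I +>\<^bsub>?E\<^esub> b" for b by (simp add: proj_below_def)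
  note S_ops = S.quot_add[OF B_ker_submodule, simplified] S.quot_smult[OF B_ker_submodule, simplified]
    S.quot_mult[OF B_ker_ideal, simplified]
  note Q_ops = E.quot_add[OF sum_submodule] E.quot_smult[OF sum_submodule]
    quot_cat_cmp[OF cat_ideal_sum X_ob X_ob X_ob]
  have B: "\<lbrakk>b \<in> B l; b' \<in> B l\<rbrakk> \<Longrightarrow> b \<oplus>\<^bsub>?E\<^esub> b' \<in> B l"
    "\<lbrakk>b \<in> B l; b' \<in> B l\<rbrakk> \<Longrightarrow> cmp C (X l) (X l) (X l) b b' \<in> B l"
    "\<lbrakk>c \<in> carrier R; b \<in> B l\<rbrakk> \<Longrightarrow> c \<odot>\<^bsub>?E\<^esub> b \<in> B l" "ident C (X l) \<in> B l" for b b' c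
    using B_subalg[of l] submoduleD[OF B_submodule] by (auto simp: subalg_def)
  have "canon R C X l \<in> ring_hom (quot ?S ?J) (End_alg (Q l) (X l))"
  proof (rule ring_hom_memI)
    fix x assume "x \<in> carrier (quot ?S ?J)"
    then obtain b where b: "b \<in> B l" "x = ?J +>\<^bsub>?S\<^esub> b" by (auto simp: carr)
    show "canon R C X l x \<in> carrier (End_alg (Q l) (X l))"
      using b B_carrier by (auto simp: canon_coset proj QE E.quot_carrier)
    fix y assume "y \<in> carrier (quot ?S ?J)"
    then obtain b' where b': "b' \<in> B l" "y = ?J +>\<^bsub>?S\<^esub> b'" by (auto simp: carr)
    show "canon R C X l (x \<oplus>\<^bsub>quot ?S ?J\<^esub> y) = canon R C X l x \<oplus>\<^bsub>End_alg (Q l) (X l)\<^esub> canon R C X l y"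
      using b b' B B_carrier by (simp add: S_ops canon_coset proj QE Q_ops)
    show "canon R C X l (x \<otimes>\<^bsub>quot ?S ?J\<^esub> y) = canon R C X l x \<otimes>\<^bsub>End_alg (Q l) (X l)\<^esub> canon R C X l y"
      using b b' B B_carrier by (simp add: S_ops canon_coset proj) (simp add: quot_below_def Q_ops)
  next
    have "\<one>\<^bsub>quot ?S ?J\<^esub> = ?J +>\<^bsub>?S\<^esub> ident C (X l)" by (simp add: quot_def)
    then show "canon R C X l \<one>\<^bsub>quot ?S ?J\<^esub> = \<one>\<^bsub>End_alg (Q l) (X l)\<^esub>"
      using B by (simp add: canon_coset proj) (simp add: quot_below_def)
  qed
  moreover have "canon R C X l (c \<odot>\<^bsub>quot ?S ?J\<^esub> x) = c \<odot>\<^bsub>End_alg (Q l) (X l)\<^esub> canon R C X l x"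
    if c: "c \<in> carrier R" and x: "x \<in> carrier (quot ?S ?J)" for c x
  proof -
    obtain b where b: "b \<in> B l" "x = ?J +>\<^bsub>?S\<^esub> b" using x by (auto simp: carr)
    then show ?thesis using c B B_carrier by (simp add: S_ops canon_coset proj QE Q_ops)
  qed
  moreover have "bij_betw (canon R C X l) (carrier (quot ?S ?J)) (carrier (End_alg (Q l) (X l)))"
    unfolding bij_betw_def
  proof
    show "inj_on (canon R C X l) (carrier (quot ?S ?J))"
    proof (rule inj_onI)
      fix x y assume "x \<in> carrier (quot ?S ?J)" "y \<in> carrier (quot ?S ?J)"
        and eq: "canon R C X l x = canon R C X l y"
      then obtain b b' where b: "b \<in> B l" "x = ?J +>\<^bsub>?S\<^esub> b" "b' \<in> B l" "y = ?J +>\<^bsub>?S\<^esub> b'"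
        by (auto simp: carr)
      define k where "k = b \<ominus>\<^bsub>?E\<^esub> b'"
      have bc: "b \<in> carrier ?E" "b' \<in> carrier ?E" using b B_carrier by auto
      have "k \<in> ?I" using eq b bc E.coset_eq_iff[OF sum_submodule] by (simp add: k_def canon_coset proj)
      moreover have "k \<in> B l"
        using b submoduleD(3,4)[OF B_submodule] by (simp add: k_def a_minus_def)
      moreover have "b = k \<oplus>\<^bsub>?E\<^esub> b'" using bc by (simp add: k_def a_minus_def E.M.a_assoc E.M.l_neg)
      ultimately have "b \<in> ?J +>\<^bsub>?S\<^esub> b'" by (auto simp: a_r_coset_def' B_ker_eq)
      then show "x = y"
        unfolding b(2,4) using b(3) by (intro S.coset_mem_eq(2)[OF B_ker_submodule]) simp_all
    qed
    show "canon R C X l ` carrier (quot ?S ?J) = carrier (End_alg (Q l) (X l))"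
    proof
      show "canon R C X l ` carrier (quot ?S ?J) \<subseteq> carrier (End_alg (Q l) (X l))"
        using B_carrier by (auto simp: carr canon_coset proj QE E.quot_carrier)
      show "carrier (End_alg (Q l) (X l)) \<subseteq> canon R C X l ` carrier (quot ?S ?J)"
      proof
        fix u assume "u \<in> carrier (End_alg (Q l) (X l))"
        then obtain f where f: "f \<in> carrier (End_alg C (X l))" "u = ?I +>\<^bsub>?E\<^esub> f"
          by (auto simp: QE E.quot_carrier)
        \<comment> \<open>The summand \<open>i\<close> vanishes in the quotient, so \<open>b\<close>
          represents the same coset as \<open>f\<close> and its class is the required
          preimage.\<close>
        then obtain b i where bi: "b \<in> B l" "i \<in> ?I" "f = b \<oplus>\<^bsub>?E\<^esub> i"
          unfolding End_eq by (auto simp: set_add_def')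
        have c: "b \<in> carrier ?E" "i \<in> carrier ?E"
          using bi B_carrier submoduleD(1)[OF sum_submodule] by auto
        then have "f \<ominus>\<^bsub>?E\<^esub> b = i" using bi(3) E.M.a_comm[of b i] by (simp add: a_minus_def E.M.a_assoc E.M.r_neg)
        then have "u = canon R C X l (?J +>\<^bsub>?S\<^esub> b)"
          using f bi c E.coset_eq_iff[OF sum_submodule] by (simp add: canon_coset proj)
        then show "u \<in> canon R C X l ` carrier (quot ?S ?J)" using bi(1) by (auto simp: carr)
      qed
    qed
  qed
  ultimately show ?thesis by (auto simp: alg_iso_def ring_iso_def)
qed

text \<open>Composites through \<open>X n\<close> with \<open>n < l\<close> vanish in the quotient,
  so of the filter term of index \<open>l\<close> only the composites through \<open>X l\<close>
  survive. They span the ideal generated by \<open>X l\<close> in \<open>Q l\<close>, which is the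
  trace ideal.\<close>

lemma gen_ideal_quot_below:
  "gen_ideal R (Q l) (X l) (X w) (X w) =
    (\<lambda>a. filter_below R (End_alg C (X w)) (End_filter R C X w) l +>\<^bsub>End_alg C (X w)\<^esub> a) ` End_filter R C X w l"
proof -
  let ?I = "I l (X w) (X w)" and ?E = "Hom C (X w) (X w)"
  let ?q = "\<lambda>f. ?I +>\<^bsub>?E\<^esub> f"
  interpret E: module R ?E by (rule Hom_X_module)
  have G: "submodule (?q ` gen_ideal R C (X l) (X w) (X w)) R (quot ?E ?I)"
    by (intro submodule_image[OF Hom_X_module E.quot_module E.coset_lin_map] sum_submodule
        gen_ideal_submodule X_ob)
  have "?q ` gen_ideal R C (X l) (X w) (X w) = ?q ` End_filter R C X w l"
  proof
    have "gen_ideal R C (X l) (X w) (X w) \<subseteq> End_filter R C X w l"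
      unfolding End_filter_def sum_ideal_def
      by (rule submod_sum_incl[where F = "\<lambda>n. gen_ideal R C (X n) (X w) (X w)"]) simp
    then show "?q ` gen_ideal R C (X l) (X w) (X w) \<subseteq> ?q ` End_filter R C X w l" by blast
    have "?q x \<in> ?q ` gen_ideal R C (X l) (X w) (X w)" if "x \<in> sum_ideal R C X {..l} (X w) (X w)" for x
    proof (rule sum_ideal_map_in[OF X_ob X_ob E.quot_module[OF sum_submodule]
          E.coset_lin_map[OF sum_submodule] G X_ob _ that])
      fix n g f
      assume n: "n \<in> {..l}" and gf: "g \<in> carrier (Hom C (X n) (X w))" "f \<in> carrier (Hom C (X w) (X n))"
      show "?q (cmp C (X w) (X n) (X w) g f) \<in> ?q ` gen_ideal R C (X l) (X w) (X w)"
      proof (cases "n = l")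
        case True
        then show ?thesis using composite_in_gen_ideal gf by blast
      next
        case False
        then have "cmp C (X w) (X n) (X w) g f \<in> ?I" using n gf by (intro composite_in_sum_ideal) auto
        then have "?q (cmp C (X w) (X n) (X w) g f) = \<zero>\<^bsub>quot ?E ?I\<^esub>"
          using E.coset_zero_iff[OF sum_submodule] gf by (simp add: E.quot_zero cmp_closed X_ob)
        then show ?thesis using submoduleD(2)[OF G] by simp
      qed
    qed
    then show "?q ` End_filter R C X w l \<subseteq> ?q ` gen_ideal R C (X l) (X w) (X w)"
      by (auto simp: End_filter_def)
  qed
  then show ?thesis
    unfolding filter_below_eq End_alg_coset quot_below_def
    by (simp add: gen_ideal_quot_cat[OF cat_ideal_sum X_ob X_ob X_ob])
qed

text \<open>
  The last two conditions encode linearity of \<open>\<eta>\<close> and \<open>\<rho>\<close> in a form that does not need the tensor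
  product to be a module; they reduce the preservation of parities to pure tensors.
\<close>

definition structure_maps ::
  "'l \<Rightarrow> 'l \<Rightarrow> ((('m set \<times> 'm set) \<Rightarrow>\<^sub>0 int) set \<Rightarrow> 'm set) \<Rightarrow>
    ((('m set \<times> 'm set) \<Rightarrow>\<^sub>0 int) set \<Rightarrow> 'm set) \<Rightarrow> bool" where
  "structure_maps w l \<eta> \<rho> \<longleftrightarrow>
    (let A = End_alg (Q l) (X w); S = quot (sub_End C X B l) (B_ker R C X B l);
         M = M_mod R C X w l; N = N_mod R C X w l in
      morita_context R A S M N \<eta> \<rho> \<and>
      trace_ideal S M N \<eta> = gen_ideal R (Q l) (X l) (X w) (X w) \<and>
      (\<forall>x\<in>carrier (Hom (Q l) (X l) (X w)). \<forall>y\<in>carrier (Hom (Q l) (X w) (X l)).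
        \<eta> (pure_tensor S M N x y) = cmp (Q l) (X w) (X l) (X w) x y \<and>
        \<rho> (pure_tensor A N M y x) \<in> carrier S \<and>
        canon R C X l (\<rho> (pure_tensor A N M y x)) = cmp (Q l) (X l) (X w) (X l) y x) \<and>
      (\<forall>H. submodule H R (Hom (Q l) (X w) (X w)) \<longrightarrow>
        submodule {t \<in> carrier (tensor S M N). \<eta> t \<in> H} R (tensor S M N)) \<and>
      (\<forall>H. submodule H R S \<longrightarrow>
        submodule {t \<in> carrier (tensor A N M). \<rho> t \<in> H} R (tensor A N M)))"

text \<open>The Morita context of two objects is applied in \<open>Q l\<close> to \<open>X l\<close>
  and \<open>X w\<close> with \<open>canon\<close> as the isomorphism; unfolding
  \<open>M_mod\<close> and \<open>N_mod\<close> gives exactly its two bimodules.\<close>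

lemma structure_maps_exist: "\<exists>\<eta> \<rho>. structure_maps w l \<eta> \<rho>"
proof -
  have ob: "X l \<in> ob (Q l)" "X w \<in> ob (Q l)" using X_ob by (auto simp: quot_below_def)
  show ?thesis
    unfolding structure_maps_def Let_def M_mod_def N_mod_def
    by (rule linear_category.morita_context_Hom[OF Q_linear_category ob quot_B_k_algebra canon_alg_iso])
      blast
qed

theorem structure_maps_standard_filter:
  assumes "\<And>l. structure_maps w l (\<eta> l) (\<rho> l)"
  shows "standard_filter R (End_alg C (X w)) (sub_End C X B) (End_filter R C X w) (B_ker R C X B)
      (M_mod R C X w) (N_mod R C X w) \<eta> \<rho>"
  unfolding standard_filter_def quot_filter_below
proof (intro conjI allI impI ballI)
  note s = assms[unfolded structure_maps_def Let_def]
  show "k_algebra R (End_alg C (X w))" by (rule End_alg_k_algebra[OF X_ob])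
  show "ideal_filter R (End_alg C (X w)) (End_filter R C X w)" by (rule End_filter_ideal_filter)
  fix l
  show "k_algebra R (sub_End C X B l)" by (rule sub_End_k_algebra)
  show "ideal (B_ker R C X B l) (sub_End C X B l)" by (rule B_ker_ideal)
  show "morita_context R (End_alg (Q l) (X w)) (quot (sub_End C X B l) (B_ker R C X B l))
      (M_mod R C X w l) (N_mod R C X w l) (\<eta> l) (\<rho> l)" using s by blast
  show "trace_ideal (quot (sub_End C X B l) (B_ker R C X B l)) (M_mod R C X w l) (N_mod R C X w l) (\<eta> l) =
      (\<lambda>a. filter_below R (End_alg C (X w)) (End_filter R C X w) l +>\<^bsub>End_alg C (X w)\<^esub> a) ` End_filter R C X w l"
    using s[of l] gen_ideal_quot_below by metis
  fix m a assume lm: "\<not> l \<le> m" and a: "a \<in> End_filter R C X w m"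
  have ac: "a \<in> carrier (Hom C (X w) (X w))"
    using a submoduleD(1)[OF sum_submodule] by (auto simp: End_filter_def)
  show "lact (M_mod R C X w l) (filter_below R (End_alg C (X w)) (End_filter R C X w) l +>\<^bsub>End_alg C (X w)\<^esub> a) x =
      \<zero>\<^bsub>M_mod R C X w l\<^esub>" if x: "x \<in> carrier (M_mod R C X w l)" for x
  proof -
    obtain x' where x': "x' \<in> carrier (Hom C (X l) (X w))" "x = I l (X l) (X w) +>\<^bsub>Hom C (X l) (X w)\<^esub> x'"
      using x by (auto simp: quot_below_def module.quot_carrier[OF Hom_X_module])
    \<comment> \<open>The coset of \<open>a\<close> acts on the coset of \<open>x'\<close> by the
      coset of their composite, which is zero because the composite lies in
      \<open>I l\<close>.\<close>
    then show ?thesis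
      using End_filter_annihilates(1)[OF lm a x'(1)] ac
      by (simp add: quot_below_def filter_below_eq End_alg_coset quot_cat_cmp[OF cat_ideal_sum] X_ob
          module.quot_zero[OF Hom_X_module] module.coset_zero_iff[OF Hom_X_module sum_submodule] cmp_closed)
  qed
  show "ract (N_mod R C X w l) y (filter_below R (End_alg C (X w)) (End_filter R C X w) l +>\<^bsub>End_alg C (X w)\<^esub> a) =
      \<zero>\<^bsub>N_mod R C X w l\<^esub>" if y: "y \<in> carrier (N_mod R C X w l)" for y
  proof -
    obtain y' where y': "y' \<in> carrier (Hom C (X w) (X l))" "y = I l (X w) (X l) +>\<^bsub>Hom C (X w) (X l)\<^esub> y'"
      using y by (auto simp: quot_below_def module.quot_carrier[OF Hom_X_module])
    then show ?thesis
      using End_filter_annihilates(2)[OF lm a y'(1)] ac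
      by (simp add: quot_below_def filter_below_eq End_alg_coset quot_cat_cmp[OF cat_ideal_sum] X_ob
          module.quot_zero[OF Hom_X_module] module.coset_zero_iff[OF Hom_X_module sum_submodule] cmp_closed)
  qed
qed

end

section \<open>Graded submodules and quotients\<close>

lemma supermodule_cong:
  assumes "carrier M' = carrier M" "ring.add M' = ring.add M" "\<zero>\<^bsub>M'\<^esub> = \<zero>\<^bsub>M\<^esub>" "smult M' = smult M"
  shows "supermodule R M' g \<longleftrightarrow> supermodule R M g"
  unfolding supermodule_def
  using assms by (simp add: module_cong[OF assms] submodule_cong[OF assms] set_add_def')

lemma graded_sub_cong:
  "ring.add M' = ring.add M \<Longrightarrow> graded_sub M' g S = graded_sub M g S"
  by (simp add: graded_sub_def set_add_def')

lemma supermodule_module: "supermodule R M g \<Longrightarrow> module R M"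
  by (simp add: supermodule_def)

lemma supermodule_submodule: "supermodule R M g \<Longrightarrow> submodule (g d) R M"
  by (simp add: supermodule_def)

lemma supermodule_carrier: "\<lbrakk>supermodule R M g; x \<in> g d\<rbrakk> \<Longrightarrow> x \<in> carrier M"
  using submoduleD(1)[OF supermodule_submodule] .

lemma supermodule_disjoint:
  assumes "supermodule R M g" "x \<in> g d" "x \<in> g (d + 1)"
  shows "x = \<zero>\<^bsub>M\<^esub>"
  using assms by (cases "d = 0") (auto simp: supermodule_def)

text \<open>Phrased with a parity \<open>d\<close> and the opposite one \<open>d + 1\<close>, so
  that arguments about one homogeneous degree need no case split on parity.\<close>

lemma graded_sub_decompose:
  assumes M: "supermodule R M g" and S: "graded_sub M g S" and x: "x \<in> S"
  obtains y z where "y \<in> S \<inter> g d" "z \<in> S \<inter> g (d + 1)" "x = y \<oplus>\<^bsub>M\<^esub> z"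
proof -
  interpret M: module R M using M by (rule supermodule_module)
  obtain y z where yz: "y \<in> S \<inter> g 0" "z \<in> S \<inter> g 1" "x = y \<oplus>\<^bsub>M\<^esub> z"
    using S x unfolding graded_sub_def by (metis set_addE)
  then have "x = z \<oplus>\<^bsub>M\<^esub> y" using supermodule_carrier[OF M] M.a_comm[of y z] by blast
  with yz that show thesis by (cases "d = 0") auto
qed

text \<open>Compare the given sum with a decomposition \<open>u + v\<close> inside \<open>S\<close>:
  the element \<open>x - u = v - y\<close> has both parities and is therefore zero. This uniqueness
  of components drives the statements on intersections and quotients.\<close>

lemma graded_sub_component:
  assumes M: "supermodule R M g" and S: "submodule S R M" "graded_sub M g S"
    and xy: "x \<in> g d" "y \<in> g (d + 1)" "x \<oplus>\<^bsub>M\<^esub> y \<in> S"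
  shows "x \<in> S"
proof -
  interpret M: module R M using M by (rule supermodule_module)
  note c = supermodule_carrier[OF M] and G = submoduleD[OF supermodule_submodule[OF M]]
  obtain u v where uv: "u \<in> S \<inter> g d" "v \<in> S \<inter> g (d + 1)" "x \<oplus>\<^bsub>M\<^esub> y = u \<oplus>\<^bsub>M\<^esub> v"
    by (rule graded_sub_decompose[OF M S(2) xy(3)])
  have carr: "x \<in> carrier M" "y \<in> carrier M" "u \<in> carrier M" "v \<in> carrier M" using c uv xy by auto
  have "x \<ominus>\<^bsub>M\<^esub> u = (x \<oplus>\<^bsub>M\<^esub> y) \<oplus>\<^bsub>M\<^esub> (\<ominus>\<^bsub>M\<^esub> y \<oplus>\<^bsub>M\<^esub> \<ominus>\<^bsub>M\<^esub> u)"
    using carr by (simp add: a_minus_def M.M.a_assoc M.M.r_neg2)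
  also have "\<dots> = (v \<oplus>\<^bsub>M\<^esub> u) \<oplus>\<^bsub>M\<^esub> (\<ominus>\<^bsub>M\<^esub> u \<oplus>\<^bsub>M\<^esub> \<ominus>\<^bsub>M\<^esub> y)"
    unfolding uv(3) using carr M.M.a_comm[of u v] M.M.a_comm[of "\<ominus>\<^bsub>M\<^esub> u" "\<ominus>\<^bsub>M\<^esub> y"] by simp
  also have "\<dots> = v \<ominus>\<^bsub>M\<^esub> y"
    using carr by (simp add: a_minus_def M.M.a_assoc M.M.r_neg2)
  finally have "x \<ominus>\<^bsub>M\<^esub> u \<in> g (d + 1)" using G(3,4) uv xy by (simp add: a_minus_def)
  moreover have "x \<ominus>\<^bsub>M\<^esub> u \<in> g d" using G(3,4) uv xy by (simp add: a_minus_def)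
  ultimately have "x \<ominus>\<^bsub>M\<^esub> u = \<zero>\<^bsub>M\<^esub>" using supermodule_disjoint[OF M] by blast
  moreover have "x = (x \<ominus>\<^bsub>M\<^esub> u) \<oplus>\<^bsub>M\<^esub> u"
    using carr by (simp add: a_minus_def M.M.a_assoc M.M.l_neg)
  ultimately have "x = u" using carr by simp
  then show ?thesis using uv by simp
qed

lemma graded_subI:
  assumes M: "supermodule R M g" and S: "submodule S R M"
    and "\<And>x. x \<in> S \<Longrightarrow> \<exists>y\<in>S \<inter> g 0. \<exists>z\<in>S \<inter> g 1. x = y \<oplus>\<^bsub>M\<^esub> z"
  shows "graded_sub M g S"
  unfolding graded_sub_def
proof
  show "S \<subseteq> S \<inter> g 0 <+>\<^bsub>M\<^esub> S \<inter> g 1" using assms(3) by (force intro: set_addI)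
  show "S \<inter> g 0 <+>\<^bsub>M\<^esub> S \<inter> g 1 \<subseteq> S" using submoduleD(3)[OF S] by (auto simp: set_add_def')
qed

text \<open>Decompose within \<open>S\<close>; the components are unique, so the graded submodule
  \<open>T\<close> contains them as well.\<close>

lemma graded_sub_Int:
  assumes M: "supermodule R M g" and S: "submodule S R M" "graded_sub M g S"
    and T: "submodule T R M" "graded_sub M g T"
  shows "graded_sub M g (S \<inter> T)"
proof (rule graded_subI[OF M submodule_Int[OF supermodule_module[OF M] S(1) T(1)]])
  fix x assume x: "x \<in> S \<inter> T"
  interpret M: module R M using M by (rule supermodule_module)
  obtain y z where yz: "y \<in> S \<inter> g 0" "z \<in> S \<inter> g (0 + 1)" "x = y \<oplus>\<^bsub>M\<^esub> z"
    by (rule graded_sub_decompose[OF M S(2)]) (use x in blast)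
  have "z \<oplus>\<^bsub>M\<^esub> y \<in> T" "y \<oplus>\<^bsub>M\<^esub> z \<in> T"
    using x yz supermodule_carrier[OF M] by (auto simp: M.a_comm)
  then have "y \<in> T" "z \<in> T"
    using graded_sub_component[OF M T, of y 0 z] graded_sub_component[OF M T, of z 1 y] yz by auto
  then show "\<exists>y\<in>(S \<inter> T) \<inter> g 0. \<exists>z\<in>(S \<inter> T) \<inter> g 1. x = y \<oplus>\<^bsub>M\<^esub> z" using yz by auto
qed

text \<open>The sums of an even and an odd element of the span form a submodule that contains the
  homogeneous generators, hence all of the span.\<close>

lemma graded_sub_lin_span:
  assumes M: "supermodule R M g" and S: "S \<subseteq> g 0 \<union> g 1"
  shows "graded_sub M g (lin_span R M S)"
proof -
  interpret M: module R M using M by (rule supermodule_module)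
  let ?L = "lin_span R M S"
  have c: "S \<subseteq> carrier M" using S supermodule_carrier[OF M] by blast
  note L = lin_span_submodule[OF M.module_axioms c]
  note sub = submodule_Int[OF M.module_axioms L supermodule_submodule[OF M]]
  have "S \<subseteq> ?L \<inter> g 0 <+>\<^bsub>M\<^esub> ?L \<inter> g 1"
  proof
    fix s assume s: "s \<in> S"
    then have "s \<in> ?L" "s \<in> carrier M" using lin_span_incl[of S R M] c by auto
    then show "s \<in> ?L \<inter> g 0 <+>\<^bsub>M\<^esub> ?L \<inter> g 1"
      using s S set_addI[of s "?L \<inter> g 0" "\<zero>\<^bsub>M\<^esub>" "?L \<inter> g 1" M] set_addI[of "\<zero>\<^bsub>M\<^esub>" "?L \<inter> g 0" s "?L \<inter> g 1" M]
        submoduleD(2)[OF sub[of 0]] submoduleD(2)[OF sub[of 1]] by auto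
  qed
  then have "?L \<subseteq> ?L \<inter> g 0 <+>\<^bsub>M\<^esub> ?L \<inter> g 1"
    by (intro lin_span_least submodule_set_add[OF M.module_axioms] sub)
  moreover have "?L \<inter> g 0 <+>\<^bsub>M\<^esub> ?L \<inter> g 1 \<subseteq> ?L" using submoduleD(3)[OF L] by (auto simp: set_add_def')
  ultimately show ?thesis by (simp add: graded_sub_def)
qed

text \<open>Gradedness of \<open>N\<close> keeps the two parities apart: if an even and an odd
  element have the same coset, their difference lies in \<open>N\<close>, and so does each of
  them.\<close>

lemma quot_supermodule:
  assumes M: "supermodule R M g" and N: "submodule N R M" "graded_sub M g N"
  shows "supermodule R (quot M N) (quot_grading M N g)"
proof -
  interpret M: module R M using M by (rule supermodule_module)
  note c = supermodule_carrier[OF M]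
  have sub: "submodule (quot_grading M N g d) R (quot M N)" for d
    unfolding quot_grading_def
    by (rule submodule_image[OF M.module_axioms M.quot_module M.coset_lin_map supermodule_submodule[OF M]])
      (rule N(1))+
  have "carrier (quot M N) \<subseteq> quot_grading M N g 0 <+>\<^bsub>quot M N\<^esub> quot_grading M N g 1"
  proof
    fix u assume "u \<in> carrier (quot M N)"
    then obtain x where x: "x \<in> carrier M" "u = N +>\<^bsub>M\<^esub> x" by (auto simp: M.quot_carrier)
    obtain y z where yz: "y \<in> g 0" "z \<in> g 1" "x = y \<oplus>\<^bsub>M\<^esub> z"
      using M x(1) by (auto simp: supermodule_def elim: set_addE)
    then have "u = (N +>\<^bsub>M\<^esub> y) \<oplus>\<^bsub>quot M N\<^esub> (N +>\<^bsub>M\<^esub> z)"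
      using x c M.quot_add[OF N(1)] by simp
    then show "u \<in> quot_grading M N g 0 <+>\<^bsub>quot M N\<^esub> quot_grading M N g 1"
      using yz by (auto simp: quot_grading_def intro!: set_addI)
  qed
  moreover have "quot_grading M N g 0 <+>\<^bsub>quot M N\<^esub> quot_grading M N g 1 \<subseteq> carrier (quot M N)"
    using submoduleD(1)[OF submodule_set_add[OF M.quot_module[OF N(1)] sub sub]] by blast
  moreover have "u = \<zero>\<^bsub>quot M N\<^esub>" if u: "u \<in> quot_grading M N g 0" "u \<in> quot_grading M N g 1" for u
  proof -
    obtain y z where yz: "y \<in> g 0" "z \<in> g 1" "u = N +>\<^bsub>M\<^esub> y" "u = N +>\<^bsub>M\<^esub> z"
      using u by (auto simp: quot_grading_def)
    then have "y \<oplus>\<^bsub>M\<^esub> \<ominus>\<^bsub>M\<^esub> z \<in> N" using M.coset_eq_iff[OF N(1), of y z] c by (simp add: a_minus_def)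
    then have "y \<in> N"
      using graded_sub_component[OF M N, of y 0 "\<ominus>\<^bsub>M\<^esub> z"] yz
        submoduleD(4)[OF supermodule_submodule[OF M]] by simp
    then show ?thesis using yz c M.coset_zero_iff[OF N(1), of y] by (simp add: M.quot_zero)
  qed
  ultimately show ?thesis
    unfolding supermodule_def using sub M.quot_module[OF N(1)] submoduleD(2)[OF sub] by blast
qed

lemma sub_supermodule:
  assumes M: "supermodule R M g" and S: "submodule S R M" "graded_sub M g S"
  shows "supermodule R (M\<lparr>carrier := S\<rparr>) (\<lambda>d. S \<inter> g d)"
proof -
  interpret M: module R M using M by (rule supermodule_module)
  interpret S: module R "M\<lparr>carrier := S\<rparr>" by (rule submodule.submodule_is_module[OF S(1) M.module_axioms])
  have "submodule (S \<inter> g d) R (M\<lparr>carrier := S\<rparr>)" for d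
  proof (rule S.submoduleI)
    note J = submoduleD[OF submodule_Int[OF M.module_axioms S(1) supermodule_submodule[OF M, of d]]]
    fix a assume a: "a \<in> S \<inter> g d"
    have "\<ominus>\<^bsub>M\<^esub> a = \<ominus>\<^bsub>M\<lparr>carrier := S\<rparr>\<^esub> a"
      using S.minus_equality[of "\<ominus>\<^bsub>M\<^esub> a" a] a J(4)[OF a] J(1)[OF a] by (simp add: M.M.l_neg)
    then show "\<ominus>\<^bsub>M\<lparr>carrier := S\<rparr>\<^esub> a \<in> S \<inter> g d" using J(4)[OF a] by simp
  qed (use submoduleD[OF S(1)] submoduleD[OF supermodule_submodule[OF M]] in auto)
  then show ?thesis
    using S.module_axioms S(2) M submoduleD(2)[OF S(1)]
    by (auto simp: supermodule_def graded_sub_def set_add_def')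
qed

lemma quot_superalgebra:
  assumes A: "superalgebra R A g" and I: "ideal I A" "graded_sub A g I"
  shows "superalgebra R (quot A I) (quot_grading A I g)"
proof -
  interpret A: k_algebra R A using A by (simp add: superalgebra_def)
  have M: "supermodule R A g" using A by (simp add: superalgebra_def)
  have "x \<otimes>\<^bsub>quot A I\<^esub> y \<in> quot_grading A I g (d + e)"
    if xy: "x \<in> quot_grading A I g d" "y \<in> quot_grading A I g e" for x y d e
  proof -
    obtain a b where ab: "a \<in> g d" "b \<in> g e" "x = I +>\<^bsub>A\<^esub> a" "y = I +>\<^bsub>A\<^esub> b"
      using xy by (auto simp: quot_grading_def)
    then have "x \<otimes>\<^bsub>quot A I\<^esub> y = I +>\<^bsub>A\<^esub> (a \<otimes>\<^bsub>A\<^esub> b)"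
      using supermodule_carrier[OF M] A.quot_mult[OF I(1)] by simp
    moreover have "a \<otimes>\<^bsub>A\<^esub> b \<in> g (d + e)" using A ab(1,2) unfolding superalgebra_def by blast
    ultimately show ?thesis unfolding quot_grading_def by blast
  qed
  moreover have "\<one>\<^bsub>quot A I\<^esub> \<in> quot_grading A I g 0"
    using A by (simp add: quot_def quot_grading_def superalgebra_def)
  ultimately show ?thesis
    using A.quot_k_algebra[OF I(1)] quot_supermodule[OF M A.ideal_submodule[OF I(1)] I(2)]
    by (simp add: superalgebra_def)
qed

lemma sub_superalgebra:
  assumes A: "superalgebra R A g" and S: "subalg R A S" "graded_sub A g S"
  shows "superalgebra R (A\<lparr>carrier := S\<rparr>) (\<lambda>d. S \<inter> g d)"
  using A S sub_supermodule[of R A g S] k_algebra.subalg_k_algebra[of R A S]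
  by (auto simp: superalgebra_def subalg_def)

section \<open>Supercategories\<close>

lemma supercategoryD:
  assumes "supercategory R C gr"
  shows "linear_category R C"
    and "\<lbrakk>X \<in> ob C; Y \<in> ob C\<rbrakk> \<Longrightarrow> supermodule R (Hom C X Y) (gr X Y)"
    and "X \<in> ob C \<Longrightarrow> ident C X \<in> gr X X 0"
    and "\<lbrakk>X \<in> ob C; Y \<in> ob C; Z \<in> ob C; g \<in> gr Y Z d; f \<in> gr X Y e\<rbrakk> \<Longrightarrow>
      cmp C X Y Z g f \<in> gr X Z (d + e)"
  using assms by (auto simp: supercategory_def)

lemma End_superalgebra:
  assumes C: "supercategory R C gr" and X: "X \<in> ob C"
  shows "superalgebra R (End_alg C X) (gr X X)"
proof -
  interpret linear_category R C by (rule supercategoryD(1)[OF C])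
  show ?thesis
    using End_alg_k_algebra[OF X] supercategoryD(2)[OF C X X] supercategoryD(3)[OF C X]
      supercategoryD(4)[OF C X X X] supermodule_cong[of "End_alg C X" "Hom C X X" R "gr X X"]
    by (simp add: superalgebra_def)
qed

lemma quot_supercategory:
  assumes C: "supercategory R C gr" and I: "cat_ideal R C I"
    and gI: "\<And>X Y. \<lbrakk>X \<in> ob C; Y \<in> ob C\<rbrakk> \<Longrightarrow> graded_sub (Hom C X Y) (gr X Y) (I X Y)"
  shows "supercategory R (quot_cat C I) (\<lambda>X Y. quot_grading (Hom C X Y) (I X Y) (gr X Y))"
proof -
  interpret linear_category R C by (rule supercategoryD(1)[OF C])
  have "cmp (quot_cat C I) X Y Z g f \<in> quot_grading (Hom C X Z) (I X Z) (gr X Z) (d + e)"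
    if ob: "X \<in> ob C" "Y \<in> ob C" "Z \<in> ob C" and g: "g \<in> quot_grading (Hom C Y Z) (I Y Z) (gr Y Z) d"
      and f: "f \<in> quot_grading (Hom C X Y) (I X Y) (gr X Y) e" for X Y Z d e g f
  proof -
    obtain g' f' where g': "g' \<in> gr Y Z d" "g = I Y Z +>\<^bsub>Hom C Y Z\<^esub> g'"
      and f': "f' \<in> gr X Y e" "f = I X Y +>\<^bsub>Hom C X Y\<^esub> f'"
      using g f by (auto simp: quot_grading_def)
    have "cmp (quot_cat C I) X Y Z g f = I X Z +>\<^bsub>Hom C X Z\<^esub> cmp C X Y Z g' f'"
      unfolding g'(2) f'(2)
      using supermodule_carrier[OF supercategoryD(2)[OF C ob(2,3)] g'(1)]
        supermodule_carrier[OF supercategoryD(2)[OF C ob(1,2)] f'(1)]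
      by (rule quot_cat_cmp[OF I ob])
    then show ?thesis using supercategoryD(4)[OF C ob g'(1) f'(1)] by (simp add: quot_grading_def)
  qed
  then show ?thesis
    unfolding supercategory_def
    using quot_cat_linear_category[OF I] supercategoryD(3)[OF C]
      quot_supermodule[OF supercategoryD(2)[OF C] cat_idealD(1)[OF I] gI]
    by (simp add: quot_grading_def)
qed

lemma sum_ideal_graded:
  assumes C: "supercategory R C gr" and X: "\<And>n. n \<in> P \<Longrightarrow> X n \<in> ob C"
    and ob: "Y \<in> ob C" "Z \<in> ob C"
  shows "graded_sub (Hom C Y Z) (gr Y Z) (sum_ideal R C X P Y Z)"
proof -
  interpret linear_category R C by (rule supercategoryD(1)[OF C])
  let ?S = "{cmp C Y (X n) Z g f | n g f d e. n \<in> P \<and> g \<in> gr (X n) Z d \<and> f \<in> gr Y (X n) e}"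
  note M = supercategoryD(2)[OF C ob]
  have deg: "h \<in> gr Y Z 0 \<union> gr Y Z 1" if "h \<in> gr Y Z d" for h d
    using that by (cases "d = 0") auto
  have hom: "?S \<subseteq> gr Y Z 0 \<union> gr Y Z 1"
    using supercategoryD(4)[OF C ob(1) X ob(2)] deg by fastforce
  have carr: "?S \<subseteq> carrier (Hom C Y Z)" using hom supermodule_carrier[OF M] by blast
  note L = lin_span_submodule[OF Hom_module[OF ob] carr]
  have "sum_ideal R C X P Y Z = lin_span R (Hom C Y Z) ?S"
  proof
    show "lin_span R (Hom C Y Z) ?S \<subseteq> sum_ideal R C X P Y Z"
      using supermodule_carrier[OF supercategoryD(2)[OF C]] X ob
      by (intro lin_span_least sum_ideal_submodule) (auto intro!: composite_in_sum_ideal)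
    show "sum_ideal R C X P Y Z \<subseteq> lin_span R (Hom C Y Z) ?S"
    proof (rule sum_ideal_least[OF L])
      fix n g f assume n: "n \<in> P" and g: "g \<in> carrier (Hom C (X n) Z)" and f: "f \<in> carrier (Hom C Y (X n))"
      note gM = supercategoryD(2)[OF C X[OF n] ob(2)] and fM = supercategoryD(2)[OF C ob(1) X[OF n]]
      obtain g0 g1 where gg: "g0 \<in> gr (X n) Z 0" "g1 \<in> gr (X n) Z 1" "g = g0 \<oplus>\<^bsub>Hom C (X n) Z\<^esub> g1"
        using gM g by (auto simp: supermodule_def elim: set_addE)
      obtain f0 f1 where ff: "f0 \<in> gr Y (X n) 0" "f1 \<in> gr Y (X n) 1" "f = f0 \<oplus>\<^bsub>Hom C Y (X n)\<^esub> f1"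
        using fM f by (auto simp: supermodule_def elim: set_addE)
      have c: "g0 \<in> carrier (Hom C (X n) Z)" "g1 \<in> carrier (Hom C (X n) Z)"
        "f0 \<in> carrier (Hom C Y (X n))" "f1 \<in> carrier (Hom C Y (X n))"
        using supermodule_carrier[OF gM] supermodule_carrier[OF fM] gg ff by auto
      have in_L: "cmp C Y (X n) Z g' f' \<in> lin_span R (Hom C Y Z) ?S"
        if "g' \<in> gr (X n) Z d" "f' \<in> gr Y (X n) e" for g' f' d e
        using that n by (intro subsetD[OF lin_span_incl]) blast
      \<comment> \<open>Splitting both legs by parity and expanding bilinearly gives four composites
        of homogeneous morphisms, each a generator of the homogeneous span.\<close>
      have "cmp C Y (X n) Z g f = (cmp C Y (X n) Z g0 f0 \<oplus>\<^bsub>Hom C Y Z\<^esub> cmp C Y (X n) Z g0 f1) \<oplus>\<^bsub>Hom C Y Z\<^esub>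
          (cmp C Y (X n) Z g1 f0 \<oplus>\<^bsub>Hom C Y Z\<^esub> cmp C Y (X n) Z g1 f1)"
        unfolding gg(3) using c f X[OF n] ob
        by (simp add: cmp_add_left) (simp add: ff(3) cmp_add_right)
      then show "cmp C Y (X n) Z g f \<in> lin_span R (Hom C Y Z) ?S"
        using in_L gg ff submoduleD(3)[OF L] by simp
    qed
  qed
  then show ?thesis using graded_sub_lin_span[OF M hom] by simp
qed

section \<open>Parity on the standard filter\<close>

context filtered_category
begin

context
  fixes gr assumes C: "supercategory R C gr"
    and B_graded: "\<And>l. graded_sub (End_alg C (X l)) (gr (X l) (X l)) (B l)"
begin

abbreviation "gB l \<equiv> (\<lambda>d. B l \<inter> gr (X l) (X l) d)"
abbreviation "gQ l \<equiv> below_grading R C X l gr"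
abbreviation "S l \<equiv> quot (sub_End C X B l) (B_ker R C X B l)"
abbreviation "gS l \<equiv> quot_grading (sub_End C X B l) (B_ker R C X B l) (gB l)"

lemma X_supermodule: "supermodule R (Hom C (X l) (X m)) (gr (X l) (X m))"
  by (rule supercategoryD(2)[OF C X_ob X_ob])

lemma Q_supercategory: "supercategory R (Q l) (gQ l)"
  using quot_supercategory[OF C cat_ideal_sum sum_ideal_graded[OF C X_ob]]
  by (simp add: quot_below_def below_grading_def[abs_def])

lemma gQ_supermodule: "supermodule R (Hom (Q l) (X m) (X n)) (gQ l (X m) (X n))"
  using supercategoryD(2)[OF Q_supercategory, of "X m" l "X n"] X_ob by (simp add: quot_below_def)

lemma gQ_cmp:
  "\<lbrakk>g \<in> gQ l (X n) (X p) d; f \<in> gQ l (X m) (X n) e\<rbrakk> \<Longrightarrow>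
    cmp (Q l) (X m) (X n) (X p) g f \<in> gQ l (X m) (X p) (d + e)"
  using supercategoryD(4)[OF Q_supercategory, of "X m" l "X n" "X p"] X_ob by (simp add: quot_below_def)

lemma B_graded_Hom: "graded_sub (Hom C (X l) (X l)) (gr (X l) (X l)) (B l)"
  using B_graded[of l] graded_sub_cong[of "End_alg C (X l)" "Hom C (X l) (X l)"] by simp

lemma sub_End_superalgebra: "superalgebra R (sub_End C X B l) (gB l)"
  unfolding sub_End_def
  by (rule sub_superalgebra[OF End_superalgebra[OF C X_ob] B_subalg B_graded])

lemma B_ker_graded: "graded_sub (sub_End C X B l) (gB l) (B_ker R C X B l)"
proof -
  have "graded_sub (Hom C (X l) (X l)) (gr (X l) (X l)) (B_ker R C X B l)"
    unfolding B_ker_eq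
    by (rule graded_sub_Int[OF X_supermodule B_submodule B_graded_Hom sum_submodule
          sum_ideal_graded[OF C X_ob X_ob X_ob]])
  moreover have "B_ker R C X B l \<inter> gB l d = B_ker R C X B l \<inter> gr (X l) (X l) d" for d
    by (auto simp: B_ker_eq)
  ultimately show ?thesis by (simp add: graded_sub_def set_add_def')
qed

lemma S_superalgebra: "superalgebra R (S l) (gS l)"
  by (rule quot_superalgebra[OF sub_End_superalgebra B_ker_ideal B_ker_graded])

text \<open>A homogeneous \<open>f\<close> is \<open>b + i\<close> with \<open>i\<close> in the
  ideal, but \<open>b\<close> need not be homogeneous. Splitting \<open>b = y + z\<close> by parity,
  the graded ideal contains \<open>i = (f - y) - z\<close> and hence its component
  \<open>f - y\<close>; so \<open>y\<close>, which lies in the graded \<open>B l\<close>, represents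
  the coset of \<open>f\<close>.\<close>

lemma canon_grading: "canon R C X l ` gS l d = gQ l (X l) (X l) d"
proof -
  let ?E = "Hom C (X l) (X l)" and ?I = "I l (X l) (X l)"
  interpret E: module R ?E by (rule Hom_X_module)
  have "canon R C X l ` gS l d = (\<lambda>b. ?I +>\<^bsub>?E\<^esub> b) ` gB l d"
    unfolding quot_grading_def image_image
    by (intro image_cong) (auto simp: canon_coset proj_below_def)
  also have "\<dots> = (\<lambda>f. ?I +>\<^bsub>?E\<^esub> f) ` gr (X l) (X l) d"
  proof
    show "(\<lambda>f. ?I +>\<^bsub>?E\<^esub> f) ` gr (X l) (X l) d \<subseteq> (\<lambda>b. ?I +>\<^bsub>?E\<^esub> b) ` gB l d"
    proof
      fix u assume "u \<in> (\<lambda>f. ?I +>\<^bsub>?E\<^esub> f) ` gr (X l) (X l) d"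
      then obtain f where f: "f \<in> gr (X l) (X l) d" "u = ?I +>\<^bsub>?E\<^esub> f" by blast
      note c = supermodule_carrier[OF X_supermodule]
      obtain b i where bi: "b \<in> B l" "i \<in> ?I" "f = b \<oplus>\<^bsub>?E\<^esub> i"
        using c[OF f(1)] End_eq[of l] by (auto simp: set_add_def')
      obtain y z where yz: "y \<in> B l \<inter> gr (X l) (X l) d" "z \<in> B l \<inter> gr (X l) (X l) (d + 1)" "b = y \<oplus>\<^bsub>?E\<^esub> z"
        by (rule graded_sub_decompose[OF X_supermodule B_graded_Hom bi(1)])
      have carr: "f \<in> carrier ?E" "y \<in> carrier ?E" "z \<in> carrier ?E" "i \<in> carrier ?E"
        using c f yz bi submoduleD(1)[OF sum_submodule] by auto
      have "(f \<ominus>\<^bsub>?E\<^esub> y) \<oplus>\<^bsub>?E\<^esub> (\<ominus>\<^bsub>?E\<^esub> z) = i"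
      proof -
        have "(f \<ominus>\<^bsub>?E\<^esub> y) \<oplus>\<^bsub>?E\<^esub> (\<ominus>\<^bsub>?E\<^esub> z) = f \<oplus>\<^bsub>?E\<^esub> \<ominus>\<^bsub>?E\<^esub> (y \<oplus>\<^bsub>?E\<^esub> z)"
          using carr by (simp add: a_minus_def E.M.a_assoc E.M.minus_add)
        moreover have "f = i \<oplus>\<^bsub>?E\<^esub> (y \<oplus>\<^bsub>?E\<^esub> z)"
          unfolding bi(3) yz(3) using carr by (simp add: E.M.a_comm)
        ultimately show ?thesis using carr by (simp add: E.M.a_assoc E.M.r_neg)
      qed
      moreover have "f \<ominus>\<^bsub>?E\<^esub> y \<in> gr (X l) (X l) d" "\<ominus>\<^bsub>?E\<^esub> z \<in> gr (X l) (X l) (d + 1)"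
        using f yz submoduleD(3,4)[OF supermodule_submodule[OF X_supermodule]] by (auto simp: a_minus_def)
      ultimately have "f \<ominus>\<^bsub>?E\<^esub> y \<in> ?I"
        using graded_sub_component[OF X_supermodule sum_submodule sum_ideal_graded[OF C X_ob X_ob X_ob]] bi(2)
        by metis
      then have "u = ?I +>\<^bsub>?E\<^esub> y" using f carr E.coset_eq_iff[OF sum_submodule] by simp
      then show "u \<in> (\<lambda>b. ?I +>\<^bsub>?E\<^esub> b) ` gB l d" using yz by blast
    qed
  qed blast
  finally show ?thesis by (simp add: below_grading_def quot_grading_def)
qed

lemma canon_homogeneous: "b \<in> gS l d \<Longrightarrow> canon R C X l b \<in> gQ l (X l) (X l) d"
  using canon_grading by blast

lemma M_superbimodule:
  assumes "bimodule R (End_alg (Q l) (X w)) (S l) (M_mod R C X w l)"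
  shows "superbimodule R (End_alg (Q l) (X w)) (gQ l (X w) (X w)) (S l) (gS l)
    (M_mod R C X w l) (gQ l (X l) (X w))"
  unfolding superbimodule_def
proof (intro conjI allI ballI)
  show "supermodule R (M_mod R C X w l) (gQ l (X l) (X w))"
    using gQ_supermodule by (subst supermodule_cong[of _ "Hom (Q l) (X l) (X w)"]) simp_all
qed (simp_all only: assms M_mod_simps gQ_cmp canon_homogeneous)

lemma N_superbimodule:
  assumes "bimodule R (S l) (End_alg (Q l) (X w)) (N_mod R C X w l)"
  shows "superbimodule R (S l) (gS l) (End_alg (Q l) (X w)) (gQ l (X w) (X w))
    (N_mod R C X w l) (gQ l (X w) (X l))"
  unfolding superbimodule_def
proof (intro conjI allI ballI)
  show "supermodule R (N_mod R C X w l) (gQ l (X w) (X l))"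
    using gQ_supermodule by (subst supermodule_cong[of _ "Hom (Q l) (X w) (X l)"]) simp_all
qed (simp_all only: assms N_mod_simps gQ_cmp canon_homogeneous)

text \<open>Tensors of a given parity are spanned by pure ones, and the preimage of a homogeneous
  part is a submodule, so only values on pure tensors matter. For \<eta> these are composites of
  homogeneous morphisms.\<close>

lemma structure_maps_super_morita_context:
  assumes "structure_maps w l \<eta> \<rho>"
  shows "super_morita_context R (End_alg (Q l) (X w)) (gQ l (X w) (X w)) (S l) (gS l)
    (M_mod R C X w l) (gQ l (X l) (X w)) (N_mod R C X w l) (gQ l (X w) (X l)) \<eta> \<rho>"
proof -
  let ?A = "End_alg (Q l) (X w)" and ?M = "M_mod R C X w l" and ?N = "N_mod R C X w l"
  note s = assms[unfolded structure_maps_def Let_def]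
  have mc: "morita_context R ?A (S l) ?M ?N \<eta> \<rho>" using s by blast
  then have M: "bimodule R ?A (S l) ?M" and N: "bimodule R (S l) ?A ?N"
    by (auto simp: morita_context_def)
  interpret MN: tensor_pair R ?A "S l" ?A ?M ?N using M N by (rule tensor_pair.intro)
  interpret NM: tensor_pair R "S l" ?A "S l" ?N ?M using N M by (rule tensor_pair.intro)
  have c: "x \<in> gQ l (X m) (X n) d \<Longrightarrow> x \<in> carrier (Hom (Q l) (X m) (X n))" for x m n d
    using supermodule_carrier[OF gQ_supermodule] .
  have "tensor_grading R (S l) ?M (gQ l (X l) (X w)) ?N (gQ l (X w) (X l)) d
      \<subseteq> {t \<in> carrier (tensor (S l) ?M ?N). \<eta> t \<in> gQ l (X w) (X w) d}" for d
    unfolding tensor_grading_def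
  proof (rule lin_span_least)
    show "submodule {t \<in> carrier (tensor (S l) ?M ?N). \<eta> t \<in> gQ l (X w) (X w) d} R (tensor (S l) ?M ?N)"
      using s supermodule_submodule[OF gQ_supermodule] by blast
    have "\<eta> (pure_tensor (S l) ?M ?N x y) \<in> gQ l (X w) (X w) (i + j)"
      if xy: "x \<in> gQ l (X l) (X w) i" "y \<in> gQ l (X w) (X l) j" for x y i j
      using s c[OF xy(1)] c[OF xy(2)] gQ_cmp[OF xy] by simp
    then show "{pure_tensor (S l) ?M ?N x y | x y i j. x \<in> gQ l (X l) (X w) i \<and> y \<in> gQ l (X w) (X l) j \<and> i + j = d}
        \<subseteq> {t \<in> carrier (tensor (S l) ?M ?N). \<eta> t \<in> gQ l (X w) (X w) d}"
      using MN.pure_tensor_closed c by (auto simp only: M_mod_simps N_mod_simps)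
  qed
  moreover have "tensor_grading R ?A ?N (gQ l (X w) (X l)) ?M (gQ l (X l) (X w)) d
      \<subseteq> {t \<in> carrier (tensor ?A ?N ?M). \<rho> t \<in> gS l d}" for d
    unfolding tensor_grading_def
  proof (rule lin_span_least)
    have SM: "supermodule R (S l) (gS l)" using S_superalgebra by (simp add: superalgebra_def)
    then show "submodule {t \<in> carrier (tensor ?A ?N ?M). \<rho> t \<in> gS l d} R (tensor ?A ?N ?M)"
      using s supermodule_submodule by blast
    \<comment> \<open>The value of \<rho> is known only after applying \<open>canon\<close>;
      \<open>canon_grading\<close> supplies a homogeneous preimage of that value, and injectivity
      identifies it with the value of \<rho>.\<close>
    have inj: "inj_on (canon R C X l) (carrier (S l))"
      using canon_alg_iso[of l] by (auto simp: alg_iso_def ring_iso_def bij_betw_def)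
    have "\<rho> (pure_tensor ?A ?N ?M y x) \<in> gS l (j + i)"
      if xy: "x \<in> gQ l (X l) (X w) i" "y \<in> gQ l (X w) (X l) j" for x y i j
    proof -
      let ?r = "\<rho> (pure_tensor ?A ?N ?M y x)"
      have r: "?r \<in> carrier (S l)" "canon R C X l ?r = cmp (Q l) (X l) (X w) (X l) y x"
        using s c[OF xy(1)] c[OF xy(2)] by auto
      then have "canon R C X l ?r \<in> canon R C X l ` gS l (j + i)"
        unfolding canon_grading using gQ_cmp[OF xy(2,1)] by simp
      then obtain u where u: "u \<in> gS l (j + i)" "canon R C X l ?r = canon R C X l u" by blast
      have "?r = u" using inj_onD[OF inj u(2) r(1)] supermodule_carrier[OF SM u(1)] by simp
      then show ?thesis using u(1) by simp
    qed
    then show "{pure_tensor ?A ?N ?M x y | x y i j. x \<in> gQ l (X w) (X l) i \<and> y \<in> gQ l (X l) (X w) j \<and> i + j = d}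
        \<subseteq> {t \<in> carrier (tensor ?A ?N ?M). \<rho> t \<in> gS l d}"
      using NM.pure_tensor_closed c by (auto simp only: M_mod_simps N_mod_simps)
  qed
  moreover have "superalgebra R ?A (gQ l (X w) (X w))"
    by (rule End_superalgebra[OF Q_supercategory]) (simp add: quot_below_def X_ob)
  ultimately show ?thesis
    unfolding super_morita_context_def
    using mc S_superalgebra M_superbimodule[OF M] N_superbimodule[OF N] by blast
qed

theorem structure_maps_super_standard_filter:
  assumes s: "\<And>l. structure_maps w l (\<eta> l) (\<rho> l)"
  shows "super_standard_filter R (End_alg C (X w)) (gr (X w) (X w)) (sub_End C X B) gB
    (End_filter R C X w) (B_ker R C X B) (M_mod R C X w) (\<lambda>l. gQ l (X l) (X w))
    (N_mod R C X w) (\<lambda>l. gQ l (X w) (X l)) \<eta> \<rho>"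
proof -
  \<comment> \<open>The grading induced on the quotient of \<open>A\<close> agrees with that of the
    endomorphism algebra in \<open>Q l\<close>: both are images of the homogeneous parts under the
    same projection.\<close>
  have "quot_grading (End_alg C (X w)) (filter_below R (End_alg C (X w)) (End_filter R C X w) l) (gr (X w) (X w))
      = gQ l (X w) (X w)" for l
    by (simp add: quot_grading_def below_grading_def filter_below_eq End_alg_coset fun_eq_iff)
  moreover have "graded_sub (End_alg C (X w)) (gr (X w) (X w)) (End_filter R C X w l)" for l
    using sum_ideal_graded[OF C X_ob X_ob X_ob]
      graded_sub_cong[of "End_alg C (X w)" "Hom C (X w) (X w)"] by (simp add: End_filter_def)
  ultimately show ?thesis
    unfolding super_standard_filter_def quot_filter_below
    using structure_maps_standard_filter[OF s] End_superalgebra[OF C X_ob] sub_End_superalgebra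
      B_ker_graded structure_maps_super_morita_context[OF s] by simp
qed

end

end

theorem lemma0p5:
  fixes R :: "('k, 'r) ring_scheme"
    and C :: "('o, 'k, 'm) lincat"
    and X :: "'l::{finite, order} \<Rightarrow> 'o"
    and B :: "'l \<Rightarrow> 'm set"
  assumes "cring R"
    and "linear_category R C"
    and "\<And>l. X l \<in> ob C"
    and "\<And>l. subalg R (End_alg C (X l)) (B l)"
    and "\<And>l m. carrier (Hom C (X m) (X l)) = sum_ideal R C X ({..l} \<inter> {..m}) (X m) (X l)"
    and "\<And>l. carrier (End_alg C (X l)) =
               B l <+>\<^bsub>End_alg C (X l)\<^esub> sum_ideal R C X {..<l} (X l) (X l)"
  shows "\<forall>w. \<exists>\<eta> \<rho>.
    standard_filter R (End_alg C (X w)) (sub_End C X B) (End_filter R C X w) (B_ker R C X B)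
      (M_mod R C X w) (N_mod R C X w) \<eta> \<rho> \<and>
    (\<forall>l. quot (End_alg C (X w)) (filter_below R (End_alg C (X w)) (End_filter R C X w) l) =
         End_alg (quot_below R C X l) (X w)) \<and>
    (\<forall>l. canon R C X l \<in> alg_iso R (quot (sub_End C X B l) (B_ker R C X B l))
                                     (End_alg (quot_below R C X l) (X l))) \<and>
    (\<forall>l. \<forall>x\<in>carrier (Hom (quot_below R C X l) (X l) (X w)).
         \<forall>y\<in>carrier (Hom (quot_below R C X l) (X w) (X l)).
      \<eta> l (pure_tensor (quot (sub_End C X B l) (B_ker R C X B l))
            (M_mod R C X w l) (N_mod R C X w l) x y) =
        cmp (quot_below R C X l) (X w) (X l) (X w) x y \<and>
      canon R C X l (\<rho> l (pure_tensor (End_alg (quot_below R C X l) (X w))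
            (N_mod R C X w l) (M_mod R C X w l) y x)) =
        cmp (quot_below R C X l) (X l) (X w) (X l) y x) \<and>
    (\<forall>gr. supercategory R C gr \<and>
          (\<forall>l. graded_sub (End_alg C (X l)) (gr (X l) (X l)) (B l)) \<longrightarrow>
      super_standard_filter R
        (End_alg C (X w)) (gr (X w) (X w))
        (sub_End C X B) (\<lambda>l d. B l \<inter> gr (X l) (X l) d)
        (End_filter R C X w) (B_ker R C X B)
        (M_mod R C X w) (\<lambda>l. below_grading R C X l gr (X l) (X w))
        (N_mod R C X w) (\<lambda>l. below_grading R C X l gr (X w) (X l)) \<eta> \<rho> \<and>
      (\<forall>l d. canon R C X l ` quot_grading (sub_End C X B l) (B_ker R C X B l)
                  (\<lambda>e. B l \<inter> gr (X l) (X l) e) d =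
             below_grading R C X l gr (X l) (X l) d))"
proof
  fix w
  interpret filtered_category R C X B
    using assms by (simp add: filtered_category_def filtered_category_axioms_def)
  \<comment> \<open>The maps are chosen for every \<open>l\<close> before a grading is considered,
    as the order of the quantifiers demands; \<open>structure_maps\<close> does not mention
    \<open>gr\<close>, so the same choice serves all gradings.\<close>
  obtain \<eta> \<rho> where s: "\<And>l. structure_maps w l (\<eta> l) (\<rho> l)"
    using structure_maps_exist by metis
  note s' = s[unfolded structure_maps_def Let_def]
  show "\<exists>\<eta> \<rho>.
    standard_filter R (End_alg C (X w)) (sub_End C X B) (End_filter R C X w) (B_ker R C X B)
      (M_mod R C X w) (N_mod R C X w) \<eta> \<rho> \<and>
    (\<forall>l. quot (End_alg C (X w)) (filter_below R (End_alg C (X w)) (End_filter R C X w) l) =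
         End_alg (quot_below R C X l) (X w)) \<and>
    (\<forall>l. canon R C X l \<in> alg_iso R (quot (sub_End C X B l) (B_ker R C X B l))
                                     (End_alg (quot_below R C X l) (X l))) \<and>
    (\<forall>l. \<forall>x\<in>carrier (Hom (quot_below R C X l) (X l) (X w)).
         \<forall>y\<in>carrier (Hom (quot_below R C X l) (X w) (X l)).
      \<eta> l (pure_tensor (quot (sub_End C X B l) (B_ker R C X B l))
            (M_mod R C X w l) (N_mod R C X w l) x y) =
        cmp (quot_below R C X l) (X w) (X l) (X w) x y \<and>
      canon R C X l (\<rho> l (pure_tensor (End_alg (quot_below R C X l) (X w))
            (N_mod R C X w l) (M_mod R C X w l) y x)) =
        cmp (quot_below R C X l) (X l) (X w) (X l) y x) \<and>
    (\<forall>gr. supercategory R C gr \<and>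
          (\<forall>l. graded_sub (End_alg C (X l)) (gr (X l) (X l)) (B l)) \<longrightarrow>
      super_standard_filter R
        (End_alg C (X w)) (gr (X w) (X w))
        (sub_End C X B) (\<lambda>l d. B l \<inter> gr (X l) (X l) d)
        (End_filter R C X w) (B_ker R C X B)
        (M_mod R C X w) (\<lambda>l. below_grading R C X l gr (X l) (X w))
        (N_mod R C X w) (\<lambda>l. below_grading R C X l gr (X w) (X l)) \<eta> \<rho> \<and>
      (\<forall>l d. canon R C X l ` quot_grading (sub_End C X B l) (B_ker R C X B l)
                  (\<lambda>e. B l \<inter> gr (X l) (X l) e) d =
             below_grading R C X l gr (X l) (X l) d))"
    using structure_maps_standard_filter[OF s] quot_filter_below canon_alg_iso s'
      structure_maps_super_standard_filter[OF _ _ s] canon_grading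
    by (intro exI[of _ \<eta>] exI[of _ \<rho>] conjI allI impI ballI) blast+
qed

end
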